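(* Let $Y=[0,1]^N$, let $0<a_1\le a_2<\infty$ and $0<b_1\le b_2<\infty$, and let $A=[a_{kl}]\in\mathcal{M}(a_1,a_2;Y)$ and $B=[b_{kl}]\in\mathcal{M}(b_1,b_2;Y)$ have $Y$-periodic entries. Let $\delta>0$ and, for $\eta\in B_\delta=\{\eta\in\mathbb{R}^N:|\eta|<\delta\}$, let $\varphi_{1,A}(\cdot;\eta)\in H^1_{\#}(Y)$ be the analytic normalized choice of first Bloch eigenvector of $\mathcal{A}(\eta)$ described in the context. Define $\nu_1:B_\delta\to\mathbb{C}$ by $$\nu_1(\eta)=\langle\mathcal{B}(\eta)\varphi_{1,A}(\cdot;\eta),\varphi_{1,A}(\cdot;\eta)\rangle_{L^2(Y)}=\frac{1}{|Y|}\int_Y B(y)\big(\nabla_y\varphi_{1,A}(y;\eta)+i\eta\,\varphi_{1,A}(y;\eta)\big)\cdot\overline{\big(\nabla_y\varphi_{1,A}(y;\eta)+i\eta\,\varphi_{1,A}(y;\eta)\big)}\,dy .$$ Then $\nu_1$ is analytic on $B_\delta$, and for all $k,l=1,\dots,N$, $$\nu_1(0)=0,\qquad \frac{\partial\nu_1}{\partial\eta_k}(0)=0,\qquad \frac12\frac{\partial^2\nu_1}{\partial\eta_k\partial\eta_l}(0)=b^{\#}_{kl},$$ where $$b^{\#}_{kl}=\int_Y B(y)\,\nabla_y(\chi_k(y)+y_k)\cdot\nabla_y(\chi_l(y)+y_l)\,dy .$$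
   Context: Summation over repeated indices is understood. For $0<\alpha\le\beta$, $\mathcal{M}(\alpha,\beta;Y)$ is the set of real symmetric $N\times N$ matrices $M(y)$ of measurable functions on $Y$ with $(M(y)\xi,\xi)\ge\alpha|\xi|^2$ and $|M(y)\xi|\le\beta|\xi|$ for all $\xi\in\mathbb{R}^N$ and a.e. $y\in Y$. $H^1_{\#}(Y)$ is the space of $Y$-periodic (complex-valued) functions in $H^1_{loc}(\mathbb{R}^N)$. Analytic means real analytic in $\eta$. Cell functions: for $k=1,\dots,N$, $\chi_k\in H^1_{\#}(Y)$ is the unique $Y$-periodic solution with $\int_Y\chi_k\,dy=0$ of $-\mathrm{div}_y\big(A(y)(\nabla_y\chi_k(y)+e_k)\big)=0$, where $\{e_k\}$ is the standard basis of $\mathbb{R}^N$. The matrix $B^{\#}=[b^{\#}_{kl}]$ is the limit of $B^\epsilon(x)=B(x/\epsilon)$ relative to $A^\epsilon(x)=A(x/\epsilon)$. Shifted operators: for $\eta\in\mathbb{R}^N$, acting on $Y$-periodic functions, $$\mathcal{A}(\eta)=-\left(\frac{\partial}{\partial y_k}+i\eta_k\right)\left[a_{kl}(y)\left(\frac{\partial}{\partial y_l}+i\eta_l\right)\right],\qquad \mathcal{B}(\eta)=-\left(\frac{\partial}{\partial y_k}+i\eta_k\right)\left[b_{kl}(y)\left(\frac{\partial}{\partial y_l}+i\eta_l\right)\right],$$ and $\langle\mathcal{B}(\eta)\varphi,\varphi\rangle_{L^2(Y)}$ is understood as the associated sesquilinear form. The operator $\mathcal{A}(\eta)$ with periodic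 boundary conditions has a discrete sequence of real eigenvalues $0\le\lambda_1(\eta)\le\lambda_2(\eta)\le\cdots\to\infty$. Choice of first eigenvector (known regularity result for the Bloch ground state): there is $\delta>0$ such that $\lambda_1$ is analytic on $B_\delta$ and there is a choice of eigenvector $\varphi_{1,A}(\cdot;\eta)$ of $\mathcal{A}(\eta)$ for $\lambda_1(\eta)$ such that $\eta\mapsto\varphi_{1,A}(\cdot;\eta)\in H^1_{\#}(Y)$ is analytic on $B_\delta$, $\varphi_{1,A}(y;0)=|Y|^{-1/2}$, $\|\varphi_{1,A}(\cdot;\eta)\|_{L^2(Y)}=1$ and $\mathrm{Im}\int_Y\varphi_{1,A}(y;\eta)\,dy=0$ for $\eta\in B_\delta$. This $\delta$ and this choice are fixed. (It is also known that $\frac{\partial\varphi_{1,A}}{\partial\eta_k}(\cdot;0)=i|Y|^{-1/2}\chi_k$.) *)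

theory Defs
  imports "HOL-Analysis.Analysis"
begin

text \<open>The periodicity cell \<open>Y = [0,1]\<^sup>N\<close>; in \<open>real ^ 'n\<close>, \<open>1\<close> is the all-ones vector.\<close>

definition cell :: "(real ^ 'n) set" where
  "cell = cbox 0 1"

text \<open>Functions stand for their almost-everywhere classes, so periodicity is required
  almost everywhere only.\<close>

definition periodic :: "(real ^ 'n \<Rightarrow> 'a) \<Rightarrow> bool" where
  "periodic f \<longleftrightarrow> (\<forall>k. AE y in lebesgue. f (y + axis k 1) = f y)"

definition coeff_class :: "real \<Rightarrow> real \<Rightarrow> (real ^ 'n \<Rightarrow> real ^ 'n ^ 'n) set" where
  "coeff_class \<alpha> \<beta> = {M.
     (\<forall>k l. (\<lambda>y. M y $ k $ l) \<in> borel_measurable (lebesgue_on cell)) \<and>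
     (AE y\<in>cell in lebesgue. transpose (M y) = M y) \<and>
     (AE y\<in>cell in lebesgue. \<forall>\<xi>. (M y *v \<xi>) \<bullet> \<xi> \<ge> \<alpha> * (norm \<xi>)\<^sup>2 \<and> norm (M y *v \<xi>) \<le> \<beta> * norm \<xi>)}"

definition partial_deriv :: "'n \<Rightarrow> (real ^ 'n \<Rightarrow> 'a::real_normed_vector) \<Rightarrow> real ^ 'n \<Rightarrow> 'a" where
  "partial_deriv k f x = vector_derivative (\<lambda>t. f (x + t *\<^sub>R axis k 1)) (at 0)"

text \<open>\<open>C\<^sub>c\<^sup>\<infinity>\<close>: every iterated partial derivative is (totally) differentiable everywhere.\<close>

definition test_function :: "(real ^ 'n \<Rightarrow> real) \<Rightarrow> bool" where
  "test_function \<phi> \<longleftrightarrow>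
     compact (closure {x. \<phi> x \<noteq> 0}) \<and>
     (\<forall>ks. \<forall>x. foldr partial_deriv ks \<phi> differentiable (at x))"

definition L2_loc :: "(real ^ 'n \<Rightarrow> 'a::euclidean_space) \<Rightarrow> bool" where
  "L2_loc u \<longleftrightarrow> u \<in> borel_measurable lebesgue \<and>
     (\<forall>K. compact K \<longrightarrow> set_integrable lebesgue K (\<lambda>y. (norm (u y))\<^sup>2))"

definition has_weak_gradient :: "(real ^ 'n \<Rightarrow> complex) \<Rightarrow> (real ^ 'n \<Rightarrow> complex ^ 'n) \<Rightarrow> bool" where
  "has_weak_gradient u g \<longleftrightarrow> L2_loc g \<and>
     (\<forall>\<phi> k. test_function \<phi> \<longrightarrow>
        (LINT y|lebesgue. partial_deriv k \<phi> y *\<^sub>R u y) = - (LINT y|lebesgue. \<phi> y *\<^sub>R g y $ k))"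

text \<open>The weak gradient is unique only up to null sets; below it occurs only under integrals.\<close>

definition weak_gradient :: "(real ^ 'n \<Rightarrow> complex) \<Rightarrow> real ^ 'n \<Rightarrow> complex ^ 'n" where
  "weak_gradient u = (SOME g. has_weak_gradient u g)"

definition H1_per :: "(real ^ 'n \<Rightarrow> complex) set" where
  "H1_per = {u. periodic u \<and> L2_loc u \<and> (\<exists>g. has_weak_gradient u g)}"

definition L2_inner :: "(real ^ 'n \<Rightarrow> complex) \<Rightarrow> (real ^ 'n \<Rightarrow> complex) \<Rightarrow> complex" where
  "L2_inner u v = (LINT y:cell|lebesgue. u y * cnj (v y))"

definition L2_norm :: "(real ^ 'n \<Rightarrow> complex) \<Rightarrow> real" where
  "L2_norm u = sqrt (LINT y:cell|lebesgue. (norm (u y))\<^sup>2)"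

definition H1_norm :: "(real ^ 'n \<Rightarrow> complex) \<Rightarrow> real" where
  "H1_norm u = sqrt (LINT y:cell|lebesgue. (norm (u y))\<^sup>2 + (norm (weak_gradient u y))\<^sup>2)"

text \<open>The dot product of \<open>\<complex>\<^sup>N\<close> is bilinear; conjugations are written out where they occur.
  (The library's \<open>\<bullet>\<close> on \<open>complex ^ 'n\<close> is the real inner product.)\<close>

definition cdot :: "complex ^ 'n \<Rightarrow> complex ^ 'n \<Rightarrow> complex" where
  "cdot z w = (\<Sum>i\<in>UNIV. z $ i * w $ i)"

definition cnj_vec :: "complex ^ 'n \<Rightarrow> complex ^ 'n" where
  "cnj_vec z = (\<chi> i. cnj (z $ i))"

definition cmat :: "real ^ 'n ^ 'n \<Rightarrow> complex ^ 'n ^ 'n" where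
  "cmat M = map_matrix complex_of_real M"

definition shifted_gradient :: "real ^ 'n \<Rightarrow> (real ^ 'n \<Rightarrow> complex) \<Rightarrow> real ^ 'n \<Rightarrow> complex ^ 'n" where
  "shifted_gradient \<eta> u y = (\<chi> k. weak_gradient u y $ k + \<i> * complex_of_real (\<eta> $ k) * u y)"

text \<open>The sesquilinear form \<open>\<langle>\<M>(\<eta>)u, v\<rangle>\<close> on \<open>H1_per\<close> of the operator
  \<open>\<M>(\<eta>) = -(\<partial>\<^sub>k + i\<eta>\<^sub>k)[m\<^sub>k\<^sub>l(\<partial>\<^sub>l + i\<eta>\<^sub>l)]\<close> with periodic boundary conditions.\<close>

definition shifted_form ::
  "(real ^ 'n \<Rightarrow> real ^ 'n ^ 'n) \<Rightarrow> real ^ 'n \<Rightarrow> (real ^ 'n \<Rightarrow> complex) \<Rightarrow> (real ^ 'n \<Rightarrow> complex) \<Rightarrow> complex" where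
  "shifted_form M \<eta> u v =
     (LINT y:cell|lebesgue.
        cdot (cmat (M y) *v shifted_gradient \<eta> u y) (cnj_vec (shifted_gradient \<eta> v y)))"

definition bloch_eigenvector ::
  "(real ^ 'n \<Rightarrow> real ^ 'n ^ 'n) \<Rightarrow> real ^ 'n \<Rightarrow> real \<Rightarrow> (real ^ 'n \<Rightarrow> complex) \<Rightarrow> bool" where
  "bloch_eigenvector A \<eta> \<mu> u \<longleftrightarrow>
     u \<in> H1_per \<and> \<not> (AE y in lebesgue. u y = 0) \<and>
     (\<forall>v\<in>H1_per. shifted_form A \<eta> u v = complex_of_real \<mu> * L2_inner u v)"

definition bloch_lambda1 :: "(real ^ 'n \<Rightarrow> real ^ 'n ^ 'n) \<Rightarrow> real ^ 'n \<Rightarrow> real" where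
  "bloch_lambda1 A \<eta> = (LEAST \<mu>. \<exists>u. bloch_eigenvector A \<eta> \<mu> u)"

text \<open>Weak form of \<open>-div (A (\<nabla>w + e\<^sub>k)) = 0\<close> with periodic boundary conditions.\<close>

definition cell_function ::
  "(real ^ 'n \<Rightarrow> real ^ 'n ^ 'n) \<Rightarrow> 'n \<Rightarrow> (real ^ 'n \<Rightarrow> complex) \<Rightarrow> bool" where
  "cell_function A k w \<longleftrightarrow>
     w \<in> H1_per \<and> (LINT y:cell|lebesgue. w y) = 0 \<and>
     (\<forall>v\<in>H1_per.
        (LINT y:cell|lebesgue.
           cdot (cmat (A y) *v (weak_gradient w y + axis k 1)) (cnj_vec (weak_gradient v y))) = 0)"

text \<open>The entries \<open>b\<^sup>#\<^sub>k\<^sub>l\<close>, with \<open>\<nabla>(\<chi>\<^sub>k + y\<^sub>k) = \<nabla>\<chi>\<^sub>k + e\<^sub>k\<close>.\<close>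

definition relative_limit ::
  "(real ^ 'n \<Rightarrow> real ^ 'n ^ 'n) \<Rightarrow> ('n \<Rightarrow> real ^ 'n \<Rightarrow> complex) \<Rightarrow> 'n \<Rightarrow> 'n \<Rightarrow> complex" where
  "relative_limit B chi k l =
     (LINT y:cell|lebesgue.
        cdot (cmat (B y) *v (weak_gradient (chi k) y + axis k 1)) (weak_gradient (chi l) y + axis l 1))"

definition monomial :: "('n \<Rightarrow> nat) \<Rightarrow> real ^ 'n \<Rightarrow> real" where
  "monomial m x = (\<Prod>i\<in>UNIV. (x $ i) ^ m i)"

definition real_analytic_on :: "(real ^ 'n \<Rightarrow> 'a::real_normed_vector) \<Rightarrow> (real ^ 'n) set \<Rightarrow> bool" where
  "real_analytic_on f S \<longleftrightarrow>
     (\<forall>a\<in>S. \<exists>r>0. ball a r \<subseteq> S \<and>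
        (\<exists>c. \<forall>x\<in>ball a r. ((\<lambda>m. monomial m (x - a) *\<^sub>R c m) has_sum f x) UNIV))"

text \<open>The same for maps into \<open>H1_per\<close>: \<open>has_sum\<close> is unfolded because the \<open>H\<^sup>1\<close> norm
  is not the norm of a type.\<close>

definition H1_analytic_on :: "(real ^ 'n \<Rightarrow> real ^ 'n \<Rightarrow> complex) \<Rightarrow> (real ^ 'n) set \<Rightarrow> bool" where
  "H1_analytic_on f S \<longleftrightarrow>
     (\<forall>a\<in>S. f a \<in> H1_per \<and> (\<exists>r>0. ball a r \<subseteq> S \<and>
        (\<exists>c. (\<forall>m. c m \<in> H1_per) \<and>
          (\<forall>x\<in>ball a r.
             ((\<lambda>F. H1_norm (\<lambda>y. f x y - (\<Sum>m\<in>F. monomial m (x - a) *\<^sub>R c m y))) \<longlongrightarrow> 0)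
               (finite_subsets_at_top UNIV)))))"

definition nu1 ::
  "(real ^ 'n \<Rightarrow> real ^ 'n ^ 'n) \<Rightarrow> (real ^ 'n \<Rightarrow> real ^ 'n \<Rightarrow> complex) \<Rightarrow> real ^ 'n \<Rightarrow> complex" where
  "nu1 B \<phi> \<eta> = complex_of_real (1 / measure lebesgue (cell :: (real ^ 'n) set)) * shifted_form B \<eta> (\<phi> \<eta>) (\<phi> \<eta>)"

end

theory Submission imports Defs "HOL-Computational_Algebra.Polynomial" begin

text \<open>Write \<open>G(\<eta>) = (\<nabla> + i\<eta>) \<phi>(\<eta>)\<close> for the shifted gradient of the ground state, a power series in \<open>\<eta>\<close>
  with coefficients in \<open>L\<^sup>2(Y)\<close>. Then \<open>\<nu>\<^sub>1(\<eta>) = \<langle>B G(\<eta>), G(\<eta>)\<rangle>\<close>, and because the form is bounded, inserting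
  the series gives an absolutely convergent double series. Hence \<open>\<nu>\<^sub>1\<close> is analytic and its coefficients
  are read off from those of \<open>G\<close> (\<open>shifted_form_mpowser\<close>). As \<open>\<phi>(0)\<close> is constant, \<open>G(0) = 0\<close>: the value
  and the first derivatives of \<open>\<nu>\<^sub>1\<close> vanish, and with \<open>g\<^sub>k = \<partial>\<^sub>kG(0) = \<nabla>\<partial>\<^sub>k\<phi>(0) + i e\<^sub>k\<close> the second
  derivatives are \<open>\<langle>B g\<^sub>k, g\<^sub>l\<rangle> + \<langle>B g\<^sub>l, g\<^sub>k\<rangle>\<close> (\<open>shifted_form_expansion\<close>).

  It remains to see that \<open>g\<^sub>k = i (\<nabla>\<chi>\<^sub>k + e\<^sub>k)\<close>. By normalization \<open>\<lambda>\<^sub>1(\<eta>) = \<langle>A G(\<eta>), G(\<eta>)\<rangle>\<close>, so the same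
  expansion, applied to \<open>A\<close>, shows that \<open>\<lambda>\<^sub>1\<close> has no terms of degree below two. The part of degree one
  of the eigenvalue equation \<open>\<langle>A G(\<eta>), (\<nabla> + i\<eta>) v\<rangle> = \<lambda>\<^sub>1(\<eta>) \<langle>\<phi>(\<eta>), v\<rangle>\<close> is therefore \<open>\<langle>A g\<^sub>k, \<nabla>v\<rangle> = 0\<close>
  (\<open>first_order_field_orthogonal\<close>), which is \<open>i\<close> times the cell problem, and by coercivity of \<open>A\<close> the
  cell problem determines its solution up to constants (\<open>cell_gradient_unique\<close>). For the same reason \<open>\<nabla>\<chi>\<^sub>k\<close> is real,
  so that \<open>\<langle>B g\<^sub>k, g\<^sub>l\<rangle>\<close> is the bilinear expression \<open>b\<^sup>#\<^sub>k\<^sub>l\<close>, which is symmetric in \<open>k\<close> and \<open>l\<close>.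

  Two foundations carry the argument. Weak gradients are unique almost everywhere
  (\<open>has_weak_gradient_unique\<close>), hence linear in the function; this rests on test functions that
  approximate the indicator of a box. Absolutely convergent power series in several variables may be
  regrouped and differentiated term by term (\<open>mpowser_regroup\<close>, \<open>mpowser_partial_deriv\<close>).\<close>

section \<open>Test functions\<close>

text \<open>The classical flat function \<open>exp (- 1 / z)\<close>, divided by a power of \<open>z\<close> so that the
  linear span of the family is closed under differentiation.\<close>

definition flat :: "nat \<Rightarrow> real \<Rightarrow> real" where
  "flat k z = (if z > 0 then exp (- 1 / z) / z ^ k else 0)"

lemma power_div_fact_le_exp:
  fixes x :: real assumes "x \<ge> 0"
  shows "x ^ n / fact n \<le> exp x"
proof -
  have s: "(\<lambda>n. x ^ n /\<^sub>R fact n) sums exp x" by (rule exp_converges)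
  have "sum (\<lambda>n. x ^ n /\<^sub>R fact n) {n} \<le> suminf (\<lambda>n. x ^ n /\<^sub>R fact n)"
    using assms by (intro sum_le_suminf sums_summable[OF s]) auto
  then show ?thesis using sums_unique[OF s] by (simp add: field_simps)
qed

text \<open>The quadratic bound gives derivative \<open>0\<close> at the origin; it comes from keeping a single term,
  of degree \<open>k + 2\<close>, of the exponential series at \<open>1 / z\<close>.\<close>

lemma flat_le:
  "\<bar>flat k z\<bar> \<le> fact (k + 2) * z\<^sup>2"
proof (cases "z > 0")
  case True
  have "(1 / z) ^ (k + 2) / fact (k + 2) \<le> exp (1 / z)"
    using True by (intro power_div_fact_le_exp) auto
  then have "1 \<le> fact (k + 2) * z ^ (k + 2) * exp (1 / z)"
    using True by (simp add: power_one_over pos_divide_le_eq mult_ac del: fact_Suc power_Suc add_2_eq_Suc')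
  then have "exp (- (1 / z)) \<le> fact (k + 2) * z ^ (k + 2)"
    by (simp add: exp_minus pos_divide_le_eq inverse_eq_divide del: fact_Suc power_Suc add_2_eq_Suc')
  then have "exp (- (1 / z)) / z ^ k \<le> fact (k + 2) * z ^ (k + 2) / z ^ k"
    using True by (intro divide_right_mono) auto
  also have "\<dots> = fact (k + 2) * z\<^sup>2" using True by (simp add: power_add power2_eq_square)
  finally show ?thesis using True by (simp add: flat_def)
qed (auto simp: flat_def)

lemma flat_Suc: "z * flat (Suc k) z = flat k z"
  by (auto simp: flat_def)

lemma DERIV_flat: "(flat k has_real_derivative flat (k + 2) z - k * flat (k + 1) z) (at z)"
proof (cases z "0::real" rule: linorder_cases)
  case less
  have "((\<lambda>_. 0) has_real_derivative 0) (at z)" by simp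
  then have "(flat k has_real_derivative 0) (at z)"
    by (rule has_field_derivative_transform_within_open[of _ _ _ "{..<0}"]) (use less in \<open>auto simp: flat_def\<close>)
  then show ?thesis using less by (simp add: flat_def)
next
  case greater
  have "((\<lambda>z. exp (- 1 / z)) has_real_derivative exp (- 1 / z) * (1 / z\<^sup>2)) (at z)"
    using greater by (auto intro!: derivative_eq_intros simp: power2_eq_square)
  moreover have "((\<lambda>z. z ^ k) has_real_derivative k * z ^ (k - 1)) (at z)"
    using DERIV_power[OF DERIV_ident, of k z UNIV] by simp
  ultimately have "((\<lambda>z. exp (- 1 / z) / z ^ k) has_real_derivative 
      (exp (- 1 / z) * (1 / z\<^sup>2) * z ^ k - exp (- 1 / z) * (k * z ^ (k - 1))) / (z ^ k * z ^ k)) (at z)"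
    using greater by (intro DERIV_divide) auto
  also have "(exp (- 1 / z) * (1 / z\<^sup>2) * z ^ k - exp (- 1 / z) * (k * z ^ (k - 1))) / (z ^ k * z ^ k)
     = flat (k + 2) z - k * flat (k + 1) z"
    using greater by (cases k) (simp_all add: flat_def field_simps power2_eq_square power_add)
  finally have "((\<lambda>z. exp (- 1 / z) / z ^ k) has_real_derivative flat (k + 2) z - k * flat (k + 1) z) (at z)" .
  then show ?thesis
    by (rule has_field_derivative_transform_within_open[of _ _ _ "{0<..}"]) (use greater in \<open>auto simp: flat_def\<close>)
next
  case equal
  have "((\<lambda>h. (flat k (0 + h) - flat k 0) / h) \<longlongrightarrow> 0) (at 0)"
  proof (rule Lim_null_comparison)
    show "\<forall>\<^sub>F h in at 0. norm ((flat k (0 + h) - flat k 0) / h) \<le> fact (k + 2) * \<bar>h\<bar>"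
    proof (rule eventually_at_filter[THEN iffD2], intro always_eventually allI impI)
      fix h :: real assume "h \<noteq> 0"
      then have "\<bar>flat k h\<bar> / \<bar>h\<bar> \<le> fact (k + 2) * h\<^sup>2 / \<bar>h\<bar>"
        by (intro divide_right_mono flat_le) auto
      also have "\<dots> = fact (k + 2) * \<bar>h\<bar>" using \<open>h \<noteq> 0\<close> by (auto simp: power2_eq_square abs_if)
      finally show "norm ((flat k (0 + h) - flat k 0) / h) \<le> fact (k + 2) * \<bar>h\<bar>"
        by (simp add: flat_def[of _ 0] abs_divide)
    qed
    show "((\<lambda>h. fact (k + 2) * \<bar>h\<bar>) \<longlongrightarrow> (0::real)) (at 0)"
      by (rule tendsto_eq_intros refl | simp)+
  qed
  then show ?thesis using equal by (simp add: DERIV_def flat_def[of _ 0])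
qed

text \<open>A function of this form is supported where \<open>q > 0\<close>, and its derivative has the same form with
  the same \<open>q\<close>. The representation is thus stable under all iterated derivatives, which is what
  being a test function asks for.\<close>

definition poly_flat :: "real poly \<Rightarrow> nat \<Rightarrow> real poly \<Rightarrow> real \<Rightarrow> real" where
  "poly_flat q k P t = poly P t * flat k (poly q t)"

lemma DERIV_poly_flat:
  "(poly_flat q k P has_real_derivative
     poly_flat q (k + 2) (pderiv P * q\<^sup>2 + P * pderiv q * (1 - of_nat k * q)) t) (at t)"
proof -
  have 1: "flat k z = z\<^sup>2 * flat (k + 2) z" "flat (k + 1) z = z * flat (k + 2) z" for z
    using flat_Suc[of z k] flat_Suc[of z "Suc k"] by (simp_all add: power2_eq_square mult.assoc)
  have "((\<lambda>t. poly P t * flat k (poly q t)) has_real_derivative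
      poly (pderiv P) t * flat k (poly q t) + 
      (flat (k + 2) (poly q t) - k * flat (k + 1) (poly q t)) * poly (pderiv q) t * poly P t) (at t)"
    by (intro DERIV_mult poly_DERIV DERIV_chain2[OF DERIV_flat])
  also have "poly (pderiv P) t * flat k (poly q t) + 
      (flat (k + 2) (poly q t) - k * flat (k + 1) (poly q t)) * poly (pderiv q) t * poly P t
    = poly_flat q (k + 2) (pderiv P * q\<^sup>2 + P * pderiv q * (1 - of_nat k * q)) t"
    unfolding poly_flat_def 1(1)[of "poly q t"] 1(2)[of "poly q t"] by (simp add: algebra_simps)
  finally show ?thesis by (simp add: poly_flat_def[abs_def])
qed

lemma partial_deriv_eq:
  assumes "(f has_derivative f') (at x)"
  shows "partial_deriv k f x = f' (axis k 1)"
proof -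
  have "((\<lambda>t. x + t *\<^sub>R axis k 1) has_derivative (\<lambda>t. t *\<^sub>R axis k 1)) (at 0)"
    by (auto intro!: derivative_eq_intros)
  then have "((\<lambda>t. f (x + t *\<^sub>R axis k 1)) has_derivative (\<lambda>t. f' (t *\<^sub>R axis k 1))) (at 0)"
    by (rule has_derivative_compose) (use assms in simp)
  moreover have "(\<lambda>t. f' (t *\<^sub>R axis k 1)) = (\<lambda>t. t *\<^sub>R f' (axis k 1))"
    using has_derivative_linear[OF assms] by (simp add: linear_scale fun_eq_iff)
  ultimately show ?thesis unfolding partial_deriv_def
    by (intro vector_derivative_at) (simp add: has_vector_derivative_def)
qed

text \<open>A product over the coordinates: a partial derivative only changes the parameters of one
  factor.\<close>

definition box_flat :: "('n \<Rightarrow> real poly) \<Rightarrow> ('n \<Rightarrow> nat) \<Rightarrow> ('n \<Rightarrow> real poly) \<Rightarrow> real ^ 'n \<Rightarrow> real" where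
  "box_flat q k P x = (\<Prod>i\<in>UNIV. poly_flat (q i) (k i) (P i) (x $ i))"

lemma box_flat_derivative:
  fixes q :: "'n::finite \<Rightarrow> real poly"
  shows "box_flat q k P differentiable (at x)"
    and "\<exists>k' P'. partial_deriv j (box_flat q k P) = box_flat q k' P'"
proof -
  let ?k' = "\<lambda>i. k i + 2" and ?P' = "\<lambda>i. pderiv (P i) * (q i)\<^sup>2 + P i * pderiv (q i) * (1 - of_nat (k i) * q i)"
  let ?D = "\<lambda>x h. \<Sum>i\<in>UNIV. poly_flat (q i) (?k' i) (?P' i) (x $ i) * h $ i * (\<Prod>j\<in>UNIV-{i}. poly_flat (q j) (k j) (P j) (x $ j))"
  have 1: "(box_flat q k P has_derivative ?D x) (at x)" for x
    unfolding box_flat_def[abs_def]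
  proof (rule has_derivative_prod)
    fix i
    have "((\<lambda>x. x $ i) has_derivative (\<lambda>h. h $ i)) (at x)"
      by (rule bounded_linear_imp_has_derivative) (rule bounded_linear_vec_nth)
    from has_derivative_compose[OF this DERIV_poly_flat[THEN has_field_derivative_imp_has_derivative]]
    show "((\<lambda>x. poly_flat (q i) (k i) (P i) (x $ i)) has_derivative
        (\<lambda>h. poly_flat (q i) (?k' i) (?P' i) (x $ i) * h $ i)) (at x)" .
  qed
  then show "box_flat q k P differentiable (at x)" by (auto simp: differentiable_def)
  have "partial_deriv j (box_flat q k P) x = box_flat q (k(j := ?k' j)) (P(j := ?P' j)) x" for x
  proof -
    have "partial_deriv j (box_flat q k P) x = ?D x (axis j 1)" by (rule partial_deriv_eq[OF 1])
    also have "\<dots> = poly_flat (q j) (?k' j) (?P' j) (x $ j) * (\<Prod>j\<in>UNIV-{j}. poly_flat (q j) (k j) (P j) (x $ j))"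
      by (subst sum.remove[of _ j]) (auto simp: axis_def intro!: sum.neutral)
    also have "\<dots> = box_flat q (k(j := ?k' j)) (P(j := ?P' j)) x"
      unfolding box_flat_def by (subst (2) prod.remove[of _ j]) (auto intro!: prod.cong)
    finally show ?thesis .
  qed
  then show "\<exists>k' P'. partial_deriv j (box_flat q k P) = box_flat q k' P'" by blast
qed

lemma test_function_box_flat:
  fixes q :: "'n::finite \<Rightarrow> real poly"
  assumes "bounded {x. box_flat q k P x \<noteq> 0}"
  shows "test_function (box_flat q k P)"
proof -
  have "\<exists>k' P'. foldr partial_deriv js (box_flat q k P) = box_flat q k' P'" for js
  proof (induction js)
    case (Cons j js)
    then show ?case using box_flat_derivative(2) by fastforce
  qed auto
  then have "foldr partial_deriv js (box_flat q k P) differentiable (at x)" for js x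
    using box_flat_derivative(1) by metis
  then show ?thesis using assms by (simp add: test_function_def compact_closure)
qed

text \<open>With \<open>q\<^sub>n = (n + 1) (t - a) (b - t)\<close> in each coordinate, \<open>exp (- 1 / q\<^sub>n)\<close> increases to \<open>1\<close> inside
  the interval and vanishes outside it. If the box is empty,
  some \<open>q\<^sub>n\<close> may still be positive somewhere, whence the separate case.\<close>

lemma ex_test_functions_box:
  fixes a b :: "real ^ 'n"
  obtains \<phi> :: "nat \<Rightarrow> real ^ 'n \<Rightarrow> real" where
    "\<And>n. test_function (\<phi> n)" "\<And>n x. \<bar>\<phi> n x\<bar> \<le> indicator (box a b) x"
    "\<And>x. (\<lambda>n. \<phi> n x) \<longlonglongrightarrow> indicator (box a b) x"
proof (cases "box a b = {}")
  case True
  have "box_flat (\<lambda>_. 0) (\<lambda>_. 0) (\<lambda>_. 0) = (\<lambda>x :: real ^ 'n. 0)"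
    by (simp add: box_flat_def poly_flat_def fun_eq_iff)
  moreover from this have "test_function (box_flat (\<lambda>_. 0) (\<lambda>_. 0) (\<lambda>_. 0) :: real ^ 'n \<Rightarrow> real)"
    by (intro test_function_box_flat) simp
  ultimately show ?thesis using that[of "\<lambda>_ _. 0"] True by simp
next
  case False
  then have ab: "a $ i < b $ i" for i using interval_ne_empty_cart(2)[of a b] by auto
  define q where "q = (\<lambda>(n::nat) i. [: real (Suc n) :] * ([: - (a $ i), 1 :] * [: b $ i, -1 :]))"
  let ?\<phi> = "\<lambda>n. box_flat (q n) (\<lambda>_. 0) (\<lambda>_. 1)"
  have poly_q: "poly (q n i) t = real (Suc n) * ((t - a $ i) * (b $ i - t))" for n i t
    by (simp add: q_def algebra_simps)
  have pos_iff: "poly (q n i) t > 0 \<longleftrightarrow> a $ i < t \<and> t < b $ i" for n i t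
    unfolding poly_q using ab[of i] by (auto simp: zero_less_mult_iff)
  have 1: "0 \<le> flat 0 z" "flat 0 z \<le> 1" for z by (auto simp: flat_def)
  have zero: "?\<phi> n x = 0" if "x \<notin> box a b" for n x
  proof -
    from that obtain i where "\<not> (a $ i < x $ i \<and> x $ i < b $ i)" by (auto simp: mem_box_cart)
    then have "poly_flat (q n i) 0 1 (x $ i) = 0" using pos_iff[of n i "x $ i"] by (simp add: poly_flat_def flat_def)
    then show ?thesis unfolding box_flat_def by (intro prod_zero) auto
  qed
  have bound: "\<bar>?\<phi> n x\<bar> \<le> indicator (box a b) x" for n x
  proof (cases "x \<in> box a b")
    case True
    have "0 \<le> ?\<phi> n x" "?\<phi> n x \<le> 1" unfolding box_flat_def poly_flat_def
      using 1 by (auto intro!: prod_nonneg prod_le_1)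
    then show ?thesis using True by simp
  qed (simp add: zero)
  have "test_function (?\<phi> n)" for n
    by (rule test_function_box_flat, rule bounded_subset[OF bounded_box[of a b]]) (use zero in blast)
  moreover have "(\<lambda>n. ?\<phi> n x) \<longlonglongrightarrow> indicator (box a b) x" for x
  proof (cases "x \<in> box a b")
    case True
    have "(\<lambda>n. poly_flat (q n i) 0 1 (x $ i)) \<longlonglongrightarrow> 1" for i
    proof -
      define c where "c = (x $ i - a $ i) * (b $ i - x $ i)"
      have c: "c > 0" using True by (auto simp: mem_box_cart c_def)
      have "(\<lambda>n. - (1 / c) * inverse (real (Suc n))) \<longlonglongrightarrow> - (1 / c) * 0"
        by (intro tendsto_intros LIMSEQ_inverse_real_of_nat)
      then have "(\<lambda>n. exp (- (1 / c) * inverse (real (Suc n)))) \<longlonglongrightarrow> exp (- (1 / c) * 0)"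
        by (rule tendsto_exp)
      moreover have "poly_flat (q n i) 0 1 (x $ i) = exp (- (1 / c) * inverse (real (Suc n)))" for n
        using c by (simp add: poly_flat_def flat_def poly_q flip: c_def) (simp add: field_simps)
      ultimately show ?thesis by simp
    qed
    then have "(\<lambda>n. ?\<phi> n x) \<longlonglongrightarrow> (\<Prod>i\<in>(UNIV::'n set). 1)"
      unfolding box_flat_def by (intro tendsto_prod) auto
    then show ?thesis using True by simp
  qed (simp add: zero)
  ultimately show ?thesis using bound by (intro that[of ?\<phi>])
qed

section \<open>Weak gradients\<close>

lemma test_function_differentiable:
  assumes "test_function \<phi>"
  shows "\<phi> differentiable (at x)" "partial_deriv k \<phi> differentiable (at x)"
proof -
  have *: "foldr partial_deriv ks \<phi> differentiable (at x)" for ks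
    using assms by (simp add: test_function_def)
  show "\<phi> differentiable (at x)" using *[of "[]"] by simp
  show "partial_deriv k \<phi> differentiable (at x)" using *[of "[k]"] by simp
qed

lemma test_function_continuous:
  assumes "test_function \<phi>"
  shows "continuous_on S \<phi>" "continuous_on S (partial_deriv k \<phi>)"
  using test_function_differentiable[OF assms]
  by (intro differentiable_imp_continuous_on differentiable_at_imp_differentiable_on; simp)+

lemma test_function_support:
  assumes "test_function \<phi>"
  obtains R where "\<And>x. norm x > R \<Longrightarrow> \<phi> x = 0" "\<And>k x. norm x > R \<Longrightarrow> partial_deriv k \<phi> x = 0"
proof -
  have "bounded (closure {x. \<phi> x \<noteq> 0})"
    using assms by (simp add: test_function_def compact_imp_bounded)
  then obtain R where R: "\<And>x. x \<in> closure {x. \<phi> x \<noteq> 0} \<Longrightarrow> norm x \<le> R"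
    by (auto simp: bounded_iff)
  have zero: "\<phi> x = 0" if "norm x > R" for x
    using R[of x] that closure_subset[of "{x. \<phi> x \<noteq> 0}"] by force
  moreover have "partial_deriv k \<phi> x = 0" if "norm x > R" for k x
  proof -
    have "((\<lambda>_. 0::real) has_derivative (\<lambda>_. 0)) (at x)" by simp
    then have "(\<phi> has_derivative (\<lambda>_. 0)) (at x)"
      by (rule has_derivative_transform_within_open[where s = "- cball 0 R"])
         (use that zero in \<open>auto\<close>)
    then show ?thesis by (rule partial_deriv_eq)
  qed
  ultimately show ?thesis by (rule that)
qed

lemma continuous_support_bounded:
  fixes \<psi> :: "real ^ 'n \<Rightarrow> real"
  assumes "continuous_on UNIV \<psi>" and "\<And>x. norm x > R \<Longrightarrow> \<psi> x = 0"
  obtains C where "C \<ge> 0" "\<And>x. \<bar>\<psi> x\<bar> \<le> C * indicator (cball 0 R) x"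
proof -
  have "compact (\<psi> ` cball 0 R)"
    by (intro compact_continuous_image continuous_on_subset[OF assms(1)]) auto
  then obtain C where C: "\<And>x. x \<in> cball 0 R \<Longrightarrow> \<bar>\<psi> x\<bar> \<le> C"
    by (metis compact_imp_bounded bounded_iff imageI real_norm_def)
  show ?thesis
    by (rule that[of "\<bar>C\<bar>"]) (use C assms(2) in \<open>force simp: indicator_def\<close>)+
qed

text \<open>On bounded sets square-integrable functions are integrable, because \<open>t \<le> t\<^sup>2 + 1\<close>.\<close>

lemma L2_loc_integrable:
  fixes u :: "real ^ 'n \<Rightarrow> 'a::euclidean_space"
  assumes u: "L2_loc u" and \<psi>: "continuous_on UNIV \<psi>" "\<And>x. norm x > R \<Longrightarrow> \<psi> x = 0"
  shows "integrable lebesgue (\<lambda>y. \<psi> y *\<^sub>R u y)"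
proof -
  obtain C where C: "C \<ge> 0" "\<And>x. \<bar>\<psi> x\<bar> \<le> C * indicator (cball 0 R) x"
    using continuous_support_bounded[OF \<psi>] by metis
  have [measurable]: "u \<in> borel_measurable lebesgue" using u by (simp add: L2_loc_def)
  have [measurable]: "\<psi> \<in> borel_measurable lebesgue"
    using \<psi>(1) by (intro measurable_completion) (simp add: borel_measurable_continuous_onI)
  have "integrable lebesgue (\<lambda>y. indicator (cball 0 R) y *\<^sub>R (norm (u y))\<^sup>2)"
    using u by (auto simp: L2_loc_def set_integrable_def)
  moreover have "integrable lebesgue (\<lambda>y::real ^ 'n. indicator (cball 0 R) y :: real)"
    using lmeasurable_cball[of "0::real ^ 'n" R] by (simp add: fmeasurable_def)
  ultimately have "integrable lebesgue (\<lambda>y. C * (indicator (cball 0 R) y *\<^sub>R (norm (u y))\<^sup>2 + indicator (cball 0 R) y))"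
    by (intro integrable_mult_right Bochner_Integration.integrable_add) auto
  then show ?thesis
  proof (rule Bochner_Integration.integrable_bound)
    show "AE y in lebesgue. norm (\<psi> y *\<^sub>R u y) \<le> norm (C * (indicator (cball 0 R) y *\<^sub>R (norm (u y))\<^sup>2 + indicator (cball 0 R) y))"
    proof (intro AE_I2)
      fix y
      have "norm (u y) \<le> (norm (u y))\<^sup>2 + 1"
        using zero_le_power2[of "norm (u y) - 1"] norm_ge_zero[of "u y"] unfolding power2_diff power_one mult_1_right by linarith
      then have "\<bar>\<psi> y\<bar> * norm (u y) \<le> (C * indicator (cball 0 R) y) * ((norm (u y))\<^sup>2 + 1)"
        using C(1) by (intro mult_mono C(2)) auto
      also have "\<dots> \<le> \<bar>(C * indicator (cball 0 R) y) * ((norm (u y))\<^sup>2 + 1)\<bar>" by simp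
      finally show "norm (\<psi> y *\<^sub>R u y) \<le> norm (C * (indicator (cball 0 R) y *\<^sub>R (norm (u y))\<^sup>2 + indicator (cball 0 R) y))"
        by (simp add: algebra_simps)
    qed
  qed measurable
qed

lemma L2_loc_test_integrable:
  assumes "L2_loc u" "test_function \<phi>"
  shows "integrable lebesgue (\<lambda>y. \<phi> y *\<^sub>R u y)" "integrable lebesgue (\<lambda>y. partial_deriv k \<phi> y *\<^sub>R u y)"
proof -
  obtain R where "\<And>x. norm x > R \<Longrightarrow> \<phi> x = 0" "\<And>k x. norm x > R \<Longrightarrow> partial_deriv k \<phi> x = 0"
    using test_function_support[OF assms(2)] by metis
  note R = this
  show "integrable lebesgue (\<lambda>y. \<phi> y *\<^sub>R u y)"
    by (rule L2_loc_integrable[OF assms(1) test_function_continuous(1)[OF assms(2)] R(1)])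
  show "integrable lebesgue (\<lambda>y. partial_deriv k \<phi> y *\<^sub>R u y)"
    by (rule L2_loc_integrable[OF assms(1) test_function_continuous(2)[OF assms(2)] R(2)])
qed

lemma norm_add_square_le: "(norm (a + b))\<^sup>2 \<le> 2 * (norm a)\<^sup>2 + 2 * (norm b)\<^sup>2"
  for a b :: "'a::real_normed_vector"
proof -
  have "(norm (a + b))\<^sup>2 \<le> (norm a + norm b)\<^sup>2" by (intro power_mono norm_triangle_ineq) auto
  also have "\<dots> \<le> 2 * (norm a)\<^sup>2 + 2 * (norm b)\<^sup>2"
    using sum_squares_bound[of "norm a" "norm b"] by (simp add: power2_sum)
  finally show ?thesis .
qed

lemma L2_loc_add:
  fixes u v :: "real ^ 'n \<Rightarrow> 'a::euclidean_space"
  assumes "L2_loc u" "L2_loc v"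
  shows "L2_loc (\<lambda>y. u y + v y)"
  unfolding L2_loc_def
proof (intro conjI allI impI)
  have m[measurable]: "u \<in> borel_measurable lebesgue" "v \<in> borel_measurable lebesgue"
    using assms by (auto simp: L2_loc_def)
  show "(\<lambda>y. u y + v y) \<in> borel_measurable lebesgue" by measurable
  fix K :: "(real ^ 'n) set" assume K: "compact K"
  then have [measurable]: "K \<in> sets lebesgue" by (intro fmeasurableD lmeasurable_compact)
  have "integrable lebesgue (\<lambda>y. indicator K y *\<^sub>R (norm (u y))\<^sup>2)" "integrable lebesgue (\<lambda>y. indicator K y *\<^sub>R (norm (v y))\<^sup>2)"
    using assms K unfolding L2_loc_def set_integrable_def by blast+
  then have "integrable lebesgue (\<lambda>y. 2 * (indicator K y *\<^sub>R (norm (u y))\<^sup>2) + 2 * (indicator K y *\<^sub>R (norm (v y))\<^sup>2))"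
    by (intro Bochner_Integration.integrable_add integrable_mult_right)
  then show "set_integrable lebesgue K (\<lambda>y. (norm (u y + v y))\<^sup>2)"
    unfolding set_integrable_def
  proof (rule Bochner_Integration.integrable_bound)
    have "(norm (u y + v y))\<^sup>2 \<le> 2 * (norm (u y))\<^sup>2 + 2 * (norm (v y))\<^sup>2" for y
      by (rule norm_add_square_le)
    then show "AE y in lebesgue. norm (indicator K y *\<^sub>R (norm (u y + v y))\<^sup>2) \<le>
       norm (2 * (indicator K y *\<^sub>R (norm (u y))\<^sup>2) + 2 * (indicator K y *\<^sub>R (norm (v y))\<^sup>2))"
      by (intro AE_I2) (auto simp: indicator_def)
  qed measurable
qed

lemma L2_loc_linear:
  fixes u :: "real ^ 'n \<Rightarrow> 'a::euclidean_space" and T :: "'a \<Rightarrow> 'b::euclidean_space"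
  assumes "L2_loc u" "bounded_linear T"
  shows "L2_loc (\<lambda>y. T (u y))"
  unfolding L2_loc_def
proof (intro conjI allI impI)
  have m[measurable]: "u \<in> borel_measurable lebesgue" "T \<in> borel_measurable borel"
    using assms by (auto simp: L2_loc_def borel_measurable_continuous_onI linear_continuous_on)
  show "(\<lambda>y. T (u y)) \<in> borel_measurable lebesgue" by measurable
  obtain C where C: "\<And>x. norm (T x) \<le> norm x * C" "C > 0" using bounded_linear.pos_bounded[OF assms(2)] by blast
  fix K :: "(real ^ 'n) set" assume K: "compact K"
  then have [measurable]: "K \<in> sets lebesgue" by (intro fmeasurableD lmeasurable_compact)
  have "integrable lebesgue (\<lambda>y. indicator K y *\<^sub>R (norm (u y))\<^sup>2)"
    using assms K unfolding L2_loc_def set_integrable_def by blast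
  then have "integrable lebesgue (\<lambda>y. C\<^sup>2 * (indicator K y *\<^sub>R (norm (u y))\<^sup>2))"
    by (intro integrable_mult_right)
  then show "set_integrable lebesgue K (\<lambda>y. (norm (T (u y)))\<^sup>2)"
    unfolding set_integrable_def
  proof (rule Bochner_Integration.integrable_bound)
    have "(norm (T (u y)))\<^sup>2 \<le> C\<^sup>2 * (norm (u y))\<^sup>2" for y
      using power_mono[OF C(1)[of "u y"], of 2] by (simp add: power_mult_distrib mult.commute)
    then show "AE y in lebesgue. norm (indicator K y *\<^sub>R (norm (T (u y)))\<^sup>2) \<le>
       norm (C\<^sup>2 * (indicator K y *\<^sub>R (norm (u y))\<^sup>2))"
      by (intro AE_I2) (auto simp: indicator_def)
  qed measurable
qed

lemma L2_loc_nth: "L2_loc g \<Longrightarrow> L2_loc (\<lambda>y. g y $ k)" for g :: "real ^ 'n \<Rightarrow> complex ^ 'n"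
  by (rule L2_loc_linear[OF _ bounded_linear_vec_nth])

lemma L2_loc_const: "L2_loc (\<lambda>_ :: real ^ 'n. c)"
proof -
  have "integrable lebesgue (\<lambda>y. indicator K y *\<^sub>R (norm c)\<^sup>2)" if "compact K" for K :: "(real ^ 'n) set"
    using lmeasurable_compact[OF that]
    by (intro integrable_scaleR_left integrable_real_indicator) (auto simp: fmeasurable_def)
  then show ?thesis by (simp add: L2_loc_def set_integrable_def)
qed

lemma sigma_finite_lebesgue: "sigma_finite_measure (lebesgue :: 'a::euclidean_space measure)"
proof
  obtain A :: "'a set set" where A: "countable A" "A \<subseteq> sets lborel" "\<Union>A = space lborel"
    "\<forall>a\<in>A. emeasure lborel a \<noteq> \<infinity>"
    using lborel.sigma_finite_countable by blast
  moreover from A have "A \<subseteq> sets lebesgue" "\<forall>a\<in>A. emeasure lebesgue a \<noteq> \<infinity>" by auto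
  ultimately show "\<exists>A :: 'a set set. countable A \<and> A \<subseteq> sets lebesgue \<and> \<Union>A = space lebesgue \<and> (\<forall>a\<in>A. emeasure lebesgue a \<noteq> \<infinity>)"
    by (intro exI[of _ A]) simp
qed

lemma AE_zero_if_set_integrals_borel:
  fixes f :: "real ^ 'n \<Rightarrow> complex"
  assumes f: "integrable lebesgue f" and "\<And>A. A \<in> sets borel \<Longrightarrow> (LINT x:A|lebesgue. f x) = 0"
  shows "AE x in lebesgue. f x = 0"
proof (rule sigma_finite_measure.density_zero[OF sigma_finite_lebesgue f])
  fix A :: "(real ^ 'n) set" assume "A \<in> sets lebesgue"
  then obtain S N N' where A: "A = S \<union> N" "N \<subseteq> N'" "N' \<in> null_sets lborel" "S \<in> sets lborel"
    by (rule sets_completionE)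
  have [measurable]: "f \<in> borel_measurable lebesgue" using f by auto
  have N': "N' \<in> null_sets lebesgue" using A(3) by (rule null_sets_completionI)
  have [measurable]: "A \<in> sets lebesgue" "S \<in> sets lebesgue" using A(4) \<open>A \<in> sets lebesgue\<close> by auto
  have "(LINT x:A|lebesgue. f x) = (LINT x:S|lebesgue. f x)"
    unfolding set_lebesgue_integral_def
  proof (rule integral_cong_AE)
    show "AE x in lebesgue. indicator A x *\<^sub>R f x = indicator S x *\<^sub>R f x"
      using AE_not_in[OF N'] by eventually_elim (use A in \<open>auto simp: indicator_def\<close>)
  qed measurable
  also have "\<dots> = 0" using assms(2)[of S] A(4) by simp
  finally show "(LINT x:A|lebesgue. f x) = 0" .
qed

text \<open>Boxes form a generator of the Borel sets that is stable under intersection, so vanishing of the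
  integral spreads to all Borel subsets of a fixed large box \<open>Q n\<close>. Truncating to \<open>Q n\<close> makes the
  function integrable, which complements need.\<close>

lemma AE_zero_if_box_integrals:
  fixes f :: "real ^ 'n \<Rightarrow> complex"
  assumes f: "\<And>a b. set_integrable lebesgue (box a b) f"
    and zero: "\<And>a b. (LINT x:box a b|lebesgue. f x) = 0"
  shows "AE x in lebesgue. f x = 0"
proof -
  define Q where "Q = (\<lambda>n::nat. box (- (real n *\<^sub>R One)) (real n *\<^sub>R One) :: (real ^ 'n) set)"
  have "AE x in lebesgue. indicator (Q n) x *\<^sub>R f x = 0" for n
  proof (rule AE_zero_if_set_integrals_borel)
    let ?g = "\<lambda>x. indicator (Q n) x *\<^sub>R f x"
    let ?E = "range (\<lambda>(a, b). box a b :: (real ^ 'n) set)"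
    show g: "integrable lebesgue ?g"
      using f by (auto simp: Q_def set_integrable_def)
    have set_g: "set_integrable lebesgue A ?g" if "A \<in> sets borel" for A
      unfolding set_integrable_def using that by (intro integrable_mult_indicator g) auto
    have g0: "(LINT x|lebesgue. ?g x) = 0" using zero by (auto simp: Q_def set_lebesgue_integral_def)
    fix A :: "(real ^ 'n) set" assume "A \<in> sets borel"
    then have "A \<in> sigma_sets UNIV ?E" by (simp add: borel_eq_box)
    have E: "?E \<subseteq> Pow UNIV" "Int_stable ?E" by (auto simp: Int_stable_def box_Int_box)
    have borel: "B \<in> sets borel" if "B \<in> sigma_sets UNIV ?E" for B using that by (simp add: borel_eq_box)
    show "(LINT x:A|lebesgue. ?g x) = 0"
      using E(2,1) \<open>A \<in> sigma_sets UNIV ?E\<close>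
    proof (induction rule: sigma_sets_induct_disjoint)
      case (basic A)
      then obtain a b where "A = box a b" by auto
      then have "A \<inter> Q n \<in> ?E" by (auto simp: Q_def box_Int_box)
      then obtain c d where cd: "A \<inter> Q n = box c d" by auto
      have "indicator A x *\<^sub>R (indicator (Q n) x *\<^sub>R f x) = indicator (box c d) x *\<^sub>R f x" for x
        unfolding cd[symmetric] by (simp add: indicator_def)
      then show ?case using zero[of c d] by (simp only: set_lebesgue_integral_def)
    next
      case (compl A)
      have "(LINT x:UNIV - A|lebesgue. ?g x) = (LINT x|lebesgue. ?g x - indicator A x *\<^sub>R ?g x)"
        unfolding set_lebesgue_integral_def
        by (intro Bochner_Integration.integral_cong) (auto simp: indicator_def)
      also have "\<dots> = (LINT x|lebesgue. ?g x) - (LINT x:A|lebesgue. ?g x)"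
        unfolding set_lebesgue_integral_def
        using g set_g[OF borel[OF compl(1)]] by (intro Bochner_Integration.integral_diff) (auto simp: set_integrable_def)
      finally have "(LINT x:UNIV - A|lebesgue. ?g x) = (LINT x|lebesgue. ?g x) - (LINT x:A|lebesgue. ?g x)" .
      then show ?case using compl g0 by (simp add: set_lebesgue_integral_def)
    next
      case (union A)
      have A: "A i \<in> sets borel" for i using union(2) by (intro borel) auto
      have "(LINT x:(\<Union>i. A i)|lebesgue. ?g x) = (\<Sum>i. LINT x:A i|lebesgue. ?g x)"
        using union(1) A
        by (intro lebesgue_integral_countable_add set_g) (auto simp: disjoint_family_on_def)
      then show ?case using union(3) by simp
    qed (simp add: set_lebesgue_integral_def)
  qed
  then have "AE x in lebesgue. \<forall>n. indicator (Q n) x *\<^sub>R f x = 0" by (rule AE_all_countable[THEN iffD2, OF allI])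
  then show ?thesis
  proof eventually_elim
    case (elim x)
    have "(\<Union>n. Q n) = UNIV" unfolding Q_def by (rule UN_box_eq_UNIV)
    then obtain n where "x \<in> Q n" by blast
    then show ?case using elim[rule_format, of n] by simp
  qed
qed

lemma L2_loc_AE_zero:
  fixes f :: "real ^ 'n \<Rightarrow> complex"
  assumes f: "L2_loc f" and zero: "\<And>\<phi>. test_function \<phi> \<Longrightarrow> (LINT y|lebesgue. \<phi> y *\<^sub>R f y) = 0"
  shows "AE y in lebesgue. f y = 0"
proof (rule AE_zero_if_box_integrals)
  fix a b :: "real ^ 'n"
  have [measurable]: "f \<in> borel_measurable lebesgue" using f by (simp add: L2_loc_def)
  have [measurable]: "box a b \<in> sets lebesgue" by simp
  obtain R where R: "box a b \<subseteq> cball 0 R" using bounded_subset_ballD[OF bounded_box, of a b 0] ball_subset_cball by blast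
  define \<psi> :: "real ^ 'n \<Rightarrow> real" where "\<psi> = (\<lambda>x. max 0 (min 1 (R + 1 - norm x)))"
  have int: "integrable lebesgue (\<lambda>y. \<psi> y *\<^sub>R f y)"
    by (rule L2_loc_integrable[OF f, of _ "R + 1"]) (auto simp: \<psi>_def intro!: continuous_intros)
  have \<psi>: "indicator (box a b) x \<le> \<psi> x" "\<psi> x \<ge> 0" for x using R by (auto simp: \<psi>_def indicator_def)
  show si: "set_integrable lebesgue (box a b) f"
    unfolding set_integrable_def
  proof (rule Bochner_Integration.integrable_bound[OF int])
    show "AE x in lebesgue. norm (indicator (box a b) x *\<^sub>R f x) \<le> norm (\<psi> x *\<^sub>R f x)"
      using \<psi> by (auto intro!: mult_right_mono)
  qed measurable
  obtain \<phi> :: "nat \<Rightarrow> real ^ 'n \<Rightarrow> real" where \<phi>: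
    "\<And>n. test_function (\<phi> n)" "\<And>n x. \<bar>\<phi> n x\<bar> \<le> indicator (box a b) x"
    "\<And>x. (\<lambda>n. \<phi> n x) \<longlonglongrightarrow> indicator (box a b) x"
    using ex_test_functions_box by metis
  have "(\<lambda>n. LINT y|lebesgue. \<phi> n y *\<^sub>R f y) \<longlonglongrightarrow> (LINT y|lebesgue. indicator (box a b) y *\<^sub>R f y)"
  proof (rule integral_dominated_convergence)
    show "(\<lambda>y. \<phi> n y *\<^sub>R f y) \<in> borel_measurable lebesgue" for n
      using L2_loc_test_integrable(1)[OF f \<phi>(1)] by auto
    show "integrable lebesgue (\<lambda>y. norm (\<psi> y *\<^sub>R f y))" using int by (rule integrable_norm)
    show "AE x in lebesgue. (\<lambda>n. \<phi> n x *\<^sub>R f x) \<longlonglongrightarrow> indicat_real (box a b) x *\<^sub>R f x"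
      by (intro AE_I2 tendsto_intros \<phi>(3))
    show "AE x in lebesgue. norm (\<phi> n x *\<^sub>R f x) \<le> norm (\<psi> x *\<^sub>R f x)" for n
    proof (intro AE_I2)
      fix x show "norm (\<phi> n x *\<^sub>R f x) \<le> norm (\<psi> x *\<^sub>R f x)"
        using \<phi>(2)[of n x] \<psi>[of x] by (auto intro!: mult_right_mono)
    qed
  qed measurable
  then show "(LINT x:box a b|lebesgue. f x) = 0"
    using zero[OF \<phi>(1)] by (simp add: set_lebesgue_integral_def LIMSEQ_const_iff)
qed

text \<open>Uniqueness is what makes the choice in the definition of the weak gradient harmless: it turns
  additivity and linearity of the relation \<open>has_weak_gradient\<close> into almost-everywhere identities for
  \<open>weak_gradient\<close>.\<close>

lemma has_weak_gradient_unique: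
  assumes "has_weak_gradient u g" "has_weak_gradient u h"
  shows "AE y in lebesgue. g y = h y"
proof -
  have "AE y in lebesgue. g y $ k - h y $ k = 0" for k
  proof (rule L2_loc_AE_zero)
    have g: "L2_loc (\<lambda>y. g y $ k)" and h: "L2_loc (\<lambda>y. h y $ k)"
      using assms by (auto simp: has_weak_gradient_def intro!: L2_loc_nth)
    show "L2_loc (\<lambda>y. g y $ k - h y $ k)"
      using L2_loc_add[OF g L2_loc_linear[OF h, of uminus]] by (simp add: bounded_linear_minus[OF bounded_linear_ident])
    fix \<phi> :: "real ^ 'a \<Rightarrow> real" assume \<phi>: "test_function \<phi>"
    have "(LINT y|lebesgue. \<phi> y *\<^sub>R g y $ k) = (LINT y|lebesgue. \<phi> y *\<^sub>R h y $ k)"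
      using assms \<phi> by (simp add: has_weak_gradient_def)
    then show "(LINT y|lebesgue. \<phi> y *\<^sub>R (g y $ k - h y $ k)) = 0"
      using L2_loc_test_integrable(1)[OF g \<phi>] L2_loc_test_integrable(1)[OF h \<phi>]
      by (simp add: scaleR_diff_right)
  qed
  then have "AE y in lebesgue. \<forall>k. g y $ k - h y $ k = 0" by (simp add: AE_all_countable)
  then show ?thesis by eventually_elim (simp add: vec_eq_iff)
qed

lemma weak_gradient:
  assumes "has_weak_gradient u g"
  shows "has_weak_gradient u (weak_gradient u)" "AE y in lebesgue. weak_gradient u y = g y"
proof -
  show *: "has_weak_gradient u (weak_gradient u)"
    using someI[of "has_weak_gradient u", OF assms] by (simp add: weak_gradient_def)
  show "AE y in lebesgue. weak_gradient u y = g y"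
    by (rule has_weak_gradient_unique[OF * assms])
qed

lemma integral_translation_lebesgue:
  fixes f :: "real ^ 'n \<Rightarrow> real"
  assumes "continuous_on UNIV f"
  shows "(LINT y|lebesgue. f (y + a)) = (LINT y|lebesgue. f y)"
proof -
  have [measurable]: "f \<in> borel_measurable borel" using assms by (rule borel_measurable_continuous_onI)
  have "(LINT y|lebesgue. f (y + a)) = (LINT y|lborel. f (a + y))"
    by (subst integral_completion) (auto simp: add.commute)
  also have "\<dots> = (LINT y|distr lborel borel ((+) a). f y)" by (subst integral_distr) auto
  also have "\<dots> = (LINT y|lebesgue. f y)"
    by (subst integral_completion) (auto simp: lborel_distr_plus)
  finally show ?thesis .
qed

text \<open>The integral of a difference quotient vanishes by translation invariance; dominated convergence
  passes to the derivative. The identity says that constants have weak gradient \<open>0\<close>.\<close>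

lemma integral_partial_deriv_test_function:
  fixes \<phi> :: "real ^ 'n \<Rightarrow> real"
  assumes \<phi>: "test_function \<phi>"
  shows "(LINT y|lebesgue. partial_deriv k \<phi> y) = 0"
proof -
  define e :: "real ^ 'n" where "e = axis k 1"
  obtain R where R: "\<And>x. norm x > R \<Longrightarrow> \<phi> x = 0" "\<And>k x. norm x > R \<Longrightarrow> partial_deriv k \<phi> x = 0"
    using test_function_support[OF \<phi>] by metis
  obtain C where C: "C \<ge> 0" "\<And>x. \<bar>partial_deriv k \<phi> x\<bar> \<le> C * indicator (cball 0 R) x"
    using continuous_support_bounded[OF test_function_continuous(2)[OF \<phi>] R(2)] by metis
  have C': "\<bar>partial_deriv k \<phi> x\<bar> \<le> C" for x using C(2)[of x] C(1) by (cases "x \<in> cball 0 R") (auto simp: indicator_def)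
  have D: "((\<lambda>t. \<phi> (x + t *\<^sub>R e)) has_real_derivative partial_deriv k \<phi> (x + t *\<^sub>R e)) (at t)" for x t
  proof -
    obtain D where D: "(\<phi> has_derivative D) (at (x + t *\<^sub>R e))"
      using test_function_differentiable(1)[OF \<phi>] by (auto simp: differentiable_def)
    have "((\<lambda>t. x + t *\<^sub>R e) has_derivative (\<lambda>t. t *\<^sub>R e)) (at t)" by (auto intro!: derivative_eq_intros)
    from has_derivative_compose[OF this D]
    have "((\<lambda>t. \<phi> (x + t *\<^sub>R e)) has_derivative (\<lambda>s. D (s *\<^sub>R e))) (at t)" .
    moreover have "(\<lambda>s. D (s *\<^sub>R e)) = (*) (partial_deriv k \<phi> (x + t *\<^sub>R e))"
      using has_derivative_linear[OF D] partial_deriv_eq[OF D, of k]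
      by (simp add: linear_scale fun_eq_iff e_def mult.commute)
    ultimately show ?thesis by (simp add: has_field_derivative_def)
  qed
  define t :: "nat \<Rightarrow> real" where "t n = inverse (real (Suc n))" for n
  have t: "0 < t n" "t n \<le> 1" for n by (auto simp: t_def field_simps)
  have "t \<longlonglongrightarrow> 0" using LIMSEQ_inverse_real_of_nat by (simp add: t_def[abs_def])
  moreover have "\<forall>\<^sub>F n in sequentially. t n \<in> UNIV \<and> t n \<noteq> 0"
    using t(1) by (intro always_eventually) (metis UNIV_I less_irrefl)
  ultimately have t0: "filterlim t (at 0) sequentially" by (simp add: filterlim_at)
  have "(\<lambda>n. LINT y|lebesgue. (\<phi> (y + t n *\<^sub>R e) - \<phi> y) / t n) \<longlonglongrightarrow> (LINT y|lebesgue. partial_deriv k \<phi> y)"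
  proof (rule integral_dominated_convergence)
    show "partial_deriv k \<phi> \<in> borel_measurable lebesgue"
      by (intro measurable_completion) (simp add: borel_measurable_continuous_onI test_function_continuous[OF \<phi>])
    show "(\<lambda>y. (\<phi> (y + t n *\<^sub>R e) - \<phi> y) / t n) \<in> borel_measurable lebesgue" for n
    proof -
      have "continuous_on UNIV (\<lambda>y. \<phi> (y + t n *\<^sub>R e))"
        by (intro continuous_on_compose2[OF test_function_continuous(1)[OF \<phi>, of UNIV]] continuous_intros) auto
      then have "continuous_on UNIV (\<lambda>y. (\<phi> (y + t n *\<^sub>R e) - \<phi> y) / t n)"
        using t[of n] by (intro continuous_intros test_function_continuous[OF \<phi>]) auto
      then show ?thesis by (intro measurable_completion) (simp add: borel_measurable_continuous_onI)
    qed
    show "integrable lebesgue (\<lambda>y::real ^ 'n. C * indicator (cball 0 (R + 1)) y)"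
      using lmeasurable_cball[of "0::real ^ 'n" "R + 1"] by (intro integrable_mult_right) (simp add: fmeasurable_def)
    show "AE y in lebesgue. (\<lambda>n. (\<phi> (y + t n *\<^sub>R e) - \<phi> y) / t n) \<longlonglongrightarrow> partial_deriv k \<phi> y"
    proof (intro AE_I2)
      fix y
      have "((\<lambda>h. (\<phi> (y + h *\<^sub>R e) - \<phi> y) / h) \<longlongrightarrow> partial_deriv k \<phi> y) (at 0)"
        using D[of y 0] by (simp add: DERIV_def)
      from filterlim_compose[OF this t0]
      show "(\<lambda>n. (\<phi> (y + t n *\<^sub>R e) - \<phi> y) / t n) \<longlonglongrightarrow> partial_deriv k \<phi> y" .
    qed
    show "AE y in lebesgue. norm ((\<phi> (y + t n *\<^sub>R e) - \<phi> y) / t n) \<le> C * indicator (cball 0 (R + 1)) y" for n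
    proof (intro AE_I2)
      fix y
      show "norm ((\<phi> (y + t n *\<^sub>R e) - \<phi> y) / t n) \<le> C * indicator (cball 0 (R + 1)) y"
      proof (cases "norm y \<le> R + 1")
        case True
        have "\<exists>z>0. z < t n \<and> \<phi> (y + t n *\<^sub>R e) - \<phi> (y + 0 *\<^sub>R e) = (t n - 0) * partial_deriv k \<phi> (y + z *\<^sub>R e)"
          by (rule MVT2[OF t(1)[of n]]) (rule D)
        then obtain z where "\<phi> (y + t n *\<^sub>R e) - \<phi> (y + 0 *\<^sub>R e) = (t n - 0) * partial_deriv k \<phi> (y + z *\<^sub>R e)"
          by (elim exE conjE) 
        then have "(\<phi> (y + t n *\<^sub>R e) - \<phi> y) / t n = partial_deriv k \<phi> (y + z *\<^sub>R e)"
          using t(1)[of n] by simp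
        then show ?thesis using True C' by simp
      next
        case False
        have "norm y \<le> norm (y + t n *\<^sub>R e) + norm (t n *\<^sub>R e)"
          using norm_triangle_ineq4[of "y + t n *\<^sub>R e" "t n *\<^sub>R e"] by simp
        moreover have "norm (t n *\<^sub>R e) \<le> 1" using t[of n] by (simp add: e_def)
        ultimately have "norm (y + t n *\<^sub>R e) > R" "norm y > R" using False by auto
        then show ?thesis using R(1) False by simp
      qed
    qed
  qed
  moreover have "(LINT y|lebesgue. (\<phi> (y + t n *\<^sub>R e) - \<phi> y) / t n) = 0" for n
  proof -
    have i1: "integrable lebesgue (\<lambda>y. \<phi> y *\<^sub>R (1::real))"
      by (rule L2_loc_integrable[OF L2_loc_const test_function_continuous(1)[OF \<phi>] R(1)])
    have i2: "integrable lebesgue (\<lambda>y. \<phi> (y + t n *\<^sub>R e) *\<^sub>R (1::real))"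
    proof (rule L2_loc_integrable[OF L2_loc_const, of _ "R + norm (t n *\<^sub>R e)"])
      show "continuous_on UNIV (\<lambda>y. \<phi> (y + t n *\<^sub>R e))"
        by (intro continuous_on_compose2[OF test_function_continuous(1)[OF \<phi>, of UNIV]] continuous_intros) auto
      show "norm x > R + norm (t n *\<^sub>R e) \<Longrightarrow> \<phi> (x + t n *\<^sub>R e) = 0" for x
        using norm_triangle_ineq4[of "x + t n *\<^sub>R e" "t n *\<^sub>R e"] by (intro R(1)) simp
    qed
    have "(LINT y|lebesgue. \<phi> (y + t n *\<^sub>R e) - \<phi> y) = 0"
      using i1 i2 integral_translation_lebesgue[OF test_function_continuous(1)[OF \<phi>], of "t n *\<^sub>R e"] by simp
    then show ?thesis by simp
  qed
  ultimately show ?thesis by (simp only: LIMSEQ_const_iff)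
qed

lemma has_weak_gradient_const: "has_weak_gradient (\<lambda>_. c) (\<lambda>_. 0)"
  unfolding has_weak_gradient_def
proof (intro conjI allI impI L2_loc_const)
  fix \<phi> :: "real ^ 'a \<Rightarrow> real" and k assume \<phi>: "test_function \<phi>"
  have "integrable lebesgue (\<lambda>y. partial_deriv k \<phi> y *\<^sub>R (1::real))"
    by (rule L2_loc_test_integrable[OF L2_loc_const \<phi>])
  then have "(LINT y|lebesgue. partial_deriv k \<phi> y *\<^sub>R c) = (LINT y|lebesgue. partial_deriv k \<phi> y) *\<^sub>R c"
    by (intro integral_scaleR_left) simp
  then show "(LINT y|lebesgue. partial_deriv k \<phi> y *\<^sub>R c) = - (LINT y|lebesgue. \<phi> y *\<^sub>R (0::complex ^ 'a) $ k)"
    by (simp add: integral_partial_deriv_test_function[OF \<phi>])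
qed

lemma has_weak_gradient_cong_AE:
  assumes "has_weak_gradient u g" "L2_loc u" "L2_loc v" "AE y in lebesgue. u y = v y"
  shows "has_weak_gradient v g"
proof -
  have "(LINT y|lebesgue. partial_deriv k \<phi> y *\<^sub>R u y) = (LINT y|lebesgue. partial_deriv k \<phi> y *\<^sub>R v y)"
    if \<phi>: "test_function \<phi>" for k \<phi>
  proof (rule integral_cong_AE)
    show "AE y in lebesgue. partial_deriv k \<phi> y *\<^sub>R u y = partial_deriv k \<phi> y *\<^sub>R v y"
      using assms(4) by eventually_elim simp
  qed (use L2_loc_test_integrable(2)[OF assms(2) \<phi>] L2_loc_test_integrable(2)[OF assms(3) \<phi>] in auto)
  then show ?thesis using assms(1) by (simp add: has_weak_gradient_def)
qed

lemma has_weak_gradient_add: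
  assumes "has_weak_gradient u g" "has_weak_gradient v h" "L2_loc u" "L2_loc v"
  shows "has_weak_gradient (\<lambda>y. u y + v y) (\<lambda>y. g y + h y)"
  unfolding has_weak_gradient_def
proof (intro conjI allI impI L2_loc_add)
  show gh: "L2_loc g" "L2_loc h" using assms by (auto simp: has_weak_gradient_def)
  fix \<phi> :: "real ^ 'a \<Rightarrow> real" and k assume \<phi>: "test_function \<phi>"
  have "(LINT y|lebesgue. partial_deriv k \<phi> y *\<^sub>R u y) = - (LINT y|lebesgue. \<phi> y *\<^sub>R g y $ k)"
    "(LINT y|lebesgue. partial_deriv k \<phi> y *\<^sub>R v y) = - (LINT y|lebesgue. \<phi> y *\<^sub>R h y $ k)"
    using assms \<phi> by (auto simp: has_weak_gradient_def)
  moreover have "L2_loc (\<lambda>y. g y $ k)" "L2_loc (\<lambda>y. h y $ k)"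
    using gh by (auto intro!: L2_loc_nth)
  note g' = L2_loc_test_integrable(1)[OF this(1) \<phi>] and h' = L2_loc_test_integrable(1)[OF this(2) \<phi>]
  ultimately show "(LINT y|lebesgue. partial_deriv k \<phi> y *\<^sub>R (u y + v y)) = - (LINT y|lebesgue. \<phi> y *\<^sub>R (g y + h y) $ k)"
    using L2_loc_test_integrable(2)[OF assms(3) \<phi>, of k] L2_loc_test_integrable(2)[OF assms(4) \<phi>, of k]
    by (simp add: scaleR_add_right)
qed

text \<open>Real linearity of \<open>T\<close> suffices, so that complex multiples and conjugation are both covered.\<close>

lemma has_weak_gradient_linear:
  assumes "has_weak_gradient u g" "L2_loc u" and T: "bounded_linear T"
  shows "has_weak_gradient (\<lambda>y. T (u y)) (\<lambda>y. \<chi> k. T (g y $ k))"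
  unfolding has_weak_gradient_def
proof (intro conjI allI impI)
  have "L2_loc g" using assms by (auto simp: has_weak_gradient_def)
  moreover have "bounded_linear (\<lambda>z. \<chi> k. T (z $ k))"
    using bounded_linear.linear[OF T]
    by (intro linear_conv_bounded_linear[THEN iffD1] linearI) (auto simp: vec_eq_iff linear_add linear_scale)
  ultimately show "L2_loc (\<lambda>y. \<chi> k. T (g y $ k))" by (rule L2_loc_linear)
  fix \<phi> :: "real ^ 'a \<Rightarrow> real" and k assume \<phi>: "test_function \<phi>"
  have g: "L2_loc (\<lambda>y. g y $ k)" using \<open>L2_loc g\<close> by (rule L2_loc_nth)
  have eq: "(LINT y|lebesgue. \<psi> y *\<^sub>R T (f y)) = T (LINT y|lebesgue. \<psi> y *\<^sub>R f y)"
    if "integrable lebesgue (\<lambda>y. \<psi> y *\<^sub>R f y)" for \<psi> :: "real ^ 'a \<Rightarrow> real" and f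
    using integral_bounded_linear[OF T that] by (simp add: linear_scale[OF bounded_linear.linear[OF T]])
  have "(LINT y|lebesgue. partial_deriv k \<phi> y *\<^sub>R u y) = - (LINT y|lebesgue. \<phi> y *\<^sub>R g y $ k)"
    using assms \<phi> by (auto simp: has_weak_gradient_def)
  then show "(LINT y|lebesgue. partial_deriv k \<phi> y *\<^sub>R T (u y)) = - (LINT y|lebesgue. \<phi> y *\<^sub>R (\<chi> k. T (g y $ k)) $ k)"
    using L2_loc_test_integrable(2)[OF assms(2) \<phi>] L2_loc_test_integrable(1)[OF g \<phi>]
    by (simp add: eq linear_neg[OF bounded_linear.linear[OF T]])
qed

lemma H1_perD:
  assumes "u \<in> H1_per"
  shows "L2_loc u" "has_weak_gradient u (weak_gradient u)" "L2_loc (weak_gradient u)"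
  using assms weak_gradient(1) by (auto simp: H1_per_def has_weak_gradient_def)

lemma H1_per_add:
  assumes "u \<in> H1_per" "v \<in> H1_per"
  shows "(\<lambda>y. u y + v y) \<in> H1_per"
    and "AE y in lebesgue. weak_gradient (\<lambda>y. u y + v y) y = weak_gradient u y + weak_gradient v y"
proof -
  have *: "has_weak_gradient (\<lambda>y. u y + v y) (\<lambda>y. weak_gradient u y + weak_gradient v y)"
    using assms by (intro has_weak_gradient_add H1_perD)
  then show "AE y in lebesgue. weak_gradient (\<lambda>y. u y + v y) y = weak_gradient u y + weak_gradient v y"
    by (rule weak_gradient(2))
  have "AE y in lebesgue. u (y + axis k 1) + v (y + axis k 1) = u y + v y" for k
  proof -
    have "AE y in lebesgue. u (y + axis k 1) = u y" "AE y in lebesgue. v (y + axis k 1) = v y"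
      using assms by (auto simp: H1_per_def periodic_def)
    then show ?thesis by eventually_elim simp
  qed
  then show "(\<lambda>y. u y + v y) \<in> H1_per"
    using * assms by (auto simp: H1_per_def periodic_def intro!: L2_loc_add)
qed

lemma H1_per_linear:
  assumes "u \<in> H1_per" "bounded_linear T"
  shows "(\<lambda>y. T (u y)) \<in> H1_per"
    and "AE y in lebesgue. weak_gradient (\<lambda>y. T (u y)) y = (\<chi> k. T (weak_gradient u y $ k))"
proof -
  have *: "has_weak_gradient (\<lambda>y. T (u y)) (\<lambda>y. \<chi> k. T (weak_gradient u y $ k))"
    using assms by (intro has_weak_gradient_linear H1_perD)
  then show "AE y in lebesgue. weak_gradient (\<lambda>y. T (u y)) y = (\<chi> k. T (weak_gradient u y $ k))"
    by (rule weak_gradient(2))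
  have "AE y in lebesgue. T (u (y + axis k 1)) = T (u y)" for k
  proof -
    have "AE y in lebesgue. u (y + axis k 1) = u y" using assms by (auto simp: H1_per_def periodic_def)
    then show ?thesis by eventually_elim simp
  qed
  then show "(\<lambda>y. T (u y)) \<in> H1_per"
    using * L2_loc_linear[OF H1_perD(1)[OF assms(1)] assms(2)] by (auto simp: H1_per_def periodic_def)
qed

lemma H1_per_const: "(\<lambda>_. c) \<in> H1_per"
  using has_weak_gradient_const[of c] by (auto simp: H1_per_def periodic_def L2_loc_const)

lemma weak_gradient_AE_const:
  assumes "u \<in> H1_per" "AE y in lebesgue. u y = c"
  shows "AE y in lebesgue. weak_gradient u y = 0"
proof (rule weak_gradient(2), rule has_weak_gradient_cong_AE)
  show "AE y in lebesgue. c = u y" using assms(2) by eventually_elim simp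
qed (use assms(1) in \<open>auto simp: has_weak_gradient_const L2_loc_const H1_perD\<close>)

section \<open>Power series in several real variables\<close>

definition total_degree :: "('n::finite \<Rightarrow> nat) \<Rightarrow> nat" where
  "total_degree m = (\<Sum>i\<in>UNIV. m i)"

definition add_exp :: "('n \<Rightarrow> nat) \<Rightarrow> ('n \<Rightarrow> nat) \<Rightarrow> 'n \<Rightarrow> nat" where
  "add_exp m n = (\<lambda>i. m i + n i)"

definition unit_exp :: "'n \<Rightarrow> 'n \<Rightarrow> nat" where
  "unit_exp k = (\<lambda>i. if i = k then 1 else 0)"

lemma total_degree_simps [simp]:
  "total_degree (add_exp m n) = total_degree m + total_degree n"
  "total_degree (unit_exp k) = 1"
  "total_degree (\<lambda>_. 0) = 0"
  by (simp_all add: total_degree_def add_exp_def unit_exp_def sum.distrib)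

lemma total_degree_ge: "m k \<le> total_degree m"
  unfolding total_degree_def by (intro member_le_sum) auto

lemma total_degree_eq_0_iff [simp]: "total_degree m = 0 \<longleftrightarrow> m = (\<lambda>_. 0)"
  by (auto simp: total_degree_def fun_eq_iff)

lemma monomial_simps [simp]:
  "monomial (add_exp m n) x = monomial m x * monomial n x"
  "monomial (unit_exp k) x = x $ k"
  "monomial (\<lambda>_. 0) x = 1"
  by (simp_all add: monomial_def add_exp_def unit_exp_def power_add prod.distrib if_distrib[of "\<lambda>j. _ ^ j"] cong: if_cong)

lemma monomial_at_0: "monomial m 0 = (if m = (\<lambda>_. 0) then 1 else 0)"
  by (auto simp: monomial_def fun_eq_iff intro!: prod_zero)

lemma monomial_remove:
  fixes m :: "'n::finite \<Rightarrow> nat"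
  shows "monomial m x = (\<Prod>i\<in>UNIV-{k}. x $ i ^ m i) * x $ k ^ m k"
  unfolding monomial_def by (subst prod.remove[of _ k]) (auto simp: mult.commute)

lemma abs_monomial_le:
  assumes "\<And>i. \<bar>x $ i\<bar> \<le> \<rho>"
  shows "\<bar>monomial m x\<bar> \<le> \<rho> ^ total_degree m"
proof -
  have "\<bar>monomial m x\<bar> \<le> (\<Prod>i\<in>UNIV. \<rho> ^ m i)"
    unfolding monomial_def abs_prod using assms by (intro prod_mono) (auto simp: power_abs intro!: power_mono)
  then show ?thesis by (simp add: total_degree_def power_sum)
qed

lemma abs_monomial_le_norm: "norm x \<le> \<rho> \<Longrightarrow> \<bar>monomial m x\<bar> \<le> \<rho> ^ total_degree m"
  by (rule abs_monomial_le) (metis component_le_norm_cart order_trans)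

text \<open>Partial sums over a cube of exponents factor into one-dimensional geometric sums.\<close>

lemma summable_geometric_exp:
  fixes q :: real assumes "0 \<le> q" "q < 1"
  shows "(\<lambda>m :: 'n::finite \<Rightarrow> nat. q ^ total_degree m) summable_on UNIV"
proof (rule nonneg_bdd_above_summable_on)
  show "bdd_above (sum (\<lambda>m :: 'n \<Rightarrow> nat. q ^ total_degree m) ` {F. F \<subseteq> UNIV \<and> finite F})"
  proof (rule bdd_aboveI2)
    fix F :: "('n \<Rightarrow> nat) set" assume "F \<in> {F. F \<subseteq> UNIV \<and> finite F}"
    then have F: "finite F" by simp
    obtain N where N: "\<forall>j \<in> total_degree ` F. j < N"
      using finite_nat_set_iff_bounded[of "total_degree ` F"] F by auto
    have "F \<subseteq> PiE UNIV (\<lambda>_. {..<N})"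
    proof
      fix m assume "m \<in> F"
      then have "m i < N" for i using N total_degree_ge[of m i] by (meson imageI le_less_trans)
      then show "m \<in> PiE UNIV (\<lambda>_. {..<N})" by (auto simp: PiE_UNIV_domain)
    qed
    then have "(\<Sum>m\<in>F. q ^ total_degree m) \<le> (\<Sum>m\<in>PiE UNIV (\<lambda>_::'n. {..<N}). q ^ total_degree m)"
      using assms by (intro sum_mono2 finite_PiE) auto
    also have "\<dots> = (\<Prod>i\<in>(UNIV::'n set). \<Sum>j<N. q ^ j)"
      by (subst prod_sum_PiE) (auto simp: total_degree_def power_sum)
    also have "\<dots> \<le> (\<Prod>i\<in>(UNIV::'n set). 1 / (1 - q))"
    proof (intro prod_mono conjI)
      show "(\<Sum>j<N. q ^ j) \<le> 1 / (1 - q)"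
        using assms sum_le_suminf[of "\<lambda>j. q ^ j" "{..<N}"] suminf_geometric[of q] summable_geometric[of q] by simp
    qed (use assms in \<open>auto intro!: sum_nonneg\<close>)
    finally show "(\<Sum>m\<in>F. q ^ total_degree m) \<le> (\<Prod>i\<in>(UNIV::'n set). 1 / (1 - q))" .
  qed
qed (use assms in auto)

text \<open>Absolute convergence at the corner \<open>(\<rho>, \<dots>, \<rho>)\<close> of a polydisc is part of the notion: it allows the
  rearrangements below and dominates the first derivatives on the ball of half the radius.\<close>

definition mpowser :: "(real ^ 'n \<Rightarrow> complex) \<Rightarrow> real ^ 'n \<Rightarrow> real \<Rightarrow> (('n \<Rightarrow> nat) \<Rightarrow> complex) \<Rightarrow> bool" where
  "mpowser f a \<rho> c \<longleftrightarrow> 0 < \<rho> \<and> (\<lambda>m. \<rho> ^ total_degree m * norm (c m)) summable_on UNIV \<and>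
     (\<forall>h. norm h < \<rho> \<longrightarrow> ((\<lambda>m. monomial m h *\<^sub>R c m) has_sum f (a + h)) UNIV)"

lemma real_analytic_on_mpowser:
  assumes "\<And>a. a \<in> S \<Longrightarrow> \<exists>\<rho> c. mpowser f a \<rho> c \<and> ball a \<rho> \<subseteq> S"
  shows "real_analytic_on f S"
  unfolding real_analytic_on_def
proof
  fix a assume "a \<in> S"
  then obtain \<rho> c where *: "mpowser f a \<rho> c" "ball a \<rho> \<subseteq> S" using assms by blast
  have "((\<lambda>m. monomial m (x - a) *\<^sub>R c m) has_sum f x) UNIV" if "x \<in> ball a \<rho>" for x
    using *(1)[unfolded mpowser_def, THEN conjunct2, THEN conjunct2, rule_format, of "x - a"] that
    by (simp add: dist_norm norm_minus_commute)
  then show "\<exists>r>0. ball a r \<subseteq> S \<and> (\<exists>c. \<forall>x\<in>ball a r. ((\<lambda>m. monomial m (x - a) *\<^sub>R c m) has_sum f x) UNIV)"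
    using * by (intro exI[of _ \<rho>] conjI exI[of _ c] ballI) (auto simp: mpowser_def)
qed

text \<open>Products of series appear as sums over an index type \<open>'p\<close> in which several indices carry the same
  monomial. Absolute convergence permits summing over the fibres of the exponent map \<open>d\<close> first.\<close>

lemma mpowser_regroup:
  fixes K :: "'p \<Rightarrow> complex" and d :: "'p \<Rightarrow> 'n::finite \<Rightarrow> nat"
  assumes \<rho>: "0 < \<rho>" and K: "(\<lambda>p. \<rho> ^ total_degree (d p) * norm (K p)) summable_on UNIV"
    and sum: "\<And>h. norm h < \<rho> \<Longrightarrow> ((\<lambda>p. monomial (d p) h *\<^sub>R K p) has_sum f (a + h)) UNIV"
  shows "mpowser f a \<rho> (\<lambda>n. \<Sum>\<^sub>\<infinity>p\<in>{p. d p = n}. K p)"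
proof -
  have bij: "bij_betw snd (Sigma UNIV (\<lambda>n. {p. d p = n})) UNIV"
    by (rule bij_betwI[where g = "\<lambda>p. (d p, p)"]) auto
  have norm_K: "(\<lambda>p. norm (K p)) summable_on {p. d p = n}" for n
  proof -
    have "(\<lambda>p. \<rho> ^ total_degree (d p) * norm (K p)) summable_on {p. d p = n}"
      using K by (rule summable_on_subset_banach) auto
    moreover have "(\<lambda>p. \<rho> ^ total_degree (d p) * norm (K p)) summable_on {p. d p = n} \<longleftrightarrow>
        (\<lambda>p. \<rho> ^ total_degree n * norm (K p)) summable_on {p. d p = n}"
      by (rule summable_on_cong) auto
    ultimately have "(\<lambda>p. inverse (\<rho> ^ total_degree n) * (\<rho> ^ total_degree n * norm (K p))) summable_on {p. d p = n}"
      by (intro summable_on_cmult_right[where f = "\<lambda>p. \<rho> ^ total_degree n * norm (K p)"]) simp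
    then show ?thesis using \<rho> by (simp flip: mult.assoc)
  qed
  have fiber: "(K has_sum (\<Sum>\<^sub>\<infinity>p\<in>{p. d p = n}. K p)) {p. d p = n}" for n
    by (rule has_sum_infsum[OF abs_summable_summable[OF norm_K]])
  have "((\<lambda>n. monomial n h *\<^sub>R (\<Sum>\<^sub>\<infinity>p\<in>{p. d p = n}. K p)) has_sum f (a + h)) UNIV" if "norm h < \<rho>" for h
  proof (rule has_sum_SigmaD)
    show "((\<lambda>q. monomial (d (snd q)) h *\<^sub>R K (snd q)) has_sum f (a + h)) (Sigma UNIV (\<lambda>n. {p. d p = n}))"
      using has_sum_reindex_bij_betw[OF bij, of "\<lambda>p. monomial (d p) h *\<^sub>R K p"] sum[OF that] by simp
    show "((\<lambda>p. monomial (d (snd (n, p))) h *\<^sub>R K (snd (n, p))) has_sum monomial n h *\<^sub>R (\<Sum>\<^sub>\<infinity>p\<in>{p. d p = n}. K p)) {p. d p = n}" for n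
      using has_sum_scaleR[OF fiber[of n], of "monomial n h"]
      by (subst has_sum_cong[where g = "\<lambda>p. monomial n h *\<^sub>R K p"]) auto
  qed
  moreover have "(\<lambda>n. \<rho> ^ total_degree n * norm (\<Sum>\<^sub>\<infinity>p\<in>{p. d p = n}. K p)) summable_on UNIV"
  proof (rule summable_on_comparison_test)
    obtain s where s: "((\<lambda>p. \<rho> ^ total_degree (d p) * norm (K p)) has_sum s) UNIV"
      using K by (auto simp: summable_on_def)
    have "((\<lambda>n. \<rho> ^ total_degree n * (\<Sum>\<^sub>\<infinity>p\<in>{p. d p = n}. norm (K p))) has_sum s) UNIV"
    proof (rule has_sum_SigmaD)
      show "((\<lambda>q. \<rho> ^ total_degree (d (snd q)) * norm (K (snd q))) has_sum s) (Sigma UNIV (\<lambda>n. {p. d p = n}))"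
        using has_sum_reindex_bij_betw[OF bij, of "\<lambda>p. \<rho> ^ total_degree (d p) * norm (K p)"] s by simp
      show "((\<lambda>p. \<rho> ^ total_degree (d (snd (n, p))) * norm (K (snd (n, p)))) has_sum
          \<rho> ^ total_degree n * (\<Sum>\<^sub>\<infinity>p\<in>{p. d p = n}. norm (K p))) {p. d p = n}" for n
        using has_sum_cmult_right[OF has_sum_infsum[OF norm_K[of n]], of "\<rho> ^ total_degree n"]
        by (subst has_sum_cong[where g = "\<lambda>p. \<rho> ^ total_degree n * norm (K p)"]) auto
    qed
    then show "(\<lambda>n. \<rho> ^ total_degree n * (\<Sum>\<^sub>\<infinity>p\<in>{p. d p = n}. norm (K p))) summable_on UNIV"
      by (auto simp: summable_on_def)
    show "\<rho> ^ total_degree n * norm (\<Sum>\<^sub>\<infinity>p\<in>{p. d p = n}. K p) \<le> \<rho> ^ total_degree n * (\<Sum>\<^sub>\<infinity>p\<in>{p. d p = n}. norm (K p))" for n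
      using \<rho> norm_K[of n] by (intro mult_left_mono norm_infsum_bound) auto
  qed (use \<rho> in auto)
  ultimately show ?thesis using \<rho> by (simp add: mpowser_def)
qed

lemma has_vector_derivative_quadratic:
  fixes F :: "real \<Rightarrow> 'a::real_normed_vector"
  assumes "d > 0" and F: "\<And>t. \<bar>t\<bar> < d \<Longrightarrow> norm (F t - F 0 - t *\<^sub>R D) \<le> M * t\<^sup>2"
  shows "(F has_vector_derivative D) (at 0)"
  unfolding has_vector_derivative_def has_derivative_at
proof (intro conjI bounded_linear_scaleR_left)
  show "(\<lambda>t. norm (F (0 + t) - F 0 - t *\<^sub>R D) / norm t) \<midarrow>0\<rightarrow> 0"
  proof (rule Lim_null_comparison)
    have "norm (norm (F (0 + t) - F 0 - t *\<^sub>R D) / norm t) \<le> M * \<bar>t\<bar>" if "\<bar>t\<bar> < d" "t \<noteq> 0" for t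
    proof -
      have "norm (F t - F 0 - t *\<^sub>R D) / \<bar>t\<bar> \<le> M * t\<^sup>2 / \<bar>t\<bar>"
        by (rule divide_right_mono[OF F[OF that(1)]]) simp
      also have "M * t\<^sup>2 / \<bar>t\<bar> = M * \<bar>t\<bar>" using that(2) by (auto simp: power2_eq_square abs_if)
      finally show ?thesis by simp
    qed
    then show "\<forall>\<^sub>F t in at 0. norm (norm (F (0 + t) - F 0 - t *\<^sub>R D) / norm t) \<le> M * \<bar>t\<bar>"
      using assms(1) by (auto simp: eventually_at)
    show "((\<lambda>t. M * \<bar>t\<bar>) \<longlongrightarrow> (0::real)) (at 0)" by (rule tendsto_eq_intros refl | simp)+
  qed
qed

lemma Suc_le_power_2: "real (Suc j) \<le> 2 ^ j"
  by (induction j) auto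

text \<open>This and the previous bound absorb the factors produced by one or two differentiations into the
  loss of half the radius.\<close>

lemma mult_pred_le_power_2: "real j * real (j - Suc 0) \<le> 2 * 2 ^ j"
proof (induction j)
  case (Suc j)
  have "real (Suc j) * real j \<le> real j * real (j - Suc 0) + 2 * real j"
    by (cases j) (auto simp: algebra_simps)
  also have "2 * real j \<le> 2 * 2 ^ j" using Suc_le_power_2[of j] by simp
  finally show ?case using Suc by simp
qed auto

lemma bij_add_unit_exp: "bij_betw (\<lambda>m. add_exp m (unit_exp k)) UNIV {m. m k \<noteq> 0}"
  by (rule bij_betwI[where g = "\<lambda>m. m(k := m k - 1)"])
     (auto simp: add_exp_def unit_exp_def fun_eq_iff)

definition deriv_coeffs :: "'n \<Rightarrow> (('n \<Rightarrow> nat) \<Rightarrow> complex) \<Rightarrow> ('n \<Rightarrow> nat) \<Rightarrow> complex" where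
  "deriv_coeffs k c m = real (Suc (m k)) *\<^sub>R c (add_exp m (unit_exp k))"

lemma summable_deriv_coeffs:
  assumes "mpowser f a \<rho> c"
  shows "(\<lambda>m. (\<rho> / 2) ^ total_degree m * norm (deriv_coeffs k c m)) summable_on UNIV"
proof (rule summable_on_comparison_test)
  have \<rho>: "\<rho> > 0" using assms by (simp add: mpowser_def)
  have "(\<lambda>m. \<rho> ^ total_degree m * norm (c m)) summable_on {m. m k \<noteq> 0}"
    by (rule summable_on_subset_banach[OF _ subset_UNIV]) (use assms in \<open>simp add: mpowser_def\<close>)
  then have "(\<lambda>m. \<rho> ^ total_degree (add_exp m (unit_exp k)) * norm (c (add_exp m (unit_exp k)))) summable_on UNIV"
    by (subst summable_on_reindex_bij_betw[OF bij_add_unit_exp])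
  then show "(\<lambda>m. 1 / \<rho> * (\<rho> ^ total_degree (add_exp m (unit_exp k)) * norm (c (add_exp m (unit_exp k))))) summable_on UNIV"
    by (rule summable_on_cmult_right)
  fix m
  have "real (Suc (m k)) \<le> 2 ^ total_degree m"
    using Suc_le_power_2[of "m k"] power_increasing[OF total_degree_ge[of m k], of "2::real"]
    by (auto intro: order_trans)
  then have "(\<rho> / 2) ^ total_degree m * real (Suc (m k)) \<le> (\<rho> / 2) ^ total_degree m * 2 ^ total_degree m"
    using \<rho> by (intro mult_left_mono) auto
  also have "\<dots> = \<rho> ^ total_degree m" by (simp add: power_divide)
  finally have "(\<rho> / 2) ^ total_degree m * real (Suc (m k)) * norm (c (add_exp m (unit_exp k)))
      \<le> \<rho> ^ total_degree m * norm (c (add_exp m (unit_exp k)))"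
    by (intro mult_right_mono) auto
  then show "(\<rho> / 2) ^ total_degree m * norm (deriv_coeffs k c m)
      \<le> 1 / \<rho> * (\<rho> ^ total_degree (add_exp m (unit_exp k)) * norm (c (add_exp m (unit_exp k))))"
    using \<rho> by (simp add: deriv_coeffs_def power_add mult.assoc del: of_nat_Suc)
  show "0 \<le> (\<rho> / 2) ^ total_degree m * norm (deriv_coeffs k c m)" using \<rho> by simp
qed

text \<open>The second-order Taylor bound in one coordinate, uniform in \<open>m\<close> relative to the majorant
  \<open>\<rho> ^ total_degree m\<close>. Since \<open>m k - 1\<close> is truncated, the factor \<open>m k\<close> is what removes the term with
  \<open>m k = 0\<close>.\<close>

lemma monomial_increment_bound:
  fixes h :: "real ^ 'n"
  assumes h: "norm h \<le> \<rho> / 2" "\<bar>h $ k + t\<bar> \<le> \<rho> / 2" and \<rho>: "\<rho> > 0"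
  shows "\<bar>monomial m (h + t *\<^sub>R axis k 1) - monomial m h - t * (real (m k) * monomial (m(k := m k - 1)) h)\<bar>
     \<le> 8 / \<rho>\<^sup>2 * \<rho> ^ total_degree m * t\<^sup>2"
proof (cases "t = 0")
  case False
  define j where "j = m k"
  define s where "s = h $ k"
  define R where "R = (\<Prod>i\<in>UNIV-{k}. h $ i ^ m i)"
  have s: "\<bar>s\<bar> \<le> \<rho> / 2" using h(1) component_le_norm_cart[of h k] unfolding s_def by linarith
  have eq: "monomial m (h + t *\<^sub>R axis k 1) - monomial m h - t * (real (m k) * monomial (m(k := m k - 1)) h)
      = R * (t * (((s + t) ^ j - s ^ j) / t - real j * s ^ (j - Suc 0)))"
    using False by (simp add: monomial_remove[of _ _ k] R_def j_def s_def axis_def field_simps)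
  have "\<bar>R\<bar> \<le> (\<Prod>i\<in>UNIV-{k}. (\<rho> / 2) ^ m i)"
    unfolding R_def abs_prod
  proof (rule prod_mono, intro conjI)
    fix i
    have "\<bar>h $ i\<bar> \<le> \<rho> / 2" using h(1) component_le_norm_cart[of h i] by linarith
    then show "\<bar>h $ i ^ m i\<bar> \<le> (\<rho> / 2) ^ m i" by (simp add: power_abs power_mono)
  qed simp
  also have "\<dots> = (\<rho> / 2) ^ (total_degree m - j)"
  proof -
    have "total_degree m = j + (\<Sum>i\<in>UNIV-{k}. m i)"
      unfolding total_degree_def j_def by (rule sum.remove) auto
    then show ?thesis by (simp add: power_sum)
  qed
  finally have R: "\<bar>R\<bar> \<le> (\<rho> / 2) ^ (total_degree m - j)" .
  have D: "\<bar>((s + t) ^ j - s ^ j) / t - real j * s ^ (j - Suc 0)\<bar> \<le> real j * real (j - Suc 0) * (\<rho> / 2) ^ (j - 2) * \<bar>t\<bar>"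
    using lemma_termdiff3[of t s "\<rho> / 2" j] False s h(2) by (simp add: s_def)
  have "\<bar>R * (t * (((s + t) ^ j - s ^ j) / t - real j * s ^ (j - Suc 0)))\<bar>
      \<le> (\<rho> / 2) ^ (total_degree m - j) * (\<bar>t\<bar> * (real j * real (j - Suc 0) * (\<rho> / 2) ^ (j - 2) * \<bar>t\<bar>))"
    unfolding abs_mult using R D \<rho> by (intro mult_mono) auto
  also have "\<dots> \<le> 8 / \<rho>\<^sup>2 * \<rho> ^ total_degree m * t\<^sup>2"
  proof (cases "j \<ge> 2")
    case True
    have "total_degree m \<ge> j" unfolding j_def by (rule total_degree_ge)
    then have "total_degree m = (total_degree m - j) + (j - 2) + 2" using True by simp
    then have "(\<rho> / 2) ^ total_degree m = (\<rho> / 2) ^ ((total_degree m - j) + (j - 2) + 2)" by (rule arg_cong)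
    then have "(\<rho> / 2) ^ total_degree m = (\<rho> / 2) ^ (total_degree m - j) * (\<rho> / 2) ^ (j - 2) * (\<rho> / 2)\<^sup>2"
      by (simp only: power_add)
    then have 1: "(\<rho> / 2) ^ (total_degree m - j) * (\<rho> / 2) ^ (j - 2) = \<rho> ^ total_degree m * (4 / \<rho>\<^sup>2) / 2 ^ total_degree m"
      using \<rho> by (simp add: power_divide[of \<rho> 2 "total_degree m"] power_divide[of \<rho> 2 2] field_simps)
    have "(2::real) ^ j \<le> 2 ^ total_degree m"
      using \<open>total_degree m \<ge> j\<close> by (intro power_increasing) auto
    then have "real j * real (j - Suc 0) \<le> 2 * 2 ^ total_degree m"
      using mult_pred_le_power_2[of j] by linarith
    then have "\<rho> ^ total_degree m * (4 / \<rho>\<^sup>2) / 2 ^ total_degree m * (real j * real (j - Suc 0)) * t\<^sup>2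
        \<le> \<rho> ^ total_degree m * (4 / \<rho>\<^sup>2) / 2 ^ total_degree m * (2 * 2 ^ total_degree m) * t\<^sup>2"
      using \<rho> by (intro mult_right_mono mult_left_mono) auto
    also have "\<dots> = 8 / \<rho>\<^sup>2 * \<rho> ^ total_degree m * t\<^sup>2" by simp
    finally show ?thesis unfolding 1[symmetric] by (simp add: power2_eq_square algebra_simps)
  next
    case False
    then have "j = 0 \<or> j = 1" by auto
    then have "real j * real (j - Suc 0) = 0" by auto
    moreover have "0 \<le> 8 / \<rho>\<^sup>2 * \<rho> ^ total_degree m * t\<^sup>2" using \<rho> by simp
    ultimately show ?thesis by (simp only: mult_zero_left mult_zero_right)
  qed
  finally show ?thesis unfolding eq .
qed (use \<rho> in auto)

lemma has_sum_diff:
  fixes f g :: "'a \<Rightarrow> 'b::topological_ab_group_add"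
  assumes "(f has_sum a) A" "(g has_sum b) A"
  shows "((\<lambda>x. f x - g x) has_sum (a - b)) A"
  using has_sum_add[OF assms(1), of "\<lambda>x. - g x" "- b"] assms(2) by (simp add: has_sum_uminus)

text \<open>Summing the increment bounds shows that the error of the term-by-term derivative is \<open>O(t\<^sup>2)\<close>.
  The derivative is again such a series, which gives access to iterated derivatives.\<close>

lemma mpowser_partial_deriv:
  fixes a :: "real ^ 'n"
  assumes f: "mpowser f a \<rho> c"
  shows "mpowser (partial_deriv k f) a (\<rho> / 2) (deriv_coeffs k c)"
    and "norm h < \<rho> / 2 \<Longrightarrow> ((\<lambda>t. f (a + h + t *\<^sub>R axis k 1)) has_vector_derivative partial_deriv k f (a + h)) (at 0)"
proof -
  have \<rho>: "\<rho> > 0" using f by (simp add: mpowser_def)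
  define g where "g h = (\<Sum>\<^sub>\<infinity>m. monomial m h *\<^sub>R deriv_coeffs k c m)" for h :: "real ^ 'n"
  have g: "((\<lambda>m. monomial m h *\<^sub>R deriv_coeffs k c m) has_sum g h) UNIV" if "norm h < \<rho> / 2" for h
    unfolding g_def
  proof (rule has_sum_infsum, rule abs_summable_summable)
    show "(\<lambda>m. norm (monomial m h *\<^sub>R deriv_coeffs k c m)) summable_on UNIV"
    proof (rule summable_on_comparison_test[OF summable_deriv_coeffs[OF f, of k]])
      fix m show "norm (monomial m h *\<^sub>R deriv_coeffs k c m) \<le> (\<rho> / 2) ^ total_degree m * norm (deriv_coeffs k c m)"
        using abs_monomial_le_norm[of h "\<rho> / 2" m] that by (simp add: mult_right_mono)
    qed simp
  qed
  obtain M where M: "((\<lambda>m. \<rho> ^ total_degree m * norm (c m)) has_sum M) UNIV"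
    using f unfolding mpowser_def summable_on_def by blast
  have deriv: "((\<lambda>t. f (a + h + t *\<^sub>R axis k 1)) has_vector_derivative g h) (at 0)" if h: "norm h < \<rho> / 2" for h
  proof (rule has_vector_derivative_quadratic)
    show "\<rho> / 2 - norm h > 0" using h by simp
    have g': "((\<lambda>m. (real (m k) * monomial (m(k := m k - 1)) h) *\<^sub>R c m) has_sum g h) UNIV"
    proof -
      have "monomial m h *\<^sub>R deriv_coeffs k c m =
          (real (add_exp m (unit_exp k) k) * monomial ((add_exp m (unit_exp k))(k := add_exp m (unit_exp k) k - 1)) h)
            *\<^sub>R c (add_exp m (unit_exp k))" for m
      proof -
        have "(add_exp m (unit_exp k))(k := add_exp m (unit_exp k) k - 1) = m"
          by (auto simp: add_exp_def unit_exp_def fun_eq_iff)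
        then show ?thesis by (simp add: deriv_coeffs_def add_exp_def unit_exp_def mult.commute)
      qed
      then have "((\<lambda>m. (real (m k) * monomial (m(k := m k - 1)) h) *\<^sub>R c m) has_sum g h) {m. m k \<noteq> 0}"
        using g[OF h] has_sum_reindex_bij_betw[OF bij_add_unit_exp[of k],
            of "\<lambda>m. (real (m k) * monomial (m(k := m k - 1)) h) *\<^sub>R c m" "g h"] by simp
      then show ?thesis by (subst (asm) has_sum_cong_neutral[where T = UNIV]) auto
    qed
    fix t :: real assume t: "\<bar>t\<bar> < \<rho> / 2 - norm h"
    have ht: "norm (h + t *\<^sub>R axis k 1) < \<rho> / 2"
      using norm_triangle_ineq[of h "t *\<^sub>R axis k 1"] t by simp
    have s: "((\<lambda>m. monomial m h *\<^sub>R c m) has_sum f (a + h)) UNIV" if "norm h < \<rho>" for h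
      using f that by (simp add: mpowser_def)
    have "((\<lambda>m. monomial m (h + t *\<^sub>R axis k 1) *\<^sub>R c m - monomial m h *\<^sub>R c m
        - t *\<^sub>R ((real (m k) * monomial (m(k := m k - 1)) h) *\<^sub>R c m))
        has_sum (f (a + (h + t *\<^sub>R axis k 1)) - f (a + h) - t *\<^sub>R g h)) UNIV"
      using h ht \<rho> by (intro has_sum_diff has_sum_scaleR s g') auto
    then have "norm (f (a + (h + t *\<^sub>R axis k 1)) - f (a + h) - t *\<^sub>R g h) \<le> (8 / \<rho>\<^sup>2 * t\<^sup>2) * M"
    proof (rule norm_infsum_le)
      show "((\<lambda>m. (8 / \<rho>\<^sup>2 * t\<^sup>2) * (\<rho> ^ total_degree m * norm (c m))) has_sum (8 / \<rho>\<^sup>2 * t\<^sup>2) * M) UNIV"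
        by (rule has_sum_cmult_right[OF M])
      fix m
      have "\<bar>h $ k + t\<bar> \<le> \<rho> / 2" using component_le_norm_cart[of h k] t by linarith
      then have "\<bar>monomial m (h + t *\<^sub>R axis k 1) - monomial m h - t * (real (m k) * monomial (m(k := m k - 1)) h)\<bar> * norm (c m)
         \<le> (8 / \<rho>\<^sup>2 * \<rho> ^ total_degree m * t\<^sup>2) * norm (c m)"
        using h \<rho> by (intro mult_right_mono monomial_increment_bound) auto
      then show "norm (monomial m (h + t *\<^sub>R axis k 1) *\<^sub>R c m - monomial m h *\<^sub>R c m
          - t *\<^sub>R ((real (m k) * monomial (m(k := m k - 1)) h) *\<^sub>R c m))
         \<le> (8 / \<rho>\<^sup>2 * t\<^sup>2) * (\<rho> ^ total_degree m * norm (c m))"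
        unfolding scaleR_scaleR scaleR_diff_left[symmetric] norm_scaleR by (simp only: mult_ac)
    qed
    then show "norm (f (a + h + t *\<^sub>R axis k 1) - f (a + h + 0 *\<^sub>R axis k 1) - t *\<^sub>R g h) \<le> (8 / \<rho>\<^sup>2 * M) * t\<^sup>2"
      by (simp add: algebra_simps)
  qed
  have pd: "partial_deriv k f (a + h) = g h" if "norm h < \<rho> / 2" for h
    unfolding partial_deriv_def by (rule vector_derivative_at[OF deriv[OF that]])
  show "mpowser (partial_deriv k f) a (\<rho> / 2) (deriv_coeffs k c)"
    using \<rho> summable_deriv_coeffs[OF f, of k] g pd by (simp add: mpowser_def)
  show "norm h < \<rho> / 2 \<Longrightarrow> ((\<lambda>t. f (a + h + t *\<^sub>R axis k 1)) has_vector_derivative partial_deriv k f (a + h)) (at 0)"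
    using deriv[of h] pd[of h] by simp
qed

lemma mpowser_at_center:
  assumes "mpowser f a \<rho> c"
  shows "f a = c (\<lambda>_. 0)"
proof -
  have "((\<lambda>m. monomial m 0 *\<^sub>R c m) has_sum f (a + 0)) UNIV"
    using assms unfolding mpowser_def by (metis norm_zero)
  moreover have "((\<lambda>m. monomial m 0 *\<^sub>R c m) has_sum c (\<lambda>_. 0)) UNIV"
    by (rule has_sum_finite_neutralI[of "{\<lambda>_. 0}"]) (auto simp: monomial_at_0)
  ultimately show ?thesis by (metis add.right_neutral has_sum_unique)
qed

lemma mpowser_deriv_at_center:
  assumes "mpowser f a \<rho> c"
  shows "((\<lambda>t. f (a + t *\<^sub>R axis k 1)) has_vector_derivative c (unit_exp k)) (at 0)"
    and "partial_deriv k f a = c (unit_exp k)"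
    and "partial_deriv k (partial_deriv l f) a = (if k = l then 2 else 1) * c (add_exp (unit_exp k) (unit_exp l))"
proof -
  have u: "add_exp (\<lambda>_. 0) (unit_exp k) = unit_exp k" for k :: 'a by (simp add: add_exp_def)
  show pd: "partial_deriv k f a = c (unit_exp k)"
    using mpowser_at_center[OF mpowser_partial_deriv(1)[OF assms]] by (simp add: deriv_coeffs_def u)
  show "((\<lambda>t. f (a + t *\<^sub>R axis k 1)) has_vector_derivative c (unit_exp k)) (at 0)"
    using mpowser_partial_deriv(2)[OF assms, of 0 k] assms by (simp add: pd mpowser_def)
  show "partial_deriv k (partial_deriv l f) a = (if k = l then 2 else 1) * c (add_exp (unit_exp k) (unit_exp l))"
    using mpowser_at_center[OF mpowser_partial_deriv(1)[OF mpowser_partial_deriv(1)[OF assms]], of k l]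
    by (simp add: deriv_coeffs_def u scaleR_conv_of_real) (simp add: unit_exp_def)
qed

section \<open>Sesquilinear forms on square-integrable fields over the cell\<close>

lemma cmat_nth [simp]: "cmat M $ i $ j = complex_of_real (M $ i $ j)"
  by (simp add: cmat_def map_matrix_def)

lemma cmat_mult_nth: "(cmat M *v z) $ i = (\<Sum>j\<in>UNIV. complex_of_real (M $ i $ j) * z $ j)"
  by (simp add: matrix_vector_mult_def)

definition Re_vec :: "complex ^ 'n \<Rightarrow> real ^ 'n" where "Re_vec z = (\<chi> i. Re (z $ i))"
definition Im_vec :: "complex ^ 'n \<Rightarrow> real ^ 'n" where "Im_vec z = (\<chi> i. Im (z $ i))"

lemma norm_Re_Im_vec: "(norm z)\<^sup>2 = (norm (Re_vec z))\<^sup>2 + (norm (Im_vec z))\<^sup>2"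
  by (simp add: power2_norm_eq_inner inner_vec_def Re_vec_def Im_vec_def inner_complex_def sum.distrib)

lemma Re_Im_cmat_mult:
  "Re_vec (cmat M *v z) = M *v Re_vec z" "Im_vec (cmat M *v z) = M *v Im_vec z"
  by (simp_all add: vec_eq_iff Re_vec_def Im_vec_def cmat_mult_nth matrix_vector_mult_def)

lemma norm_cmat_mult_le:
  assumes "\<And>\<xi>. norm (M *v \<xi>) \<le> \<beta> * norm \<xi>"
  shows "norm (cmat M *v z) \<le> \<beta> * norm z"
proof -
  have \<beta>: "\<beta> \<ge> 0"
    using assms[of "axis undefined 1"] norm_ge_zero[of "M *v axis undefined 1"] by (simp del: norm_ge_zero)
  have "(norm (M *v \<xi>))\<^sup>2 \<le> \<beta>\<^sup>2 * (norm \<xi>)\<^sup>2" for \<xi>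
    using power_mono[OF assms[of \<xi>] norm_ge_zero, of 2] by (simp add: power_mult_distrib)
  from add_mono[OF this[of "Re_vec z"] this[of "Im_vec z"]]
  have "(norm (cmat M *v z))\<^sup>2 \<le> (\<beta> * norm z)\<^sup>2"
    by (simp add: norm_Re_Im_vec[of "cmat M *v z"] norm_Re_Im_vec[of z] Re_Im_cmat_mult power_mult_distrib distrib_left)
  then show ?thesis by (rule power2_le_imp_le) (use \<beta> in simp)
qed

lemma Re_cdot_cnj: "Re (cdot z (cnj_vec w)) = Re_vec z \<bullet> Re_vec w + Im_vec z \<bullet> Im_vec w"
  by (simp add: cdot_def cnj_vec_def inner_vec_def Re_vec_def Im_vec_def sum.distrib)

text \<open>A real matrix acts separately on the real and imaginary parts, and only the diagonal
  contributions survive in the real part.\<close>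

lemma cdot_cmat_coercive:
  assumes "\<And>\<xi>. (M *v \<xi>) \<bullet> \<xi> \<ge> \<alpha> * (norm \<xi>)\<^sup>2"
  shows "Re (cdot (cmat M *v z) (cnj_vec z)) \<ge> \<alpha> * (norm z)\<^sup>2"
  using assms[of "Re_vec z"] assms[of "Im_vec z"]
  by (simp add: Re_cdot_cnj Re_Im_cmat_mult norm_Re_Im_vec[of z] distrib_left)

lemma norm_cnj_vec [simp]: "norm (cnj_vec z) = norm z"
  by (simp add: norm_vec_def cnj_vec_def)

lemma norm_cdot_le: "norm (cdot z w) \<le> norm z * norm w"
proof -
  have "norm (cdot z w) \<le> (\<Sum>i\<in>UNIV. norm (z $ i) * norm (w $ i))"
    unfolding cdot_def by (rule order_trans[OF norm_sum]) (simp add: norm_mult)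
  also have "\<dots> \<le> norm z * norm w"
    using L2_set_mult_ineq[of "\<lambda>i. norm (z $ i)" "\<lambda>i. norm (w $ i)" UNIV] by (simp add: norm_vec_def)
  finally show ?thesis .
qed

lemma cdot_cmat_symmetric:
  assumes "transpose M = M"
  shows "cdot (cmat M *v z) w = cdot (cmat M *v w) z"
proof -
  have M: "M $ i $ j = M $ j $ i" for i j using assms by (metis transpose_def vec_lambda_beta)
  have "cdot (cmat M *v z) w = (\<Sum>i\<in>UNIV. \<Sum>j\<in>UNIV. complex_of_real (M $ i $ j) * z $ j * w $ i)"
    by (simp add: cdot_def cmat_mult_nth sum_distrib_right)
  also have "\<dots> = (\<Sum>j\<in>UNIV. \<Sum>i\<in>UNIV. complex_of_real (M $ j $ i) * z $ j * w $ i)"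
  proof (subst sum.swap, intro sum.cong refl)
    fix i j show "complex_of_real (M $ i $ j) * z $ j * w $ i = complex_of_real (M $ j $ i) * z $ j * w $ i"
      by (subst M) (rule refl)
  qed
  also have "\<dots> = cdot (cmat M *v w) z"
    unfolding cdot_def cmat_mult_nth sum_distrib_right by (intro sum.cong refl) (simp only: mult_ac)
  finally show ?thesis .
qed

abbreviation cell_measure :: "(real ^ 'n) measure" where
  "cell_measure \<equiv> lebesgue_on cell"

lemma cell_lebesgue [simp, measurable]: "cell \<in> sets lebesgue"
  by (simp add: cell_def)

lemma measure_cell: "measure lebesgue (cell :: (real ^ 'n) set) = 1"
proof -
  have "cbox 0 (1 :: real ^ 'n) \<noteq> {}" by (simp add: interval_ne_empty_cart)
  from content_cbox_cart[OF this] show ?thesis by (simp add: cell_def)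
qed

lemma set_integral_cell: "(LINT y:cell|lebesgue. f y) = (LINT y|cell_measure. f y)"
  for f :: "real ^ 'n \<Rightarrow> 'a::{banach, second_countable_topology}"
  by (simp add: integral_restrict_space set_lebesgue_integral_def)

lemma AE_cell: "AE y in lebesgue. P y \<Longrightarrow> AE y in cell_measure. P y"
  by (auto simp: AE_restrict_space_iff elim: eventually_mono)

definition L2_cell :: "(real ^ 'n \<Rightarrow> 'a::euclidean_space) \<Rightarrow> bool" where
  "L2_cell f \<longleftrightarrow> f \<in> borel_measurable cell_measure \<and> integrable cell_measure (\<lambda>y. (norm (f y))\<^sup>2)"

definition L2_cell_norm :: "(real ^ 'n \<Rightarrow> 'a::euclidean_space) \<Rightarrow> real" where
  "L2_cell_norm f = sqrt (LINT y|cell_measure. (norm (f y))\<^sup>2)"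

lemma L2_cell_norm_nonneg [simp]: "L2_cell_norm f \<ge> 0"
  by (simp add: L2_cell_norm_def)

lemma L2_loc_imp_L2_cell:
  assumes "L2_loc f"
  shows "L2_cell f"
proof -
  have "set_integrable lebesgue cell (\<lambda>y. (norm (f y))\<^sup>2)"
    using assms by (simp add: L2_loc_def cell_def)
  moreover have "f \<in> borel_measurable lebesgue" using assms by (simp add: L2_loc_def)
  ultimately show ?thesis
    by (simp add: L2_cell_def integrable_restrict_space set_integrable_def measurable_restrict_space1)
qed

lemma L2_cell_add:
  fixes f g :: "real ^ 'n \<Rightarrow> 'a::euclidean_space"
  assumes "L2_cell f" "L2_cell g"
  shows "L2_cell (\<lambda>y. f y + g y)"
proof -
  have [measurable]: "f \<in> borel_measurable cell_measure" "g \<in> borel_measurable cell_measure"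
    using assms by (auto simp: L2_cell_def)
  have "integrable cell_measure (\<lambda>y. 2 * (norm (f y))\<^sup>2 + 2 * (norm (g y))\<^sup>2)"
    using assms unfolding L2_cell_def by (intro Bochner_Integration.integrable_add integrable_mult_right) auto
  then have "integrable cell_measure (\<lambda>y. (norm (f y + g y))\<^sup>2)"
  proof (rule Bochner_Integration.integrable_bound)
    have "(norm (f y + g y))\<^sup>2 \<le> 2 * (norm (f y))\<^sup>2 + 2 * (norm (g y))\<^sup>2" for y
      by (rule norm_add_square_le)
    then show "AE y in cell_measure. norm ((norm (f y + g y))\<^sup>2) \<le> norm (2 * (norm (f y))\<^sup>2 + 2 * (norm (g y))\<^sup>2)"
      by (intro AE_I2) auto
  qed measurable
  then show ?thesis by (simp add: L2_cell_def)
qed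

lemma L2_cell_linear:
  fixes f :: "real ^ 'n \<Rightarrow> 'a::euclidean_space" and T :: "'a \<Rightarrow> 'b::euclidean_space"
  assumes "L2_cell f" "bounded_linear T"
  shows "L2_cell (\<lambda>y. T (f y))"
proof -
  have [measurable]: "f \<in> borel_measurable cell_measure" "T \<in> borel_measurable borel"
    using assms by (auto simp: L2_cell_def borel_measurable_continuous_onI linear_continuous_on)
  obtain C where C: "\<And>x. norm (T x) \<le> norm x * C" "C > 0" using bounded_linear.pos_bounded[OF assms(2)] by metis
  have "integrable cell_measure (\<lambda>y. C\<^sup>2 * (norm (f y))\<^sup>2)"
    using assms unfolding L2_cell_def by (intro integrable_mult_right) auto
  then have "integrable cell_measure (\<lambda>y. (norm (T (f y)))\<^sup>2)"
  proof (rule Bochner_Integration.integrable_bound)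
    have "(norm (T (f y)))\<^sup>2 \<le> C\<^sup>2 * (norm (f y))\<^sup>2" for y
      using power_mono[OF C(1)[of "f y"], of 2] by (simp add: power_mult_distrib mult.commute)
    then show "AE y in cell_measure. norm ((norm (T (f y)))\<^sup>2) \<le> norm (C\<^sup>2 * (norm (f y))\<^sup>2)"
      by (intro AE_I2) auto
  qed measurable
  then show ?thesis by (simp add: L2_cell_def)
qed

lemma L2_cell_scaleR: "L2_cell f \<Longrightarrow> L2_cell (\<lambda>y. r *\<^sub>R f y)"
  by (rule L2_cell_linear[OF _ bounded_linear_scaleR_right])

lemma L2_cell_zero: "L2_cell (\<lambda>_. 0)" by (simp add: L2_cell_def)

lemma L2_cell_sum:
  fixes f :: "'i \<Rightarrow> real ^ 'n \<Rightarrow> 'a::euclidean_space"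
  assumes "\<And>i. i \<in> I \<Longrightarrow> L2_cell (f i)"
  shows "L2_cell (\<lambda>y. \<Sum>i\<in>I. r i *\<^sub>R f i y)"
  using assms
proof (induction I rule: infinite_finite_induct)
  case (insert i I)
  have "L2_cell (\<lambda>y. r i *\<^sub>R f i y + (\<Sum>i\<in>I. r i *\<^sub>R f i y))"
    using insert by (intro L2_cell_add L2_cell_scaleR) auto
  then show ?case using insert by simp
qed (auto simp: L2_cell_zero)

lemma L2_cell_norm_cong_AE:
  assumes "AE y in cell_measure. f y = g y" "L2_cell f" "L2_cell g"
  shows "L2_cell_norm f = L2_cell_norm g"
proof -
  have "(LINT y|cell_measure. (norm (f y))\<^sup>2) = (LINT y|cell_measure. (norm (g y))\<^sup>2)"
  proof (rule integral_cong_AE)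
    show "AE y in cell_measure. (norm (f y))\<^sup>2 = (norm (g y))\<^sup>2" using assms(1) by eventually_elim simp
  qed (use assms(2,3) in \<open>auto simp: L2_cell_def\<close>)
  then show ?thesis by (simp add: L2_cell_norm_def)
qed

lemma L2_cell_norm_eq_0:
  assumes "L2_cell f" "L2_cell_norm f = 0"
  shows "AE y in cell_measure. f y = 0"
proof -
  have "AE y in cell_measure. (norm (f y))\<^sup>2 = 0"
    using assms by (subst integral_nonneg_eq_0_iff_AE[symmetric]) (auto simp: L2_cell_def L2_cell_norm_def)
  then show ?thesis by eventually_elim simp
qed

text \<open>The quadratic form \<open>(s, t) \<mapsto> \<integral>(s f + t g)\<^sup>2\<close> is nonnegative; its discriminant gives the inequality.\<close>

lemma integral_Cauchy_Schwarz:
  fixes f g :: "'a \<Rightarrow> real"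
  assumes f: "integrable N (\<lambda>x. (f x)\<^sup>2)" and g: "integrable N (\<lambda>x. (g x)\<^sup>2)" and fg: "integrable N (\<lambda>x. f x * g x)"
  shows "\<bar>LINT x|N. f x * g x\<bar> \<le> sqrt (LINT x|N. (f x)\<^sup>2) * sqrt (LINT x|N. (g x)\<^sup>2)"
proof -
  define A where "A = (LINT x|N. (f x)\<^sup>2)"
  define B where "B = (LINT x|N. (g x)\<^sup>2)"
  define C where "C = (LINT x|N. f x * g x)"
  have nonneg: "0 \<le> s\<^sup>2 * A + 2 * s * t * C + t\<^sup>2 * B" for s t
  proof -
    have "0 \<le> (LINT x|N. (s * f x + t * g x)\<^sup>2)" by simp
    also have "\<dots> = (LINT x|N. s\<^sup>2 * (f x)\<^sup>2 + 2 * s * t * (f x * g x) + t\<^sup>2 * (g x)\<^sup>2)"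
      by (intro Bochner_Integration.integral_cong) (auto simp: power2_eq_square algebra_simps)
    also have "\<dots> = s\<^sup>2 * A + 2 * s * t * C + t\<^sup>2 * B"
      using f g fg unfolding A_def B_def C_def by simp
    finally show ?thesis .
  qed
  have AB: "A \<ge> 0" "B \<ge> 0" by (simp_all add: A_def B_def)
  have "C\<^sup>2 \<le> A * B"
  proof (cases "B = 0")
    case True
    have "C = 0"
    proof (rule ccontr)
      assume "C \<noteq> 0"
      then show False using nonneg[of 1 "- (A + 1) / (2 * C)"] True by (simp add: field_simps)
    qed
    then show ?thesis using True by simp
  next
    case False
    have "0 \<le> B * (A * B - C\<^sup>2)"
      using nonneg[of B "- C"] by (simp add: power2_eq_square algebra_simps)
    then show ?thesis using False AB by (simp add: zero_le_mult_iff)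
  qed
  then have "\<bar>C\<bar> \<le> sqrt (A * B)" by (rule real_le_rsqrt[of "\<bar>C\<bar>", simplified])
  then show ?thesis by (simp add: real_sqrt_mult A_def B_def C_def)
qed

text \<open>The form \<open>\<langle>M f, g\<rangle>\<close> on vector fields, detached from gradients. All shifted forms are instances
  of it with different fields, which is why the dependence on \<open>\<eta>\<close> can be moved into the fields.\<close>

definition field_form :: "(real ^ 'n \<Rightarrow> real ^ 'n ^ 'n) \<Rightarrow> (real ^ 'n \<Rightarrow> complex ^ 'n) \<Rightarrow> (real ^ 'n \<Rightarrow> complex ^ 'n) \<Rightarrow> complex" where
  "field_form M f g = (LINT y|cell_measure. cdot (cmat (M y) *v f y) (cnj_vec (g y)))"

lemma shifted_form_eq: "shifted_form M \<eta> u v = field_form M (shifted_gradient \<eta> u) (shifted_gradient \<eta> v)"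
  by (simp add: shifted_form_def field_form_def set_integral_cell)

lemma coeff_classD:
  fixes M :: "real ^ 'n \<Rightarrow> real ^ 'n ^ 'n"
  assumes "M \<in> coeff_class \<alpha> \<beta>"
  shows "(\<lambda>y. M y $ k $ l) \<in> borel_measurable cell_measure"
    and "AE y in cell_measure. transpose (M y) = M y"
    and "AE y in cell_measure. \<forall>\<xi>. (M y *v \<xi>) \<bullet> \<xi> \<ge> \<alpha> * (norm \<xi>)\<^sup>2"
    and "AE y in cell_measure. \<forall>\<xi>. norm (M y *v \<xi>) \<le> \<beta> * norm \<xi>"
  using assms by (auto simp: coeff_class_def AE_restrict_space_iff elim: eventually_mono)

lemma coeff_class_nonneg:
  assumes "M \<in> coeff_class \<alpha> \<beta>"
  shows "\<beta> \<ge> 0"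
proof (rule ccontr)
  assume "\<not> \<beta> \<ge> 0"
  have "AE y in (cell_measure :: (real ^ 'a) measure). False"
  proof (rule eventually_mono[OF coeff_classD(4)[OF assms]])
    fix y assume *: "\<forall>\<xi>. norm (M y *v \<xi>) \<le> \<beta> * norm \<xi>"
    have "0 \<le> norm (M y *v axis undefined 1)" by simp
    also have "\<dots> \<le> \<beta> * norm (axis undefined 1 :: real ^ 'a)" using * by blast
    finally show False using \<open>\<not> \<beta> \<ge> 0\<close> by simp
  qed
  then have "emeasure lebesgue (cell :: (real ^ 'a) set) = 0"
    using AE_iff_measurable[of cell "cell_measure :: (real ^ 'a) measure" "\<lambda>_. False"]
    by (simp add: emeasure_restrict_space sets_restrict_space_iff)
  then show False using measure_cell[where 'n = 'a] by (simp add: measure_def)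
qed

lemma field_form_integrand:
  fixes M :: "real ^ 'n \<Rightarrow> real ^ 'n ^ 'n"
  assumes M: "M \<in> coeff_class \<alpha> \<beta>" and f: "L2_cell f" and g: "L2_cell g"
  shows "integrable cell_measure (\<lambda>y. norm (f y) * norm (g y))"
    and "integrable cell_measure (\<lambda>y. cdot (cmat (M y) *v f y) (cnj_vec (g y)))"
    and "AE y in cell_measure. norm (cdot (cmat (M y) *v f y) (cnj_vec (g y))) \<le> \<beta> * (norm (f y) * norm (g y))"
proof -
  have fg [measurable]: "f \<in> borel_measurable cell_measure" "g \<in> borel_measurable cell_measure"
    using f g by (auto simp: L2_cell_def)
  have nth: "(\<lambda>z :: complex ^ 'n. z $ i) \<in> borel_measurable borel" for i
    by (intro borel_measurable_continuous_onI continuous_intros)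
  have [measurable]: "(\<lambda>y. f y $ i) \<in> borel_measurable cell_measure" "(\<lambda>y. g y $ i) \<in> borel_measurable cell_measure" for i
    using measurable_compose[OF fg(1) nth] measurable_compose[OF fg(2) nth] by auto
  have [measurable]: "(\<lambda>z. cnj z) \<in> borel_measurable borel"
    by (intro borel_measurable_continuous_onI continuous_intros)
  note coeff_classD(1)[OF M, measurable]
  have meas: "(\<lambda>y. cdot (cmat (M y) *v f y) (cnj_vec (g y))) \<in> borel_measurable cell_measure"
    unfolding cdot_def cmat_mult_nth cnj_vec_def vec_lambda_beta by measurable
  have "integrable cell_measure (\<lambda>y. (norm (f y))\<^sup>2 + (norm (g y))\<^sup>2)"
    using f g by (simp add: L2_cell_def)
  then show fg_int: "integrable cell_measure (\<lambda>y. norm (f y) * norm (g y))"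
  proof (rule Bochner_Integration.integrable_bound)
    show "AE y in cell_measure. norm (norm (f y) * norm (g y)) \<le> norm ((norm (f y))\<^sup>2 + (norm (g y))\<^sup>2)"
    proof (intro AE_I2)
      fix y
      have "norm (f y) * norm (g y) \<ge> 0" by simp
      then have "norm (f y) * norm (g y) \<le> (norm (f y))\<^sup>2 + (norm (g y))\<^sup>2"
        using sum_squares_bound[of "norm (f y)" "norm (g y)"] unfolding mult.assoc by linarith
      then show "norm (norm (f y) * norm (g y)) \<le> norm ((norm (f y))\<^sup>2 + (norm (g y))\<^sup>2)" by simp
    qed
  qed measurable
  show bound: "AE y in cell_measure. norm (cdot (cmat (M y) *v f y) (cnj_vec (g y))) \<le> \<beta> * (norm (f y) * norm (g y))"
    using coeff_classD(4)[OF M]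
  proof eventually_elim
    case (elim y)
    have "norm (cdot (cmat (M y) *v f y) (cnj_vec (g y))) \<le> norm (cmat (M y) *v f y) * norm (g y)"
      using norm_cdot_le[of "cmat (M y) *v f y" "cnj_vec (g y)"] by simp
    also have "\<dots> \<le> (\<beta> * norm (f y)) * norm (g y)"
      using elim by (intro mult_right_mono norm_cmat_mult_le) auto
    finally show ?case by (simp add: mult.assoc)
  qed
  have "integrable cell_measure (\<lambda>y. \<beta> * (norm (f y) * norm (g y)))"
    using fg_int by (rule integrable_mult_right)
  then show "integrable cell_measure (\<lambda>y. cdot (cmat (M y) *v f y) (cnj_vec (g y)))"
    by (rule Bochner_Integration.integrable_bound[OF _ meas])
       (use bound coeff_class_nonneg[OF M] in \<open>auto elim: eventually_mono\<close>)
qed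

lemma field_form_bound:
  assumes M: "M \<in> coeff_class \<alpha> \<beta>" and f: "L2_cell f" and g: "L2_cell g"
  shows "norm (field_form M f g) \<le> \<beta> * (L2_cell_norm f * L2_cell_norm g)"
proof -
  note I = field_form_integrand[OF M f g]
  have "norm (field_form M f g) \<le> (LINT y|cell_measure. norm (cdot (cmat (M y) *v f y) (cnj_vec (g y))))"
    unfolding field_form_def by (rule integral_norm_bound)
  also have "\<dots> \<le> (LINT y|cell_measure. \<beta> * (norm (f y) * norm (g y)))"
    by (intro integral_mono_AE integrable_mult_right I integrable_norm)
  also have "\<dots> = \<beta> * (LINT y|cell_measure. norm (f y) * norm (g y))" by simp
  also have "\<dots> \<le> \<beta> * (L2_cell_norm f * L2_cell_norm g)"
    using integral_Cauchy_Schwarz[of cell_measure "\<lambda>y. norm (f y)" "\<lambda>y. norm (g y)"] f g I(1) coeff_class_nonneg[OF M]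
    unfolding L2_cell_norm_def by (intro mult_left_mono) (auto simp: L2_cell_def)
  finally show ?thesis .
qed

lemma cdot_linear:
  "cdot (z + z') w = cdot z w + cdot z' w" "cdot z (w + w') = cdot z w + cdot z w'"
  "cdot (c *s z) w = c * cdot z w" "cdot z (c *s w) = c * cdot z w"
  by (simp_all add: cdot_def sum.distrib sum_distrib_left algebra_simps)

lemma cnj_vec_linear: "cnj_vec (z + w) = cnj_vec z + cnj_vec w" "cnj_vec (c *s z) = cnj c *s cnj_vec z"
  by (simp_all add: cnj_vec_def vec_eq_iff)

lemma scaleR_eq_smult: "r *\<^sub>R z = complex_of_real r *s z" for z :: "complex ^ 'n"
  unfolding vec_eq_iff vector_scaleR_component by (simp add: scaleR_conv_of_real)

lemma field_form_add_left:
  assumes "M \<in> coeff_class \<alpha> \<beta>" "L2_cell f" "L2_cell h" "L2_cell g"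
  shows "field_form M (\<lambda>y. f y + h y) g = field_form M f g + field_form M h g"
  using field_form_integrand(2)[OF assms(1,2,4)] field_form_integrand(2)[OF assms(1,3,4)]
  unfolding field_form_def by (simp add: matrix_vector_right_distrib cdot_linear)

lemma field_form_add_right:
  assumes "M \<in> coeff_class \<alpha> \<beta>" "L2_cell f" "L2_cell h" "L2_cell g"
  shows "field_form M g (\<lambda>y. f y + h y) = field_form M g f + field_form M g h"
  using field_form_integrand(2)[OF assms(1,4,2)] field_form_integrand(2)[OF assms(1,4,3)]
  unfolding field_form_def by (simp add: cdot_linear cnj_vec_linear)

lemma field_form_smult:
  "field_form M (\<lambda>y. c *s f y) g = c * field_form M f g"
  "field_form M f (\<lambda>y. c *s g y) = cnj c * field_form M f g"
  unfolding field_form_def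
  by (simp_all add: cdot_linear cnj_vec_linear vector_scalar_commute)

lemma field_form_scaleR:
  "field_form M (\<lambda>y. r *\<^sub>R f y) g = r *\<^sub>R field_form M f g"
  "field_form M f (\<lambda>y. r *\<^sub>R g y) = r *\<^sub>R field_form M f g"
  unfolding scaleR_eq_smult by (simp_all add: field_form_smult scaleR_conv_of_real)

lemma field_form_zero [simp]: "field_form M (\<lambda>y. 0) g = 0" "field_form M f (\<lambda>y. 0) = 0"
  using field_form_scaleR(1)[of M 0] field_form_scaleR(2)[of M _ 0] by auto

lemma field_form_sum:
  assumes M: "M \<in> coeff_class \<alpha> \<beta>"
    and f: "\<And>i. i \<in> I \<Longrightarrow> L2_cell (f i)" and g: "\<And>j. j \<in> J \<Longrightarrow> L2_cell (g j)"
  shows "field_form M (\<lambda>y. \<Sum>i\<in>I. r i *\<^sub>R f i y) (\<lambda>y. \<Sum>j\<in>J. s j *\<^sub>R g j y)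
    = (\<Sum>(i, j)\<in>I \<times> J. (r i * s j) *\<^sub>R field_form M (f i) (g j))"
proof -
  have left: "field_form M (\<lambda>y. \<Sum>i\<in>I. r i *\<^sub>R f i y) h = (\<Sum>i\<in>I. r i *\<^sub>R field_form M (f i) h)" if h: "L2_cell h" for h
    using f
  proof (induction I rule: infinite_finite_induct)
    case (insert i I)
    then show ?case
      using field_form_add_left[OF M L2_cell_scaleR[of "f i" "r i"] L2_cell_sum[of I f r] h]
      by (simp add: field_form_scaleR)
  qed auto
  have right: "field_form M h (\<lambda>y. \<Sum>j\<in>J. s j *\<^sub>R g j y) = (\<Sum>j\<in>J. s j *\<^sub>R field_form M h (g j))" if h: "L2_cell h" for h
    using g
  proof (induction J rule: infinite_finite_induct)
    case (insert j J)
    then show ?case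
      using field_form_add_right[OF M L2_cell_scaleR[of "g j" "s j"] L2_cell_sum[of J g s] h]
      by (simp add: field_form_scaleR)
  qed auto
  show ?thesis
    using f by (simp add: left L2_cell_sum[OF g] right sum.cartesian_product[symmetric] scaleR_sum_right)
qed

lemma field_form_cong_AE:
  assumes M: "M \<in> coeff_class \<alpha> \<beta>" and L2: "L2_cell f" "L2_cell f'" "L2_cell g" "L2_cell g'"
    and eq: "AE y in cell_measure. f y = f' y" "AE y in cell_measure. g y = g' y"
  shows "field_form M f g = field_form M f' g'"
  unfolding field_form_def
proof (rule integral_cong_AE)
  show "AE y in cell_measure. cdot (cmat (M y) *v f y) (cnj_vec (g y)) = cdot (cmat (M y) *v f' y) (cnj_vec (g' y))"
    using eq by eventually_elim simp
qed (use field_form_integrand(2)[OF M L2(1,3)] field_form_integrand(2)[OF M L2(2,4)] in auto)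

text \<open>The source of uniqueness for the cell problem.\<close>

lemma field_form_coercive:
  assumes M: "M \<in> coeff_class \<alpha> \<beta>" and "\<alpha> > 0" and f: "L2_cell f" and zero: "field_form M f f = 0"
  shows "AE y in cell_measure. f y = 0"
proof -
  note I = field_form_integrand(2)[OF M f f]
  have f2: "integrable cell_measure (\<lambda>y. (norm (f y))\<^sup>2)" using f by (simp add: L2_cell_def)
  have "\<alpha> * (LINT y|cell_measure. (norm (f y))\<^sup>2) = (LINT y|cell_measure. \<alpha> * (norm (f y))\<^sup>2)" by simp
  also have "\<dots> \<le> (LINT y|cell_measure. Re (cdot (cmat (M y) *v f y) (cnj_vec (f y))))"
  proof (intro integral_mono_AE)
    show "integrable cell_measure (\<lambda>y. \<alpha> * (norm (f y))\<^sup>2)" using f2 by simp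
    show "integrable cell_measure (\<lambda>y. Re (cdot (cmat (M y) *v f y) (cnj_vec (f y))))" using I by simp
    show "AE y in cell_measure. \<alpha> * (norm (f y))\<^sup>2 \<le> Re (cdot (cmat (M y) *v f y) (cnj_vec (f y)))"
      using coeff_classD(3)[OF M] by eventually_elim (auto intro: cdot_cmat_coercive)
  qed
  also have "\<dots> = Re (field_form M f f)" unfolding field_form_def using I by simp
  finally have "(LINT y|cell_measure. (norm (f y))\<^sup>2) \<le> 0" using zero \<open>\<alpha> > 0\<close> by (simp add: mult_le_0_iff)
  moreover have "(LINT y|cell_measure. (norm (f y))\<^sup>2) \<ge> 0" by simp
  ultimately have "L2_cell_norm f = 0" by (simp add: L2_cell_norm_def)
  then show ?thesis by (rule L2_cell_norm_eq_0[OF f])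
qed

section \<open>The shifted form along analytic families\<close>

lemma H1_per_L2_cell:
  assumes "u \<in> H1_per"
  shows "L2_cell u" "L2_cell (weak_gradient u)"
  using H1_perD[OF assms] by (auto intro: L2_loc_imp_L2_cell)

lemma H1_norm_eq: "H1_norm u = sqrt (LINT y|cell_measure. (norm (u y))\<^sup>2 + (norm (weak_gradient u y))\<^sup>2)"
  by (simp add: H1_norm_def set_integral_cell)

lemma H1_norm_nonneg [simp]: "H1_norm u \<ge> 0"
  unfolding H1_norm_eq by (intro real_sqrt_ge_zero integral_nonneg_AE) auto

lemma H1_norm_square:
  assumes "u \<in> H1_per"
  shows "(H1_norm u)\<^sup>2 = (L2_cell_norm u)\<^sup>2 + (L2_cell_norm (weak_gradient u))\<^sup>2"
proof -
  have "(H1_norm u)\<^sup>2 = (LINT y|cell_measure. (norm (u y))\<^sup>2 + (norm (weak_gradient u y))\<^sup>2)"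
    unfolding H1_norm_eq by (intro real_sqrt_pow2 integral_nonneg_AE) auto
  then show ?thesis
    using H1_per_L2_cell[OF assms] by (simp add: L2_cell_def L2_cell_norm_def)
qed

lemma H1_norm_eq_0:
  assumes "u \<in> H1_per" "H1_norm u = 0"
  shows "AE y in cell_measure. u y = 0" "AE y in cell_measure. weak_gradient u y = 0"
proof -
  have "L2_cell_norm u = 0" "L2_cell_norm (weak_gradient u) = 0"
    using H1_norm_square[OF assms(1)] assms(2) by (simp_all add: sum_power2_eq_zero_iff)
  then show "AE y in cell_measure. u y = 0" "AE y in cell_measure. weak_gradient u y = 0"
    using H1_per_L2_cell[OF assms(1)] by (auto intro: L2_cell_norm_eq_0)
qed

lemma H1_per_scaleR:
  assumes "u \<in> H1_per"
  shows "(\<lambda>y. r *\<^sub>R u y) \<in> H1_per"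
    and "AE y in lebesgue. weak_gradient (\<lambda>y. r *\<^sub>R u y) y = r *\<^sub>R weak_gradient u y"
proof -
  note * = H1_per_linear[OF assms bounded_linear_scaleR_right[of r]]
  show "(\<lambda>y. r *\<^sub>R u y) \<in> H1_per" by (rule *(1))
  show "AE y in lebesgue. weak_gradient (\<lambda>y. r *\<^sub>R u y) y = r *\<^sub>R weak_gradient u y"
    using *(2) by eventually_elim (simp add: vec_eq_iff)
qed

lemma H1_per_diff:
  assumes "u \<in> H1_per" "v \<in> H1_per"
  shows "(\<lambda>y. u y - v y) \<in> H1_per"
    and "AE y in lebesgue. weak_gradient (\<lambda>y. u y - v y) y = weak_gradient u y - weak_gradient v y"
proof -
  note v = H1_per_scaleR[OF assms(2), of "-1"]
  show "(\<lambda>y. u y - v y) \<in> H1_per" using H1_per_add(1)[OF assms(1) v(1)] by simp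
  show "AE y in lebesgue. weak_gradient (\<lambda>y. u y - v y) y = weak_gradient u y - weak_gradient v y"
    using H1_per_add(2)[OF assms(1) v(1)] v(2) by eventually_elim simp
qed

lemma H1_per_sum:
  assumes "\<And>i. c i \<in> H1_per"
  shows "(\<lambda>y. \<Sum>i\<in>I. r i *\<^sub>R c i y) \<in> H1_per"
    and "AE y in lebesgue. weak_gradient (\<lambda>y. \<Sum>i\<in>I. r i *\<^sub>R c i y) y = (\<Sum>i\<in>I. r i *\<^sub>R weak_gradient (c i) y)"
proof -
  have "(\<lambda>y. \<Sum>i\<in>I. r i *\<^sub>R c i y) \<in> H1_per \<and>
    (AE y in lebesgue. weak_gradient (\<lambda>y. \<Sum>i\<in>I. r i *\<^sub>R c i y) y = (\<Sum>i\<in>I. r i *\<^sub>R weak_gradient (c i) y))"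
  proof (induction I rule: infinite_finite_induct)
    case (insert i I)
    note I = conjunct1[OF insert.IH] conjunct2[OF insert.IH]
    note i = H1_per_scaleR[OF assms, of "r i" i]
    have eq: "(\<lambda>y. \<Sum>i\<in>insert i I. r i *\<^sub>R c i y) = (\<lambda>y. r i *\<^sub>R c i y + (\<Sum>i\<in>I. r i *\<^sub>R c i y))"
      using insert.hyps by simp
    have "AE y in lebesgue. weak_gradient (\<lambda>y. r i *\<^sub>R c i y + (\<Sum>i\<in>I. r i *\<^sub>R c i y)) y
        = (\<Sum>i\<in>insert i I. r i *\<^sub>R weak_gradient (c i) y)"
      using H1_per_add(2)[OF i(1) I(1)] i(2) I(2) by eventually_elim (use insert.hyps in simp)
    then show ?case unfolding eq using H1_per_add(1)[OF i(1) I(1)] by blast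
  qed (auto simp: H1_per_const intro: weak_gradient_AE_const)
  then show "(\<lambda>y. \<Sum>i\<in>I. r i *\<^sub>R c i y) \<in> H1_per"
    "AE y in lebesgue. weak_gradient (\<lambda>y. \<Sum>i\<in>I. r i *\<^sub>R c i y) y = (\<Sum>i\<in>I. r i *\<^sub>R weak_gradient (c i) y)"
    by blast+
qed

lemma H1_norm_scaleR:
  assumes "u \<in> H1_per"
  shows "H1_norm (\<lambda>y. r *\<^sub>R u y) = \<bar>r\<bar> * H1_norm u"
proof -
  have "(H1_norm (\<lambda>y. r *\<^sub>R u y))\<^sup>2 = (L2_cell_norm (\<lambda>y. r *\<^sub>R u y))\<^sup>2 + (L2_cell_norm (\<lambda>y. r *\<^sub>R weak_gradient u y))\<^sup>2"
    unfolding H1_norm_square[OF H1_per_scaleR(1)[OF assms]]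
    using L2_cell_norm_cong_AE[OF AE_cell[OF H1_per_scaleR(2)[OF assms, of r]]]
      H1_per_L2_cell(2)[OF H1_per_scaleR(1)[OF assms, of r]] L2_cell_scaleR[OF H1_per_L2_cell(2)[OF assms], of r] by simp
  also have "\<dots> = (\<bar>r\<bar> * H1_norm u)\<^sup>2"
    by (simp add: H1_norm_square[OF assms] L2_cell_norm_def power_mult_distrib distrib_left)
  finally show ?thesis by (simp add: power2_eq_iff_nonneg)
qed

lemma L2_cell_norm_add_square:
  fixes f g :: "real ^ 'n \<Rightarrow> 'a::euclidean_space"
  assumes "L2_cell f" "L2_cell g"
  shows "(L2_cell_norm (\<lambda>y. f y + g y))\<^sup>2 \<le> 2 * (L2_cell_norm f)\<^sup>2 + 2 * (L2_cell_norm g)\<^sup>2"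
proof -
  have "(LINT y|cell_measure. (norm (f y + g y))\<^sup>2) \<le> (LINT y|cell_measure. 2 * (norm (f y))\<^sup>2 + 2 * (norm (g y))\<^sup>2)"
    using L2_cell_add[OF assms] assms
    by (intro integral_mono norm_add_square_le) (auto simp: L2_cell_def)
  also have "\<dots> = 2 * (LINT y|cell_measure. (norm (f y))\<^sup>2) + 2 * (LINT y|cell_measure. (norm (g y))\<^sup>2)"
    using assms by (simp add: L2_cell_def)
  finally show ?thesis by (simp add: L2_cell_norm_def)
qed

lemma H1_norm_add_square:
  assumes u: "u \<in> H1_per" and v: "v \<in> H1_per"
  shows "(H1_norm (\<lambda>y. u y + v y))\<^sup>2 \<le> 2 * (H1_norm u)\<^sup>2 + 2 * (H1_norm v)\<^sup>2"
proof -
  note uv = H1_per_L2_cell[OF u] H1_per_L2_cell[OF v]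
  have "L2_cell_norm (weak_gradient (\<lambda>y. u y + v y)) = L2_cell_norm (\<lambda>y. weak_gradient u y + weak_gradient v y)"
    by (rule L2_cell_norm_cong_AE[OF AE_cell[OF H1_per_add(2)[OF u v]] H1_per_L2_cell(2)[OF H1_per_add(1)[OF u v]] L2_cell_add[OF uv(2,4)]])
  then show ?thesis
    using L2_cell_norm_add_square[OF uv(1,3)] L2_cell_norm_add_square[OF uv(2,4)]
    by (simp add: H1_norm_square u v H1_per_add(1))
qed

lemma shifted_gradient_0 [simp]: "shifted_gradient 0 u = weak_gradient u"
  by (simp add: shifted_gradient_def fun_eq_iff vec_eq_iff)

text \<open>Around \<open>a\<close> the shifted gradient is affine in \<open>h = \<eta> - a\<close>: \<open>None\<close> selects its constant part and
  \<open>Some k\<close> the coefficient of \<open>h\<^sub>k\<close>. The exponents of the corresponding monomials are \<open>part_exp\<close>.\<close>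

definition field_part :: "real ^ 'n \<Rightarrow> 'n option \<Rightarrow> (real ^ 'n \<Rightarrow> complex) \<Rightarrow> real ^ 'n \<Rightarrow> complex ^ 'n" where
  "field_part a j u = (case j of None \<Rightarrow> shifted_gradient a u | Some k \<Rightarrow> (\<lambda>y. (\<i> * u y) *s axis k 1))"

definition part_exp :: "'n option \<Rightarrow> 'n \<Rightarrow> nat" where
  "part_exp j = (case j of None \<Rightarrow> (\<lambda>_. 0) | Some k \<Rightarrow> unit_exp k)"

lemma sum_UNIV_option: "(\<Sum>j\<in>UNIV. f j) = f None + (\<Sum>k\<in>UNIV. f (Some k))"
  for f :: "'n::finite option \<Rightarrow> 'a::comm_monoid_add"
  by (simp add: UNIV_option_conv sum.reindex)

lemma shifted_gradient_eq_sum: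
  "shifted_gradient (a + h) u y = (\<Sum>j\<in>UNIV. monomial (part_exp j) h *\<^sub>R field_part a j u y)"
  by (simp add: vec_eq_iff sum_UNIV_option part_exp_def field_part_def shifted_gradient_def axis_def
      algebra_simps scaleR_eq_smult if_distrib[of "\<lambda>x. _ * x"] cong: if_cong)

lemma shifted_gradient_eq:
  "shifted_gradient a u y = weak_gradient u y + (\<Sum>k\<in>UNIV. (a $ k) *\<^sub>R ((\<i> * u y) *s axis k 1))"
  using shifted_gradient_eq_sum[of 0 a u y]
  by (simp add: sum_UNIV_option part_exp_def field_part_def)

lemma L2_cell_field_part:
  assumes "u \<in> H1_per"
  shows "L2_cell (field_part a j u)"
proof -
  have *: "L2_cell (\<lambda>y. (\<i> * u y) *s (axis k 1 :: complex ^ 'a))" for k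
  proof (rule L2_cell_linear[OF H1_per_L2_cell(1)[OF assms]])
    show "bounded_linear (\<lambda>z. (\<i> * z) *s (axis k 1 :: complex ^ 'a))"
      by (intro linear_conv_bounded_linear[THEN iffD1] linearI) (simp_all add: vec_eq_iff algebra_simps)
  qed
  have "L2_cell (shifted_gradient a u)"
    unfolding shifted_gradient_eq[abs_def] by (intro L2_cell_add L2_cell_sum * H1_per_L2_cell(2)[OF assms])
  then show ?thesis using * by (simp add: field_part_def split: option.split)
qed

lemma L2_cell_shifted_gradient: "u \<in> H1_per \<Longrightarrow> L2_cell (shifted_gradient a u)"
  using L2_cell_field_part[of u a None] by (simp add: field_part_def)

lemma norm_field_part_le:
  "(norm (field_part a j u y))\<^sup>2 \<le> 2 * (1 + (norm a)\<^sup>2) * ((norm (u y))\<^sup>2 + (norm (weak_gradient u y))\<^sup>2)"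
proof (cases j)
  case None
  have "(norm (field_part a j u y))\<^sup>2 \<le> 2 * (norm (weak_gradient u y))\<^sup>2 + 2 * (norm (\<chi> k. \<i> * complex_of_real (a $ k) * u y))\<^sup>2"
    using norm_add_square_le[of "weak_gradient u y" "\<chi> k. \<i> * complex_of_real (a $ k) * u y"]
    by (simp add: None field_part_def shifted_gradient_def vec_eq_iff plus_vec_def)
  also have "(norm (\<chi> k. \<i> * complex_of_real (a $ k) * u y))\<^sup>2 = (norm a)\<^sup>2 * (norm (u y))\<^sup>2"
    by (simp add: norm_vec_def L2_set_def sum_nonneg norm_mult power_mult_distrib sum_distrib_right)
  also have "2 * (norm (weak_gradient u y))\<^sup>2 + 2 * ((norm a)\<^sup>2 * (norm (u y))\<^sup>2)
      \<le> 2 * (1 + (norm a)\<^sup>2) * ((norm (u y))\<^sup>2 + (norm (weak_gradient u y))\<^sup>2)"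
    by (simp add: algebra_simps)
  finally show ?thesis .
next
  case (Some k)
  have "norm ((\<i> * u y) *s (axis k 1 :: complex ^ 'a)) = norm (u y)"
  proof -
    have "(\<i> * u y) *s (axis k 1 :: complex ^ 'a) = axis k (\<i> * u y)" by (simp add: vec_eq_iff axis_def)
    then show ?thesis
      by (simp add: norm_vec_def L2_set_def axis_def norm_mult if_distrib[of norm] if_distrib[of "\<lambda>x. x\<^sup>2"] cong: if_cong)
  qed
  moreover have "0 \<le> (norm a)\<^sup>2 * (norm (u y))\<^sup>2" "0 \<le> (norm a)\<^sup>2 * (norm (weak_gradient u y))\<^sup>2" by simp_all
  ultimately show ?thesis by (simp add: Some field_part_def algebra_simps)
qed

lemma L2_cell_norm_field_part:
  assumes "u \<in> H1_per"
  shows "L2_cell_norm (field_part a j u) \<le> sqrt (2 * (1 + (norm a)\<^sup>2)) * H1_norm u"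
proof -
  note u = H1_per_L2_cell[OF assms]
  have "(LINT y|cell_measure. (norm (field_part a j u y))\<^sup>2)
      \<le> (LINT y|cell_measure. 2 * (1 + (norm a)\<^sup>2) * ((norm (u y))\<^sup>2 + (norm (weak_gradient u y))\<^sup>2))"
    using L2_cell_field_part[OF assms, of a j] u
    by (intro integral_mono norm_field_part_le integrable_mult_right Bochner_Integration.integrable_add) (auto simp: L2_cell_def)
  then show ?thesis
    unfolding L2_cell_norm_def H1_norm_eq real_sqrt_mult[symmetric] by (simp add: real_sqrt_le_iff)
qed

lemma L2_cell_norm_shifted_gradient:
  "u \<in> H1_per \<Longrightarrow> L2_cell_norm (shifted_gradient a u) \<le> sqrt (2 * (1 + (norm a)\<^sup>2)) * H1_norm u"
  using L2_cell_norm_field_part[of u a None] by (simp add: field_part_def)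

lemma shifted_gradient_sum:
  assumes "\<And>i. c i \<in> H1_per"
  shows "AE y in cell_measure. shifted_gradient a (\<lambda>y. \<Sum>i\<in>I. r i *\<^sub>R c i y) y = (\<Sum>i\<in>I. r i *\<^sub>R shifted_gradient a (c i) y)"
  using AE_cell[OF H1_per_sum(2)[of c, OF assms, where r = r and I = I]]
proof eventually_elim
  case (elim y)
  then show ?case
    by (simp add: shifted_gradient_def vec_eq_iff sum.distrib sum_distrib_left scaleR_add_right)
qed

lemma shifted_gradient_add:
  assumes "u \<in> H1_per" "v \<in> H1_per"
  shows "AE y in cell_measure. shifted_gradient a (\<lambda>y. u y + v y) y = shifted_gradient a u y + shifted_gradient a v y"
  using AE_cell[OF H1_per_add(2)[OF assms]]
  by eventually_elim (simp add: shifted_gradient_def vec_eq_iff algebra_simps)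

definition H1_powser :: "(real ^ 'n \<Rightarrow> real ^ 'n \<Rightarrow> complex) \<Rightarrow> real ^ 'n \<Rightarrow> real \<Rightarrow> (('n \<Rightarrow> nat) \<Rightarrow> real ^ 'n \<Rightarrow> complex) \<Rightarrow> bool" where
  "H1_powser f a r c \<longleftrightarrow> 0 < r \<and> (\<forall>m. c m \<in> H1_per) \<and> (\<forall>x\<in>ball a r. f x \<in> H1_per \<and>
     ((\<lambda>F. H1_norm (\<lambda>y. f x y - (\<Sum>m\<in>F. monomial m (x - a) *\<^sub>R c m y))) \<longlongrightarrow> 0) (finite_subsets_at_top UNIV))"

lemma H1_powserD:
  assumes "H1_powser f a r c"
  shows "0 < r" and "c m \<in> H1_per" and "x \<in> ball a r \<Longrightarrow> f x \<in> H1_per"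
    and "x \<in> ball a r \<Longrightarrow> ((\<lambda>F. H1_norm (\<lambda>y. f x y - (\<Sum>m\<in>F. monomial m (x - a) *\<^sub>R c m y))) \<longlongrightarrow> 0) (finite_subsets_at_top UNIV)"
  using assms by (simp_all add: H1_powser_def)

lemma H1_analytic_on_powser:
  assumes f: "H1_analytic_on f S" and "a \<in> S"
  obtains r c where "H1_powser f a r c" "ball a r \<subseteq> S"
proof -
  note f' = f[unfolded H1_analytic_on_def, THEN bspec]
  obtain r c where r: "r > 0" "ball a r \<subseteq> S" "\<forall>m. c m \<in> H1_per"
    "\<forall>x\<in>ball a r. ((\<lambda>F. H1_norm (\<lambda>y. f x y - (\<Sum>m\<in>F. monomial m (x - a) *\<^sub>R c m y))) \<longlongrightarrow> 0) (finite_subsets_at_top UNIV)"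
    using f'[OF \<open>a \<in> S\<close>, THEN conjunct2] by (elim exE conjE)
  moreover have "\<forall>x\<in>ball a r. f x \<in> H1_per"
    using f'[THEN conjunct1] r(2) by (simp add: subset_iff)
  ultimately have "H1_powser f a r c" by (simp add: H1_powser_def)
  then show ?thesis using r(2) by (rule that)
qed

lemma H1_powser_const:
  assumes "v \<in> H1_per" "0 < r"
  shows "H1_powser (\<lambda>_. v) a r (\<lambda>m. if m = (\<lambda>_. 0) then v else (\<lambda>_. 0))"
  unfolding H1_powser_def
proof (intro conjI ballI allI)
  fix x
  have "H1_norm (\<lambda>_::real ^ 'a. 0) = 0"
    using H1_norm_scaleR[OF assms(1), of 0] by simp
  moreover have "(\<lambda>y. v y - (\<Sum>m\<in>F. monomial m (x - a) *\<^sub>R (if m = (\<lambda>_. 0) then v else (\<lambda>_. 0)) y)) = (\<lambda>_. 0)"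
    if "finite F" "{\<lambda>_. 0} \<subseteq> F" for F :: "('a \<Rightarrow> nat) set"
  proof
    fix y
    have "(\<Sum>m\<in>F. monomial m (x - a) *\<^sub>R (if m = (\<lambda>_. 0) then v else (\<lambda>_. 0)) y) = (\<Sum>m\<in>{(\<lambda>_. 0) :: 'a \<Rightarrow> nat}. v y)"
      by (rule sum.mono_neutral_cong_right) (use that in auto)
    then show "v y - (\<Sum>m\<in>F. monomial m (x - a) *\<^sub>R (if m = (\<lambda>_. 0) then v else (\<lambda>_. 0)) y) = 0" by simp
  qed
  ultimately have "\<forall>\<^sub>F F in finite_subsets_at_top UNIV.
      H1_norm (\<lambda>y. v y - (\<Sum>m\<in>F. monomial m (x - a) *\<^sub>R (if m = (\<lambda>_. 0) then v else (\<lambda>_. 0)) y)) = 0"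
    unfolding eventually_finite_subsets_at_top by (intro exI[of _ "{\<lambda>_. 0}"]) auto
  then show "((\<lambda>F. H1_norm (\<lambda>y. v y - (\<Sum>m\<in>F. monomial m (x - a) *\<^sub>R (if m = (\<lambda>_. 0) then v else (\<lambda>_. 0)) y))) \<longlongrightarrow> 0) (finite_subsets_at_top UNIV)"
    by (rule tendsto_eventually)
qed (use assms in \<open>auto simp: H1_per_const\<close>)

text \<open>Unconditional convergence bounds the terms: beyond a finite set, each one is the difference of
  two remainders of norm less than \<open>1\<close>. In an infinite-dimensional space it does not give absolute
  convergence at the same point, so absolute convergence is recovered on a smaller polydisc.\<close>

lemma H1_powser_terms_bounded:
  assumes f: "H1_powser f a r c" and h: "norm h < r"
  obtains C where "\<And>m. \<bar>monomial m h\<bar> * H1_norm (c m) \<le> C"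
proof -
  have x: "a + h \<in> ball a r" using h by (simp add: dist_norm)
  have c: "c m \<in> H1_per" for m using f by (simp add: H1_powser_def)
  define D where "D F = (\<lambda>y. f (a + h) y - (\<Sum>m\<in>F. monomial m h *\<^sub>R c m y))" for F
  have fx: "f (a + h) \<in> H1_per"
    using f x by (simp add: H1_powser_def)
  have "((\<lambda>F. H1_norm (\<lambda>y. f (a + h) y - (\<Sum>m\<in>F. monomial m (a + h - a) *\<^sub>R c m y))) \<longlongrightarrow> 0) (finite_subsets_at_top UNIV)"
    by (rule H1_powserD(4)[OF f x])
  then have "((\<lambda>F. H1_norm (D F)) \<longlongrightarrow> 0) (finite_subsets_at_top UNIV)" by (simp add: D_def)
  then have "\<forall>\<^sub>F F in finite_subsets_at_top UNIV. H1_norm (D F) < 1" by (rule order_tendstoD) simp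
  then obtain F0 where F0: "finite F0" "\<And>F. finite F \<Longrightarrow> F0 \<subseteq> F \<Longrightarrow> H1_norm (D F) < 1"
    unfolding eventually_finite_subsets_at_top by auto
  have D: "D F \<in> H1_per" for F unfolding D_def by (intro H1_per_diff H1_per_sum fx c)
  define C where "C = 2 + (\<Sum>m\<in>F0. \<bar>monomial m h\<bar> * H1_norm (c m))"
  have pos: "0 \<le> (\<Sum>m\<in>F0. \<bar>monomial m h\<bar> * H1_norm (c m))" by (intro sum_nonneg) auto
  show ?thesis
  proof (rule that[of C])
    fix m
    show "\<bar>monomial m h\<bar> * H1_norm (c m) \<le> C"
    proof (cases "m \<in> F0")
      case True
      have "\<bar>monomial m h\<bar> * H1_norm (c m) \<le> (\<Sum>m\<in>F0. \<bar>monomial m h\<bar> * H1_norm (c m))"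
        using True F0(1) by (intro member_le_sum) auto
      then show ?thesis by (simp add: C_def)
    next
      case False
      have eq: "(\<lambda>y. monomial m h *\<^sub>R c m y) = (\<lambda>y. D F0 y + (-1) *\<^sub>R D (insert m F0) y)"
        using False F0(1) by (simp add: D_def fun_eq_iff)
      have 1: "(H1_norm (D F0))\<^sup>2 \<le> 1" "(H1_norm (D (insert m F0)))\<^sup>2 \<le> 1"
        using F0(2)[OF F0(1) order_refl] F0(2)[of "insert m F0", OF _ subset_insertI] F0(1)
        by (auto intro!: power_le_one)
      have "(\<bar>monomial m h\<bar> * H1_norm (c m))\<^sup>2 = (H1_norm (\<lambda>y. D F0 y + (-1) *\<^sub>R D (insert m F0) y))\<^sup>2"
        unfolding eq[symmetric] H1_norm_scaleR[OF c] ..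
      also have "\<dots> \<le> 2 * (H1_norm (D F0))\<^sup>2 + 2 * (H1_norm (\<lambda>y. (-1) *\<^sub>R D (insert m F0) y))\<^sup>2"
        by (intro H1_norm_add_square D H1_per_scaleR(1))
      also have "\<dots> \<le> 2\<^sup>2" using 1 unfolding H1_norm_scaleR[OF D] by simp
      finally have "\<bar>monomial m h\<bar> * H1_norm (c m) \<le> 2" by (rule power2_le_imp_le) simp
      then show ?thesis using pos by (simp add: C_def)
    qed
  qed
qed

text \<open>The bound on the terms at the corner \<open>a + (\<rho>, \<dots>, \<rho>)\<close> is the Cauchy estimate for the coefficients.\<close>

lemma H1_powser_coeff_bound:
  fixes a :: "real ^ 'n"
  assumes f: "H1_powser f a r c" and \<rho>: "0 < \<rho>" "\<rho> * norm (1 :: real ^ 'n) < r"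
  obtains C where "\<And>m. \<rho> ^ total_degree m * H1_norm (c m) \<le> C"
proof -
  have "norm (\<rho> *\<^sub>R (1 :: real ^ 'n)) < r" using \<rho> by simp
  then obtain C where C: "\<And>m. \<bar>monomial m (\<rho> *\<^sub>R (1 :: real ^ 'n))\<bar> * H1_norm (c m) \<le> C"
    using H1_powser_terms_bounded[OF f] by metis
  have "monomial m (\<rho> *\<^sub>R (1 :: real ^ 'n)) = \<rho> ^ total_degree m" for m
    by (simp add: monomial_def total_degree_def power_sum)
  then show ?thesis using C \<rho>(1) by (intro that[of C]) simp
qed

text \<open>A bounded sesquilinear form is jointly continuous, so its values on the partial sums of both
  series converge to its value on the limits.\<close>

lemma shifted_form_tendsto:
  assumes M: "M \<in> coeff_class \<alpha> \<beta>" and x: "x \<in> ball a r"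
    and f: "H1_powser f a r c" and g: "H1_powser g a r d"
  shows "((\<lambda>F. shifted_form M x (\<lambda>y. \<Sum>m\<in>F. monomial m (x - a) *\<^sub>R c m y) (\<lambda>y. \<Sum>m\<in>F. monomial m (x - a) *\<^sub>R d m y))
     \<longlongrightarrow> shifted_form M x (f x) (g x)) (finite_subsets_at_top UNIV)"
proof -
  define SF where "SF F = (\<lambda>y. \<Sum>m\<in>F. monomial m (x - a) *\<^sub>R c m y)" for F
  define SG where "SG F = (\<lambda>y. \<Sum>m\<in>F. monomial m (x - a) *\<^sub>R d m y)" for F
  define DF where "DF F = (\<lambda>y. f x y - SF F y)" for F
  define DG where "DG F = (\<lambda>y. g x y - SG F y)" for F
  have c: "c m \<in> H1_per" and d: "d m \<in> H1_per" for m using f g by (simp_all add: H1_powser_def)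
  have fx: "f x \<in> H1_per" "g x \<in> H1_per" using f g x by (simp_all add: H1_powser_def)
  have S: "SF F \<in> H1_per" "SG F \<in> H1_per" for F
    unfolding SF_def SG_def by (intro H1_per_sum c d)+
  have D: "DF F \<in> H1_per" "DG F \<in> H1_per" for F
    unfolding DF_def DG_def by (intro H1_per_diff fx S)+
  have lim: "((\<lambda>F. H1_norm (DF F)) \<longlongrightarrow> 0) (finite_subsets_at_top UNIV)" "((\<lambda>F. H1_norm (DG F)) \<longlongrightarrow> 0) (finite_subsets_at_top UNIV)"
    using f g x by (simp_all add: H1_powser_def DF_def DG_def SF_def SG_def)
  define \<kappa> where "\<kappa> = sqrt (2 * (1 + (norm x)\<^sup>2))"
  let ?G = "shifted_gradient x"
  have L2: "L2_cell (?G u)" if "u \<in> H1_per" for u using that by (rule L2_cell_shifted_gradient)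
  have bound: "norm (field_form M (?G u) (?G v)) \<le> \<beta> * (\<kappa> * H1_norm u * (\<kappa> * H1_norm v))" if "u \<in> H1_per" "v \<in> H1_per" for u v
  proof -
    have "norm (field_form M (?G u) (?G v)) \<le> \<beta> * (L2_cell_norm (?G u) * L2_cell_norm (?G v))"
      using that by (intro field_form_bound[OF M] L2)
    also have "\<dots> \<le> \<beta> * (\<kappa> * H1_norm u * (\<kappa> * H1_norm v))"
      using L2_cell_norm_shifted_gradient[of _ x] that coeff_class_nonneg[OF M]
      by (intro mult_left_mono mult_mono) (auto simp: \<kappa>_def)
    finally show ?thesis .
  qed
  have split: "field_form M (?G (SF F)) (?G (SG F)) = field_form M (?G (f x)) (?G (g x))
      - (field_form M (?G (DF F)) (?G (g x)) + field_form M (?G (f x)) (?G (DG F)) - field_form M (?G (DF F)) (?G (DG F)))" for F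
  proof -
    have eqf: "AE y in cell_measure. ?G (f x) y = ?G (SF F) y + ?G (DF F) y"
      using shifted_gradient_add[OF S(1)[of F] D(1)[of F], of x] by (simp add: DF_def)
    have eqg: "AE y in cell_measure. ?G (g x) y = ?G (SG F) y + ?G (DG F) y"
      using shifted_gradient_add[OF S(2)[of F] D(2)[of F], of x] by (simp add: DG_def)
    note L = L2[OF S(1)[of F]] L2[OF S(2)[of F]] L2[OF D(1)[of F]] L2[OF D(2)[of F]] L2[OF fx(1)] L2[OF fx(2)]
    have refl: "AE y in cell_measure. h y = h y" for h :: "real ^ 'a \<Rightarrow> complex ^ 'a" by simp
    have 1: "field_form M (?G (f x)) h = field_form M (?G (SF F)) h + field_form M (?G (DF F)) h" if "L2_cell h" for h
      using field_form_cong_AE[OF M L(5) L2_cell_add[OF L(1,3)] that that eqf refl]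
        field_form_add_left[OF M L(1,3) that] by simp
    have 2: "field_form M h (?G (g x)) = field_form M h (?G (SG F)) + field_form M h (?G (DG F))" if "L2_cell h" for h
      using field_form_cong_AE[OF M that that L(6) L2_cell_add[OF L(2,4)] refl eqg]
        field_form_add_right[OF M L(2,4) that] by simp
    show ?thesis
      unfolding 1[OF L(6)] 1[OF L(4)] 2[OF L(1)] 2[OF L(3)] by simp
  qed
  have "((\<lambda>F. field_form M (?G (DF F)) (?G (g x)) + field_form M (?G (f x)) (?G (DG F)) - field_form M (?G (DF F)) (?G (DG F)))
      \<longlongrightarrow> 0 + 0 - 0) (finite_subsets_at_top UNIV)"
  proof (intro tendsto_add tendsto_diff)
    have "((\<lambda>F. \<beta> * (\<kappa> * H1_norm (DF F) * (\<kappa> * H1_norm (g x)))) \<longlongrightarrow> 0) (finite_subsets_at_top UNIV)"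
      using lim(1) by (auto intro!: tendsto_mult_right_zero tendsto_mult_left_zero)
    then show "((\<lambda>F. field_form M (?G (DF F)) (?G (g x))) \<longlongrightarrow> 0) (finite_subsets_at_top UNIV)"
      by (rule Lim_null_comparison[rotated]) (intro always_eventually allI bound D fx)
    have "((\<lambda>F. \<beta> * (\<kappa> * H1_norm (f x) * (\<kappa> * H1_norm (DG F)))) \<longlongrightarrow> 0) (finite_subsets_at_top UNIV)"
      using lim(2) by (auto intro!: tendsto_mult_right_zero tendsto_mult_left_zero)
    then show "((\<lambda>F. field_form M (?G (f x)) (?G (DG F))) \<longlongrightarrow> 0) (finite_subsets_at_top UNIV)"
      by (rule Lim_null_comparison[rotated]) (intro always_eventually allI bound D fx)
    have "((\<lambda>F. \<beta> * (\<kappa> * H1_norm (DF F) * (\<kappa> * H1_norm (DG F)))) \<longlongrightarrow> \<beta> * (\<kappa> * 0 * (\<kappa> * 0))) (finite_subsets_at_top UNIV)"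
      by (intro tendsto_intros lim)
    then have "((\<lambda>F. \<beta> * (\<kappa> * H1_norm (DF F) * (\<kappa> * H1_norm (DG F)))) \<longlongrightarrow> 0) (finite_subsets_at_top UNIV)" by simp
    then show "((\<lambda>F. field_form M (?G (DF F)) (?G (DG F))) \<longlongrightarrow> 0) (finite_subsets_at_top UNIV)"
      by (rule Lim_null_comparison[rotated]) (intro always_eventually allI bound D)
  qed
  then have "((\<lambda>F. field_form M (?G (f x)) (?G (g x))
      - (field_form M (?G (DF F)) (?G (g x)) + field_form M (?G (f x)) (?G (DG F)) - field_form M (?G (DF F)) (?G (DG F))))
      \<longlongrightarrow> field_form M (?G (f x)) (?G (g x)) - (0 + 0 - 0)) (finite_subsets_at_top UNIV)"
    by (intro tendsto_diff[OF tendsto_const])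
  then show ?thesis
    unfolding split[symmetric] shifted_form_eq by (simp add: SF_def SG_def)
qed

text \<open>The field \<open>(\<nabla> + i(a + h)) \<Sum>\<^sub>m h\<^sup>m c\<^sub>m\<close> is the sum of \<open>h ^ term_exp p\<close> times \<open>field_term a c p\<close>, where
  \<open>p\<close> pairs an exponent \<open>m\<close> with a part of the shifted gradient.\<close>

definition term_exp :: "('n \<Rightarrow> nat) \<times> 'n option \<Rightarrow> 'n \<Rightarrow> nat" where
  "term_exp p = add_exp (fst p) (part_exp (snd p))"

definition field_term :: "real ^ 'n \<Rightarrow> (('n \<Rightarrow> nat) \<Rightarrow> real ^ 'n \<Rightarrow> complex) \<Rightarrow> ('n \<Rightarrow> nat) \<times> 'n option \<Rightarrow> real ^ 'n \<Rightarrow> complex ^ 'n" where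
  "field_term a c p = field_part a (snd p) (c (fst p))"

lemma shifted_form_sum:
  assumes M: "M \<in> coeff_class \<alpha> \<beta>" and c: "\<And>m. c m \<in> H1_per" and d: "\<And>m. d m \<in> H1_per"
  shows "shifted_form M (a + h) (\<lambda>y. \<Sum>m\<in>F. monomial m h *\<^sub>R c m y) (\<lambda>y. \<Sum>m\<in>F. monomial m h *\<^sub>R d m y)
    = (\<Sum>(p, q)\<in>(F \<times> UNIV) \<times> (F \<times> UNIV). monomial (add_exp (term_exp p) (term_exp q)) h *\<^sub>R
         field_form M (field_term a c p) (field_term a d q))"
proof -
  have eq: "AE y in cell_measure. shifted_gradient (a + h) (\<lambda>y. \<Sum>m\<in>F. monomial m h *\<^sub>R c m y) y
      = (\<Sum>p\<in>F \<times> UNIV. monomial (term_exp p) h *\<^sub>R field_term a c p y)" if "\<And>m. c m \<in> H1_per" for c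
    using shifted_gradient_sum[of c, OF that, where a = "a + h" and I = F and r = "\<lambda>m. monomial m h"]
    by eventually_elim
      (simp add: shifted_gradient_eq_sum scaleR_sum_right sum.cartesian_product field_term_def term_exp_def case_prod_unfold)
  have L: "L2_cell (field_term a c p)" if "\<And>m. c m \<in> H1_per" for c p
    unfolding field_term_def by (intro L2_cell_field_part that)
  have "shifted_form M (a + h) (\<lambda>y. \<Sum>m\<in>F. monomial m h *\<^sub>R c m y) (\<lambda>y. \<Sum>m\<in>F. monomial m h *\<^sub>R d m y)
    = field_form M (\<lambda>y. \<Sum>p\<in>F \<times> UNIV. monomial (term_exp p) h *\<^sub>R field_term a c p y)
        (\<lambda>y. \<Sum>p\<in>F \<times> UNIV. monomial (term_exp p) h *\<^sub>R field_term a d p y)"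
    unfolding shifted_form_eq
    by (intro field_form_cong_AE[OF M] eq c d L2_cell_shifted_gradient H1_per_sum L2_cell_sum L)
  then show ?thesis
    by (simp add: field_form_sum[OF M L L, OF c d])
qed

lemma summable_on_times_real:
  fixes f :: "'a \<Rightarrow> real" and g :: "'b \<Rightarrow> real"
  assumes f: "f summable_on A" and g: "g summable_on B"
    and nonneg: "\<And>x. x \<in> A \<Longrightarrow> f x \<ge> 0" "\<And>y. y \<in> B \<Longrightarrow> g y \<ge> 0"
  shows "(\<lambda>p. f (fst p) * g (snd p)) summable_on A \<times> B"
proof (rule summable_on_SigmaI)
  show "((\<lambda>y. f (fst (x, y)) * g (snd (x, y))) has_sum f x * infsum g B) B" for x
    using has_sum_cmult_right[OF has_sum_infsum[OF g], of "f x"] by simp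
  show "(\<lambda>x. f x * infsum g B) summable_on A"
    using f by (rule summable_on_cmult_left)
qed (use nonneg in auto)

text \<open>On half the radius of the coefficient bounds, the double series of the
  form is dominated by a product of geometric series; its sum is identified along square index sets,
  where it is the form on partial sums. Grouping by total exponent then gives the coefficients.\<close>

lemma shifted_form_mpowser:
  fixes a :: "real ^ 'n"
  assumes M: "M \<in> coeff_class \<alpha> \<beta>" and f: "H1_powser f a r c" and g: "H1_powser g a r d"
  obtains \<rho> where "\<rho> \<le> r" "mpowser (\<lambda>x. shifted_form M x (f x) (g x)) a \<rho>
    (\<lambda>n. \<Sum>\<^sub>\<infinity>(p, q)\<in>{(p, q). add_exp (term_exp p) (term_exp q) = n}. field_form M (field_term a c p) (field_term a d q))"
proof -
  have r: "r > 0" using f by (simp add: H1_powser_def)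
  have c: "c m \<in> H1_per" and d: "d m \<in> H1_per" for m using f g by (simp_all add: H1_powser_def)
  define \<rho>0 where "\<rho>0 = min 1 (min r (r / (2 * norm (1 :: real ^ 'n))))"
  have n1: "norm (1 :: real ^ 'n) > 0" by simp
  have \<rho>0: "\<rho>0 > 0" "\<rho>0 \<le> 1" "\<rho>0 \<le> r" using r n1 by (auto simp: \<rho>0_def)
  have "\<rho>0 * norm (1 :: real ^ 'n) \<le> r / (2 * norm (1 :: real ^ 'n)) * norm (1 :: real ^ 'n)"
    by (intro mult_right_mono) (auto simp: \<rho>0_def)
  also have "\<dots> < r" using r n1 by simp
  finally have \<rho>0': "\<rho>0 * norm (1 :: real ^ 'n) < r" .
  obtain C1 where C1: "\<And>m. \<rho>0 ^ total_degree m * H1_norm (c m) \<le> C1"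
    using H1_powser_coeff_bound[OF f \<rho>0(1) \<rho>0'] by metis
  obtain C2 where C2: "\<And>m. \<rho>0 ^ total_degree m * H1_norm (d m) \<le> C2"
    using H1_powser_coeff_bound[OF g \<rho>0(1) \<rho>0'] by metis
  define \<rho> where "\<rho> = \<rho>0 / 2"
  have \<rho>: "\<rho> > 0" "\<rho> \<le> 1" "\<rho> \<le> r" using \<rho>0 by (auto simp: \<rho>_def)
  define \<kappa> where "\<kappa> = sqrt (2 * (1 + (norm a)\<^sup>2))"
  define K where "K = (\<lambda>(p, q). field_form M (field_term a c p) (field_term a d q))"
  define e where "e = (\<lambda>(p, q). add_exp (term_exp p) (term_exp q :: 'n \<Rightarrow> nat))"
  define G where "G p = (1 / 2 :: real) ^ total_degree (fst p)" for p :: "('n \<Rightarrow> nat) \<times> 'n option"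
  have G: "G summable_on UNIV"
  proof -
    have "(\<lambda>p. (1 / 2) ^ total_degree (fst p) * (1 :: real)) summable_on (UNIV :: ('n \<Rightarrow> nat) set) \<times> (UNIV :: 'n option set)"
      by (rule summable_on_times_real[where g = "\<lambda>_. 1"]) (auto intro!: summable_geometric_exp)
    then show ?thesis by (simp add: G_def[abs_def])
  qed
  have term_bound: "\<rho> ^ total_degree (term_exp p) * L2_cell_norm (field_term a c p) \<le> \<kappa> * C * G p"
    if c: "\<And>m. c m \<in> H1_per" and C: "\<And>m. \<rho>0 ^ total_degree m * H1_norm (c m) \<le> C" for c C p
  proof -
    have "\<rho> ^ total_degree (term_exp p) \<le> \<rho> ^ total_degree (fst p)"
      using \<rho> by (intro power_decreasing) (auto simp: term_exp_def)
    then have "\<rho> ^ total_degree (term_exp p) * L2_cell_norm (field_term a c p) \<le> \<rho> ^ total_degree (fst p) * (\<kappa> * H1_norm (c (fst p)))"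
      unfolding field_term_def \<kappa>_def using \<rho> by (intro mult_mono L2_cell_norm_field_part c) auto
    also have "\<dots> = \<kappa> * G p * (\<rho>0 ^ total_degree (fst p) * H1_norm (c (fst p)))"
      by (simp add: \<rho>_def G_def power_divide)
    also have "\<dots> \<le> \<kappa> * G p * C"
      using C[of "fst p"] by (intro mult_left_mono) (auto simp: \<kappa>_def G_def)
    finally show ?thesis by (simp add: mult_ac)
  qed
  have summ: "(\<lambda>z. \<rho> ^ total_degree (e z) * norm (K z)) summable_on UNIV"
  proof (rule summable_on_comparison_test)
    have "(\<lambda>z. G (fst z) * G (snd z)) summable_on UNIV \<times> UNIV"
      by (rule summable_on_times_real[OF G G]) (auto simp: G_def)
    then show "(\<lambda>z. \<beta> * (\<kappa> * C1) * (\<kappa> * C2) * (G (fst z) * G (snd z))) summable_on UNIV"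
      by (intro summable_on_cmult_right) simp
    fix z :: "(('n \<Rightarrow> nat) \<times> 'n option) \<times> (('n \<Rightarrow> nat) \<times> 'n option)"
    obtain p q where z: "z = (p, q)" by (cases z)
    have "norm (K z) \<le> \<beta> * (L2_cell_norm (field_term a c p) * L2_cell_norm (field_term a d q))"
      unfolding K_def z prod.case field_term_def by (intro field_form_bound[OF M] L2_cell_field_part c d)
    then have "\<rho> ^ total_degree (e z) * norm (K z)
        \<le> \<rho> ^ total_degree (e z) * (\<beta> * (L2_cell_norm (field_term a c p) * L2_cell_norm (field_term a d q)))"
      using \<rho> by (intro mult_left_mono) auto
    also have "\<dots> = \<beta> * ((\<rho> ^ total_degree (term_exp p) * L2_cell_norm (field_term a c p)) *
        (\<rho> ^ total_degree (term_exp q) * L2_cell_norm (field_term a d q)))"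
      by (simp add: e_def z power_add)
    also have "\<dots> \<le> \<beta> * ((\<kappa> * C1 * G p) * (\<kappa> * C2 * G q))"
    proof -
      have 1: "\<rho> ^ total_degree (term_exp p) * L2_cell_norm (field_term a c p) \<le> \<kappa> * C1 * G p"
        by (rule term_bound[OF c C1])
      have 2: "\<rho> ^ total_degree (term_exp q) * L2_cell_norm (field_term a d q) \<le> \<kappa> * C2 * G q"
        by (rule term_bound[OF d C2])
      have "0 \<le> \<rho> ^ total_degree (term_exp p) * L2_cell_norm (field_term a c p)"
        "0 \<le> \<rho> ^ total_degree (term_exp q) * L2_cell_norm (field_term a d q)" using \<rho> by simp_all
      with 1 2 show ?thesis
        by (intro mult_left_mono[OF mult_mono[OF 1 2]] coeff_class_nonneg[OF M]) linarith+
    qed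
    finally show "\<rho> ^ total_degree (e z) * norm (K z) \<le> \<beta> * (\<kappa> * C1) * (\<kappa> * C2) * (G (fst z) * G (snd z))"
      by (simp add: z mult_ac)
    show "0 \<le> \<rho> ^ total_degree (e z) * norm (K z)" using \<rho> by simp
  qed
  have has_sum: "((\<lambda>z. monomial (e z) h *\<^sub>R K z) has_sum shifted_form M (a + h) (f (a + h)) (g (a + h))) UNIV"
    if h: "norm h < \<rho>" for h
  proof -
    have "(\<lambda>z. norm (monomial (e z) h *\<^sub>R K z)) summable_on UNIV"
    proof (rule summable_on_comparison_test[OF summ])
      fix z show "norm (monomial (e z) h *\<^sub>R K z) \<le> \<rho> ^ total_degree (e z) * norm (K z)"
        using abs_monomial_le_norm[of h \<rho> "e z"] h by (simp add: mult_right_mono)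
    qed simp
    from abs_summable_summable[OF this] obtain L where L: "((\<lambda>z. monomial (e z) h *\<^sub>R K z) has_sum L) UNIV"
      by (auto simp: summable_on_def)
    \<comment> \<open>Partial sums over \<open>sq F\<close> are the form on the partial sums over \<open>F\<close>, and they are cofinal.\<close>
    define sq where "sq = (\<lambda>F :: ('n \<Rightarrow> nat) set. (F \<times> (UNIV :: 'n option set)) \<times> (F \<times> (UNIV :: 'n option set)))"
    have sq: "filterlim sq (finite_subsets_at_top UNIV) (finite_subsets_at_top UNIV)"
      unfolding filterlim_finite_subsets_at_top
    proof (intro allI impI)
      fix X :: "((('n \<Rightarrow> nat) \<times> 'n option) \<times> (('n \<Rightarrow> nat) \<times> 'n option)) set" assume X: "finite X \<and> X \<subseteq> UNIV"
      show "\<forall>\<^sub>F F in finite_subsets_at_top UNIV. finite (sq F) \<and> X \<subseteq> sq F \<and> sq F \<subseteq> UNIV"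
        unfolding eventually_finite_subsets_at_top
      proof (intro exI[of _ "fst ` fst ` X \<union> fst ` snd ` X"] conjI allI impI)
        fix F assume F: "finite F \<and> fst ` fst ` X \<union> fst ` snd ` X \<subseteq> F \<and> F \<subseteq> UNIV"
        show "finite (sq F)" using F by (simp add: sq_def)
        show "X \<subseteq> sq F" using F by (force simp: sq_def)
      qed (use X in auto)
    qed
    have "((\<lambda>F. \<Sum>z\<in>sq F. monomial (e z) h *\<^sub>R K z) \<longlongrightarrow> L) (finite_subsets_at_top UNIV)"
      using filterlim_compose[OF L[unfolded has_sum_def] sq] .
    moreover have "(\<Sum>z\<in>sq F. monomial (e z) h *\<^sub>R K z)
        = shifted_form M (a + h) (\<lambda>y. \<Sum>m\<in>F. monomial m h *\<^sub>R c m y) (\<lambda>y. \<Sum>m\<in>F. monomial m h *\<^sub>R d m y)" for F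
      unfolding shifted_form_sum[OF M c d] sq_def by (intro sum.cong refl) (auto simp: e_def K_def)
    moreover have "((\<lambda>F. shifted_form M (a + h) (\<lambda>y. \<Sum>m\<in>F. monomial m h *\<^sub>R c m y) (\<lambda>y. \<Sum>m\<in>F. monomial m h *\<^sub>R d m y))
        \<longlongrightarrow> shifted_form M (a + h) (f (a + h)) (g (a + h))) (finite_subsets_at_top UNIV)"
      using shifted_form_tendsto[OF M _ f g, of "a + h"] h \<rho>(3) by (simp add: dist_norm)
    ultimately have "L = shifted_form M (a + h) (f (a + h)) (g (a + h))"
      by (intro tendsto_unique[OF finite_subsets_at_top_neq_bot]) simp_all
    then show ?thesis using L by simp
  qed
  have "mpowser (\<lambda>x. shifted_form M x (f x) (g x)) a \<rho> (\<lambda>n. \<Sum>\<^sub>\<infinity>z\<in>{z. e z = n}. K z)"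
    by (rule mpowser_regroup[OF \<rho>(1) summ has_sum])
  moreover have "{z. e z = n} = {(p, q). add_exp (term_exp p) (term_exp q) = n}" for n by (auto simp: e_def)
  ultimately show ?thesis using \<rho>(3) by (intro that[of \<rho>]) (simp_all add: K_def)
qed

section \<open>Expansion to second order at the origin\<close>

lemma total_degree_eq_1:
  assumes "total_degree m = 1"
  obtains i where "m = unit_exp i"
proof -
  have "m \<noteq> (\<lambda>_. 0)" using assms by (metis total_degree_eq_0_iff zero_neq_one)
  then obtain i where i: "m i > 0" by auto
  have "total_degree m = m i + (\<Sum>j\<in>UNIV-{i}. m j)"
    unfolding total_degree_def by (rule sum.remove) auto
  then have "m i = 1" and "(\<Sum>j\<in>UNIV-{i}. m j) = 0" using assms i by linarith+
  from this(2) have "\<forall>j\<in>UNIV-{i}. m j = 0" by simp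
  with \<open>m i = 1\<close> have "m = unit_exp i" by (auto simp: unit_exp_def fun_eq_iff)
  then show ?thesis by (rule that)
qed

lemma unit_exp_inject: "unit_exp i = unit_exp k \<longleftrightarrow> i = k"
  by (auto simp: unit_exp_def fun_eq_iff split: if_splits)

lemma add_exp_unit_exp_eq:
  "add_exp (unit_exp i) (unit_exp j) = add_exp (unit_exp k) (unit_exp l) \<longleftrightarrow> i = k \<and> j = l \<or> i = l \<and> j = k"
proof
  assume "add_exp (unit_exp i) (unit_exp j) = add_exp (unit_exp k) (unit_exp l)"
  then have *: "unit_exp i x + unit_exp j x = unit_exp k x + unit_exp l x" for x
    by (simp add: add_exp_def fun_eq_iff)
  have "i = k \<or> i = l" using *[of i] by (simp add: unit_exp_def split: if_splits)
  then show "i = k \<and> j = l \<or> i = l \<and> j = k"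
  proof
    assume "i = k"
    then have "unit_exp j = unit_exp l" using * by (simp add: fun_eq_iff)
    with \<open>i = k\<close> show ?thesis by (simp add: unit_exp_inject)
  next
    assume "i = l"
    then have "unit_exp j = unit_exp k" using * by (simp add: fun_eq_iff)
    with \<open>i = l\<close> show ?thesis by (simp add: unit_exp_inject)
  qed
qed (auto simp: add_exp_def fun_eq_iff)

lemma add_exp_0 [simp]: "add_exp (\<lambda>_. 0) m = m" "add_exp m (\<lambda>_. 0) = m"
  by (simp_all add: add_exp_def)

lemma total_degree_part_exp: "total_degree (part_exp j) = (if j = None then 0 else 1)"
  by (simp add: part_exp_def split: option.split)

lemma term_exp_eq_0:
  fixes p :: "('n::finite \<Rightarrow> nat) \<times> 'n option"
  shows "term_exp p = (\<lambda>_. 0) \<longleftrightarrow> p = (\<lambda>_. 0, None)"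
proof
  assume "term_exp p = (\<lambda>_. 0)"
  then have "total_degree (fst p) + total_degree (part_exp (snd p)) = 0"
    by (metis term_exp_def total_degree_simps(1,3))
  then show "p = (\<lambda>_. 0, None)"
    by (cases p) (auto simp: total_degree_part_exp split: if_splits)
qed (simp add: term_exp_def part_exp_def)

definition unit_terms :: "'n \<Rightarrow> (('n \<Rightarrow> nat) \<times> 'n option) set" where
  "unit_terms k = {(unit_exp k, None), (\<lambda>_. 0, Some k)}"

lemma term_exp_eq_unit_exp:
  fixes p :: "('n::finite \<Rightarrow> nat) \<times> 'n option"
  shows "term_exp p = unit_exp k \<longleftrightarrow> p \<in> unit_terms k"
proof
  assume *: "term_exp p = unit_exp k"
  obtain m j where p: "p = (m, j)" by (cases p)
  show "p \<in> unit_terms k"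
  proof (cases j)
    case None
    then show ?thesis using * p by (simp add: term_exp_def part_exp_def unit_terms_def)
  next
    case (Some i)
    have "total_degree m + 1 = total_degree (unit_exp k)"
      unfolding *[symmetric] by (simp add: term_exp_def p Some part_exp_def)
    then have "m = (\<lambda>_. 0)" by simp
    then show ?thesis using * p Some by (simp add: term_exp_def part_exp_def unit_terms_def unit_exp_inject)
  qed
qed (auto simp: unit_terms_def term_exp_def part_exp_def)

lemma sum_unit_terms: "(\<Sum>p\<in>unit_terms k. f p) = f (unit_exp k, None) + f (\<lambda>_. 0, Some k)"
  by (simp add: unit_terms_def)

text \<open>When the index \<open>z\<close> of degree \<open>0\<close> does not contribute, each remaining factor has degree at least
  \<open>1\<close>, so in total degree at most two only finitely many pairs survive. For \<open>k = l\<close> the two products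
  of index sets coincide, which the factor \<open>2\<close> compensates.\<close>

lemma double_series_coeff:
  fixes K :: "('n::finite \<Rightarrow> nat) \<times> 'n option \<Rightarrow> ('n \<Rightarrow> nat) \<times> 'n option \<Rightarrow> complex"
  defines "S n \<equiv> \<Sum>\<^sub>\<infinity>(p, q)\<in>{(p, q). add_exp (term_exp p) (term_exp q) = n}. K p q"
    and "z \<equiv> (\<lambda>_. 0, None)"
  assumes left: "\<And>q. K z q = 0"
  shows "S (\<lambda>_. 0) = 0"
    and "S (unit_exp k) = (\<Sum>p\<in>unit_terms k. K p z)"
    and "(\<And>p. K p z = 0) \<Longrightarrow> (if k = l then 2 else 1) * S (add_exp (unit_exp k) (unit_exp l))
      = (\<Sum>p\<in>unit_terms k. \<Sum>q\<in>unit_terms l. K p q) + (\<Sum>p\<in>unit_terms l. \<Sum>q\<in>unit_terms k. K p q)"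
proof -
  have eq: "S n = (\<Sum>(p, q)\<in>X. K p q)"
    if "finite X" "X \<subseteq> {(p, q). add_exp (term_exp p) (term_exp q) = n}"
      "\<And>p q. add_exp (term_exp p) (term_exp q) = n \<Longrightarrow> K p q \<noteq> 0 \<Longrightarrow> (p, q) \<in> X" for n X
  proof -
    have "S n = (\<Sum>\<^sub>\<infinity>(p, q)\<in>X. K p q)"
      unfolding S_def
    proof (rule infsum_cong_neutral)
      fix pq assume "pq \<in> {(p, q). add_exp (term_exp p) (term_exp q) = n} - X"
      then show "(case pq of (p, q) \<Rightarrow> K p q) = 0"
        using that(3)[of "fst pq" "snd pq"] by (cases pq) auto
    qed (use that(2) in auto)
    then show ?thesis using that(1) by simp
  qed
  have deg: "total_degree (term_exp p) \<noteq> 0" if "K p q \<noteq> 0" for p q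
    using that left[of q] by (cases "p = z") (simp_all add: term_exp_eq_0 z_def)
  have add: "total_degree (term_exp p) + total_degree (term_exp q) = total_degree n"
    if "add_exp (term_exp p) (term_exp q) = n" for p q n
    using that by (metis total_degree_simps(1))
  have "S (\<lambda>_. 0) = (\<Sum>(p, q)\<in>{}. K p q)"
  proof (rule eq)
    fix p q assume "add_exp (term_exp p) (term_exp q) = (\<lambda>_. 0)" "K p q \<noteq> 0"
    then show "(p, q) \<in> {}" using deg[of p q] add[of p q "\<lambda>_. 0"] by simp
  qed auto
  then show "S (\<lambda>_. 0) = 0" by simp
  have z: "term_exp z = (\<lambda>_. 0)" by (simp add: term_exp_eq_0 z_def)
  have "S (unit_exp k) = (\<Sum>(p, q)\<in>unit_terms k \<times> {z}. K p q)"
  proof (rule eq)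
    show "unit_terms k \<times> {z} \<subseteq> {(p, q). add_exp (term_exp p) (term_exp q) = unit_exp k}"
      using z by (auto simp: term_exp_eq_unit_exp[symmetric])
    fix p q assume *: "add_exp (term_exp p) (term_exp q) = unit_exp k" "K p q \<noteq> 0"
    then have "total_degree (term_exp q) = 0" using deg[of p q, OF *(2)] add[OF *(1)] unfolding total_degree_simps by linarith
    then have "term_exp q = (\<lambda>_. 0)" by simp
    with * show "(p, q) \<in> unit_terms k \<times> {z}"
      by (simp add: term_exp_eq_unit_exp term_exp_eq_0[of q] z_def)
  qed (simp add: unit_terms_def)
  then show "S (unit_exp k) = (\<Sum>p\<in>unit_terms k. K p z)"
    by (simp add: sum.cartesian_product[symmetric])
  assume right: "\<And>p. K p z = 0"
  have deg': "total_degree (term_exp q) \<noteq> 0" if "K p q \<noteq> 0" for p q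
    using that right[of p] by (cases "q = z") (simp_all add: term_exp_eq_0 z_def)
  have S2: "S (add_exp (unit_exp k) (unit_exp l)) = (\<Sum>(p, q)\<in>unit_terms k \<times> unit_terms l \<union> unit_terms l \<times> unit_terms k. K p q)"
  proof (rule eq)
    show "unit_terms k \<times> unit_terms l \<union> unit_terms l \<times> unit_terms k
        \<subseteq> {(p, q). add_exp (term_exp p) (term_exp q) = add_exp (unit_exp k) (unit_exp l)}"
    proof
      fix pq assume "pq \<in> unit_terms k \<times> unit_terms l \<union> unit_terms l \<times> unit_terms k"
      then have "term_exp (fst pq) = unit_exp k \<and> term_exp (snd pq) = unit_exp l \<or>
          term_exp (fst pq) = unit_exp l \<and> term_exp (snd pq) = unit_exp k"
        unfolding term_exp_eq_unit_exp by auto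
      then show "pq \<in> {(p, q). add_exp (term_exp p) (term_exp q) = add_exp (unit_exp k) (unit_exp l)}"
        by (cases pq) (auto simp: add_exp_unit_exp_eq)
    qed
    fix p q assume *: "add_exp (term_exp p) (term_exp q) = add_exp (unit_exp k) (unit_exp l)" "K p q \<noteq> 0"
    have "total_degree (term_exp p) = 1" "total_degree (term_exp q) = 1"
      using add[OF *(1)] deg[OF *(2)] deg'[OF *(2)] unfolding total_degree_simps by linarith+
    then obtain i j where ij: "term_exp p = unit_exp i" "term_exp q = unit_exp j"
      using total_degree_eq_1[of "term_exp p"] total_degree_eq_1[of "term_exp q"] by metis
    then have "i = k \<and> j = l \<or> i = l \<and> j = k"
      using *(1) by (simp add: add_exp_unit_exp_eq)
    with ij show "(p, q) \<in> unit_terms k \<times> unit_terms l \<union> unit_terms l \<times> unit_terms k"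
      unfolding term_exp_eq_unit_exp by auto
  qed (simp add: unit_terms_def)
  show "(if k = l then 2 else 1) * S (add_exp (unit_exp k) (unit_exp l))
      = (\<Sum>p\<in>unit_terms k. \<Sum>q\<in>unit_terms l. K p q) + (\<Sum>p\<in>unit_terms l. \<Sum>q\<in>unit_terms k. K p q)"
  proof (cases "k = l")
    case True
    then show ?thesis unfolding S2 by (simp add: sum.cartesian_product)
  next
    case False
    then have "unit_terms k \<times> unit_terms l \<inter> unit_terms l \<times> unit_terms k = {}"
      by (auto simp: unit_terms_def unit_exp_inject)
    then have "(\<Sum>(p, q)\<in>unit_terms k \<times> unit_terms l \<union> unit_terms l \<times> unit_terms k. K p q)
        = (\<Sum>(p, q)\<in>unit_terms k \<times> unit_terms l. K p q) + (\<Sum>(p, q)\<in>unit_terms l \<times> unit_terms k. K p q)"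
      by (intro sum.union_disjoint) (auto simp: unit_terms_def)
    then show ?thesis unfolding S2 using False by (simp add: sum.cartesian_product)
  qed
qed

text \<open>The derivative at \<open>\<eta> = 0\<close>, in direction \<open>k\<close>, of the shifted gradient \<open>(\<nabla> + i\<eta>) f(\<eta>)\<close> of the family
  \<open>f\<close> with coefficients \<open>c\<close>.\<close>

definition first_order_field :: "(('n \<Rightarrow> nat) \<Rightarrow> real ^ 'n \<Rightarrow> complex) \<Rightarrow> 'n \<Rightarrow> real ^ 'n \<Rightarrow> complex ^ 'n" where
  "first_order_field c k y = weak_gradient (c (unit_exp k)) y + (\<i> * c (\<lambda>_. 0) y) *s axis k 1"

lemma first_order_field_eq:
  "first_order_field c k = (\<lambda>y. field_term 0 c (unit_exp k, None) y + field_term 0 c (\<lambda>_. 0, Some k) y)"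
  by (simp add: first_order_field_def field_term_def field_part_def fun_eq_iff)

lemma L2_cell_field_term: "(\<And>m. c m \<in> H1_per) \<Longrightarrow> L2_cell (field_term a c p)"
  unfolding field_term_def by (rule L2_cell_field_part)

lemma L2_cell_first_order_field: "(\<And>m. c m \<in> H1_per) \<Longrightarrow> L2_cell (first_order_field c k)"
  unfolding first_order_field_eq by (intro L2_cell_add L2_cell_field_term)

lemma field_form_first_order_field:
  assumes M: "M \<in> coeff_class \<alpha> \<beta>" and c: "\<And>m. c m \<in> H1_per"
  shows "L2_cell g \<Longrightarrow> field_form M (first_order_field c k) g = (\<Sum>p\<in>unit_terms k. field_form M (field_term 0 c p) g)"
    and "L2_cell g \<Longrightarrow> field_form M g (first_order_field c k) = (\<Sum>p\<in>unit_terms k. field_form M g (field_term 0 c p))"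
  unfolding first_order_field_eq sum_unit_terms
  by (intro field_form_add_left[OF M] field_form_add_right[OF M] L2_cell_field_term c; assumption)+

lemma field_form_AE_zero:
  assumes "AE y in cell_measure. f y = 0"
  shows "field_form M f g = 0" "field_form M g f = 0"
proof -
  have "AE y in cell_measure. cdot (cmat (M y) *v f y) (cnj_vec (g y)) = 0"
    using assms by eventually_elim (simp add: cdot_def)
  then show "field_form M f g = 0" unfolding field_form_def by (rule integral_eq_zero_AE)
  have "AE y in cell_measure. cdot (cmat (M y) *v g y) (cnj_vec (f y)) = 0"
    using assms by eventually_elim (simp add: cdot_def cnj_vec_def)
  then show "field_form M g f = 0" unfolding field_form_def by (rule integral_eq_zero_AE)
qed

text \<open>The shifted gradient vanishes at \<open>\<eta> = 0\<close> because its constant term is the gradient of the constant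
  term of the family. A form that is quadratic in it therefore starts in degree two.\<close>

lemma shifted_form_expansion:
  assumes M: "M \<in> coeff_class \<alpha> \<beta>" and f: "H1_powser f 0 r c"
    and c0: "AE y in cell_measure. weak_gradient (c (\<lambda>_. 0)) y = 0"
  obtains \<rho> C where "mpowser (\<lambda>x. shifted_form M x (f x) (f x)) 0 \<rho> C" "C (\<lambda>_. 0) = 0" "\<And>k. C (unit_exp k) = 0"
    "\<And>k l. (if k = l then 2 else 1) * C (add_exp (unit_exp k) (unit_exp l)) =
      field_form M (first_order_field c k) (first_order_field c l) + field_form M (first_order_field c l) (first_order_field c k)"
proof -
  note c = H1_powserD(2)[OF f]
  obtain \<rho> where "\<rho> \<le> r" and \<rho>: "mpowser (\<lambda>x. shifted_form M x (f x) (f x)) 0 \<rho>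
    (\<lambda>n. \<Sum>\<^sub>\<infinity>(p, q)\<in>{(p, q). add_exp (term_exp p) (term_exp q) = n}. field_form M (field_term 0 c p) (field_term 0 c q))"
    by (rule shifted_form_mpowser[OF M f f])
  have z: "field_form M (field_term 0 c (\<lambda>_. 0, None)) g = 0" "field_form M g (field_term 0 c (\<lambda>_. 0, None)) = 0" for g
    using field_form_AE_zero[OF c0] by (simp_all add: field_term_def field_part_def)
  have forms: "field_form M (first_order_field c k) (first_order_field c l)
      = (\<Sum>p\<in>unit_terms k. \<Sum>q\<in>unit_terms l. field_form M (field_term 0 c p) (field_term 0 c q))" for k l
    by (simp only: field_form_first_order_field(1)[OF M c L2_cell_first_order_field[OF c]]
        field_form_first_order_field(2)[OF M c L2_cell_field_term[OF c]])
  note coeff = double_series_coeff[of "\<lambda>p q. field_form M (field_term 0 c p) (field_term 0 c q)", OF z(1)]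
  show ?thesis
  proof (rule that[OF \<rho>])
    show "(\<Sum>\<^sub>\<infinity>(p, q)\<in>{(p, q). add_exp (term_exp p) (term_exp q) = unit_exp k}. field_form M (field_term 0 c p) (field_term 0 c q)) = 0" for k
      unfolding coeff(2) by (simp add: z)
    show "(if k = l then 2 else 1) * (\<Sum>\<^sub>\<infinity>(p, q)\<in>{(p, q). add_exp (term_exp p) (term_exp q) = add_exp (unit_exp k) (unit_exp l)}.
        field_form M (field_term 0 c p) (field_term 0 c q)) =
      field_form M (first_order_field c k) (first_order_field c l) + field_form M (first_order_field c l) (first_order_field c k)" for k l
      unfolding coeff(3)[OF z(2)] forms ..
  qed (rule coeff(1))
qed

text \<open>With a fixed second argument only one factor vanishes at the origin, so the form starts in degree
  one.\<close>

lemma shifted_form_expansion_left: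
  assumes M: "M \<in> coeff_class \<alpha> \<beta>" and f: "H1_powser f 0 r c"
    and c0: "AE y in cell_measure. weak_gradient (c (\<lambda>_. 0)) y = 0" and v: "v \<in> H1_per"
  obtains \<rho> C where "mpowser (\<lambda>x. shifted_form M x (f x) v) 0 \<rho> C" "C (\<lambda>_. 0) = 0"
    "\<And>k. C (unit_exp k) = field_form M (first_order_field c k) (weak_gradient v)"
proof -
  note c = H1_powserD(2)[OF f] and r = H1_powserD(1)[OF f]
  define d where "d = (\<lambda>m :: 'a \<Rightarrow> nat. if m = (\<lambda>_. 0) then v else (\<lambda>_. 0))"
  have d: "H1_powser (\<lambda>_. v) 0 r d" unfolding d_def by (rule H1_powser_const[OF v r])
  obtain \<rho> where "\<rho> \<le> r" and \<rho>: "mpowser (\<lambda>x. shifted_form M x (f x) v) 0 \<rho>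
    (\<lambda>n. \<Sum>\<^sub>\<infinity>(p, q)\<in>{(p, q). add_exp (term_exp p) (term_exp q) = n}. field_form M (field_term 0 c p) (field_term 0 d q))"
    by (rule shifted_form_mpowser[OF M f d])
  have z: "field_form M (field_term 0 c (\<lambda>_. 0, None)) g = 0" for g
    using field_form_AE_zero(1)[OF c0] by (simp add: field_term_def field_part_def)
  note coeff = double_series_coeff[of "\<lambda>p q. field_form M (field_term 0 c p) (field_term 0 d q)", OF z]
  have dz: "field_term 0 d (\<lambda>_. 0, None) = weak_gradient v" by (simp add: field_term_def field_part_def d_def)
  show ?thesis
  proof (rule that[OF \<rho>])
    show "(\<Sum>\<^sub>\<infinity>(p, q)\<in>{(p, q). add_exp (term_exp p) (term_exp q) = unit_exp k}. field_form M (field_term 0 c p) (field_term 0 d q))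
        = field_form M (first_order_field c k) (weak_gradient v)" for k
      unfolding coeff(2) dz by (simp add: field_form_first_order_field[OF M c] H1_per_L2_cell(2)[OF v])
  qed (rule coeff(1))
qed

section \<open>The Bloch eigenvector and the cell functions\<close>

lemma H1_powser_at_0:
  fixes f :: "real ^ 'n \<Rightarrow> real ^ 'n \<Rightarrow> complex"
  assumes f: "H1_powser f 0 r c" and f0: "AE y in lebesgue. f 0 y = e"
  shows "AE y in cell_measure. c (\<lambda>_. 0) y = e" "AE y in cell_measure. weak_gradient (c (\<lambda>_. 0)) y = 0"
proof -
  note c = H1_powserD(2)[OF f]
  have 0: "0 \<in> ball (0 :: real ^ 'n) r" using H1_powserD(1)[OF f] by simp
  note f0_H1 = H1_powserD(3)[OF f 0]
  define D where "D = (\<lambda>y. f 0 y - c (\<lambda>_. 0) y)"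
  have D: "D \<in> H1_per" unfolding D_def by (rule H1_per_diff(1)[OF f0_H1 c])
  have partial_sum: "(\<lambda>y. f 0 y - (\<Sum>m\<in>F. monomial m (0 - 0) *\<^sub>R c m y)) = D"
    if "finite F" "{(\<lambda>_. 0) :: 'n \<Rightarrow> nat} \<subseteq> F" for F
  proof
    fix y
    have "(\<Sum>m\<in>F. monomial m (0 - 0) *\<^sub>R c m y) = (\<Sum>m\<in>{(\<lambda>_. 0) :: 'n \<Rightarrow> nat}. c m y)"
      by (rule sum.mono_neutral_cong_right) (use that in \<open>auto simp: monomial_at_0\<close>)
    then show "f 0 y - (\<Sum>m\<in>F. monomial m (0 - 0) *\<^sub>R c m y) = D y" by (simp add: D_def)
  qed
  have "\<forall>\<^sub>F F in finite_subsets_at_top UNIV. H1_norm (\<lambda>y. f 0 y - (\<Sum>m\<in>F. monomial m (0 - 0) *\<^sub>R c m y)) = H1_norm D"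
    unfolding eventually_finite_subsets_at_top
    by (intro exI[of _ "{(\<lambda>_. 0) :: 'n \<Rightarrow> nat}"]) (use partial_sum in auto)
  then have "((\<lambda>F. H1_norm (\<lambda>y. f 0 y - (\<Sum>m\<in>F. monomial m (0 - 0) *\<^sub>R c m y))) \<longlongrightarrow> H1_norm D) (finite_subsets_at_top UNIV)"
    by (rule tendsto_eventually)
  then have "H1_norm D = 0"
    using H1_powserD(4)[OF f 0] by (rule tendsto_unique[OF finite_subsets_at_top_neq_bot])
  note D0 = H1_norm_eq_0[OF D this]
  show "AE y in cell_measure. c (\<lambda>_. 0) y = e"
    using D0(1) AE_cell[OF f0] by eventually_elim (simp add: D_def)
  show "AE y in cell_measure. weak_gradient (c (\<lambda>_. 0)) y = 0"
    using D0(2) AE_cell[OF weak_gradient_AE_const[OF f0_H1 f0]] AE_cell[OF H1_per_diff(2)[OF f0_H1 c[of "\<lambda>_. 0"]]]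
    by eventually_elim (simp add: D_def)
qed

lemma norm_L2_inner_le:
  assumes "u \<in> H1_per" "v \<in> H1_per"
  shows "norm (L2_inner u v) \<le> L2_norm u * L2_norm v"
proof -
  have m: "u \<in> borel_measurable cell_measure" "v \<in> borel_measurable cell_measure"
    and i: "integrable cell_measure (\<lambda>y. (norm (u y))\<^sup>2)" "integrable cell_measure (\<lambda>y. (norm (v y))\<^sup>2)"
    using H1_per_L2_cell(1)[OF assms(1)] H1_per_L2_cell(1)[OF assms(2)] by (auto simp: L2_cell_def)
  have uv: "integrable cell_measure (\<lambda>y. norm (u y) * norm (v y))"
  proof (rule Bochner_Integration.integrable_bound)
    show "integrable cell_measure (\<lambda>y. (norm (u y))\<^sup>2 + (norm (v y))\<^sup>2)" using i by simp
    show "AE y in cell_measure. norm (norm (u y) * norm (v y)) \<le> norm ((norm (u y))\<^sup>2 + (norm (v y))\<^sup>2)"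
    proof (intro AE_I2)
      fix y
      have "norm (u y) * norm (v y) \<ge> 0" by simp
      then have "norm (u y) * norm (v y) \<le> (norm (u y))\<^sup>2 + (norm (v y))\<^sup>2"
        using sum_squares_bound[of "norm (u y)" "norm (v y)"] unfolding mult.assoc by linarith
      then show "norm (norm (u y) * norm (v y)) \<le> norm ((norm (u y))\<^sup>2 + (norm (v y))\<^sup>2)" by simp
    qed
  qed (use m in measurable)
  have "norm (L2_inner u v) \<le> (LINT y|cell_measure. norm (u y * cnj (v y)))"
    unfolding L2_inner_def set_integral_cell by (rule integral_norm_bound)
  also have "\<dots> = (LINT y|cell_measure. norm (u y) * norm (v y))" by (simp add: norm_mult)
  also have "\<dots> \<le> L2_norm u * L2_norm v"
    unfolding L2_norm_def set_integral_cell
    using integral_Cauchy_Schwarz[OF i uv] by simp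
  finally show ?thesis .
qed

lemma L2_inner_self: "L2_inner u u = complex_of_real ((L2_norm u)\<^sup>2)"
proof -
  have "L2_inner u u = (LINT y|cell_measure. complex_of_real ((norm (u y))\<^sup>2))"
    unfolding L2_inner_def set_integral_cell by (simp only: complex_norm_square)
  also have "\<dots> = complex_of_real (LINT y|cell_measure. (norm (u y))\<^sup>2)"
    by (rule integral_complex_of_real)
  also have "(LINT y|cell_measure. (norm (u y))\<^sup>2) = (L2_norm u)\<^sup>2"
    unfolding L2_norm_def set_integral_cell by (intro real_sqrt_pow2[symmetric] integral_nonneg_AE) simp
  finally show ?thesis .
qed

text \<open>If \<open>g = o(t)\<close> and \<open>h\<close> is bounded, then \<open>g h = o(t)\<close>.\<close>

lemma vector_derivative_zero_mult_bounded:
  fixes g :: "real \<Rightarrow> complex" and h :: "real \<Rightarrow> complex"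
  assumes g: "(g has_vector_derivative 0) (at 0)" "g 0 = 0"
    and f: "(f has_vector_derivative D) (at 0)"
    and "d > 0" and eq: "\<And>t. \<bar>t\<bar> < d \<Longrightarrow> f t = g t * h t" and h: "\<And>t. \<bar>t\<bar> < d \<Longrightarrow> norm (h t) \<le> B"
  shows "D = 0"
proof -
  have "(\<lambda>t. g t /\<^sub>R t) \<midarrow>0\<rightarrow> 0"
    using g by (simp add: has_vector_derivative_def has_derivative_at tendsto_norm_zero_iff[of "\<lambda>t. g t /\<^sub>R t", symmetric] divide_inverse mult.commute)
  then have "(\<lambda>t. norm (g t /\<^sub>R t) * B) \<midarrow>0\<rightarrow> 0"
    by (intro tendsto_mult_left_zero tendsto_norm_zero)
  then have "(\<lambda>t. f t /\<^sub>R t) \<midarrow>0\<rightarrow> 0"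
  proof (rule Lim_null_comparison[rotated])
    have bound: "norm (f t /\<^sub>R t) \<le> norm (g t /\<^sub>R t) * B" if "\<bar>t\<bar> < d" for t
    proof -
      have "norm (f t /\<^sub>R t) = norm (g t /\<^sub>R t) * norm (h t)" using eq[OF that] by (simp add: norm_mult)
      also have "\<dots> \<le> norm (g t /\<^sub>R t) * B" by (intro mult_left_mono h that norm_ge_zero)
      finally show ?thesis .
    qed
    show "\<forall>\<^sub>F t in at 0. norm (f t /\<^sub>R t) \<le> norm (g t /\<^sub>R t) * B"
      unfolding eventually_at
    proof (intro exI[of _ d] conjI ballI impI \<open>d > 0\<close>)
      fix t :: real assume "t \<noteq> 0 \<and> dist t 0 < d"
      then show "norm (f t /\<^sub>R t) \<le> norm (g t /\<^sub>R t) * B" by (intro bound) simp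
    qed
  qed
  moreover have "f 0 = 0" using eq[of 0] \<open>d > 0\<close> g(2) by simp
  ultimately have "(f has_vector_derivative 0) (at 0)"
    by (simp add: has_vector_derivative_def has_derivative_at tendsto_norm_zero_iff[of "\<lambda>t. f t /\<^sub>R t", symmetric] divide_inverse mult.commute)
  then show ?thesis using vector_derivative_unique_at[OF f] by simp
qed

lemma cell_functionD:
  assumes "cell_function A k w"
  shows "w \<in> H1_per" and "v \<in> H1_per \<Longrightarrow> field_form A (\<lambda>y. weak_gradient w y + axis k 1) (weak_gradient v) = 0"
  using assms by (auto simp: cell_function_def field_form_def set_integral_cell)

lemma L2_cell_corrected:
  "w \<in> H1_per \<Longrightarrow> L2_cell (\<lambda>y. weak_gradient w y + axis k 1)"
  by (intro L2_cell_add H1_per_L2_cell L2_loc_imp_L2_cell[OF L2_loc_const])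

lemma cnj_vec_cnj_vec [simp]: "cnj_vec (cnj_vec z) = z"
  by (simp add: cnj_vec_def vec_eq_iff)

lemma cmat_mult_cnj_vec: "cmat M *v cnj_vec z = cnj_vec (cmat M *v z)"
  by (simp add: vec_eq_iff cmat_mult_nth cnj_vec_def)

lemma cdot_cnj_vec: "cdot (cnj_vec z) (cnj_vec w) = cnj (cdot z w)"
  by (simp add: cdot_def cnj_vec_def)

lemma field_form_cnj: "field_form M (\<lambda>y. cnj_vec (f y)) (\<lambda>y. cnj_vec (g y)) = cnj (field_form M f g)"
  unfolding field_form_def cmat_mult_cnj_vec cdot_cnj_vec by (rule Bochner_Integration.integral_cnj)

lemma H1_per_cnj:
  assumes "u \<in> H1_per"
  shows "(\<lambda>y. cnj (u y)) \<in> H1_per"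
    and "AE y in lebesgue. weak_gradient (\<lambda>y. cnj (u y)) y = cnj_vec (weak_gradient u y)"
  using H1_per_linear[OF assms bounded_linear_cnj] by (simp_all add: cnj_vec_def)

lemma H1_per_cmult:
  assumes "u \<in> H1_per"
  shows "(\<lambda>y. a * u y) \<in> H1_per"
    and "AE y in lebesgue. weak_gradient (\<lambda>y. a * u y) y = a *s weak_gradient u y"
  using H1_per_linear[OF assms bounded_linear_mult_right[of a]] by (simp_all add: vector_scalar_mult_def)

lemma L2_cell_smult: "L2_cell f \<Longrightarrow> L2_cell (\<lambda>y. a *s f y)" for f :: "real ^ 'n \<Rightarrow> complex ^ 'n"
  by (rule L2_cell_linear, assumption)
     (intro linear_conv_bounded_linear[THEN iffD1] linearI; simp add: vec_eq_iff algebra_simps)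

text \<open>Two solutions of the weak equation that differ by a periodic gradient coincide: the difference
  may be tested with itself.\<close>

lemma cell_gradient_unique:
  assumes A: "A \<in> coeff_class \<alpha> \<beta>" "\<alpha> > 0"
    and f: "L2_cell f" "\<And>v. v \<in> H1_per \<Longrightarrow> field_form A f (weak_gradient v) = 0"
    and g: "L2_cell g" "\<And>v. v \<in> H1_per \<Longrightarrow> field_form A g (weak_gradient v) = 0"
    and w: "w \<in> H1_per" "AE y in cell_measure. weak_gradient w y = f y - g y"
  shows "AE y in cell_measure. f y = g y"
proof -
  have L: "L2_cell (\<lambda>y. (-1) *s g y)" by (rule L2_cell_smult[OF g(1)])
  have "field_form A (weak_gradient w) (weak_gradient w) = field_form A (\<lambda>y. f y + (-1) *s g y) (weak_gradient w)"
  proof (rule field_form_cong_AE[OF A(1)])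
    show "AE y in cell_measure. weak_gradient w y = f y + (-1) *s g y"
      using w(2) by eventually_elim (simp add: vec_eq_iff)
  qed (use H1_per_L2_cell(2)[OF w(1)] L2_cell_add[OF f(1) L] in auto)
  also have "\<dots> = field_form A f (weak_gradient w) + field_form A (\<lambda>y. (-1) *s g y) (weak_gradient w)"
    by (rule field_form_add_left[OF A(1) f(1) L H1_per_L2_cell(2)[OF w(1)]])
  also have "\<dots> = 0"
    by (simp only: field_form_smult f(2)[OF w(1)] g(2)[OF w(1)] mult_zero_right add_0)
  finally have "AE y in cell_measure. weak_gradient w y = 0"
    by (rule field_form_coercive[OF A H1_per_L2_cell(2)[OF w(1)]])
  then show ?thesis using w(2) by eventually_elim simp
qed

text \<open>The matrix \<open>A\<close> and the source \<open>e\<^sub>k\<close> are real, so conjugation maps solutions to solutions. Reality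
  reconciles the conjugated form with the bilinear one in the definition of \<open>relative_limit\<close>.\<close>

lemma cell_function_real:
  assumes A: "A \<in> coeff_class \<alpha> \<beta>" "\<alpha> > 0" and w: "cell_function A k w"
  shows "AE y in cell_measure. cnj_vec (weak_gradient w y + axis k 1) = weak_gradient w y + axis k 1"
proof (rule cell_gradient_unique[OF A])
  note w' = cell_functionD[OF w]
  let ?X = "\<lambda>y. weak_gradient w y + axis k 1"
  have "bounded_linear (cnj_vec :: complex ^ 'a \<Rightarrow> complex ^ 'a)"
    by (intro linear_conv_bounded_linear[THEN iffD1] linearI) (simp_all add: vec_eq_iff cnj_vec_def)
  then show X': "L2_cell (\<lambda>y. cnj_vec (?X y))" by (rule L2_cell_linear[OF L2_cell_corrected[OF w'(1)]])
  show X: "L2_cell ?X" by (rule L2_cell_corrected[OF w'(1)])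
  show "field_form A ?X (weak_gradient v) = 0" if "v \<in> H1_per" for v by (rule w'(2)[OF that])
  show "field_form A (\<lambda>y. cnj_vec (?X y)) (weak_gradient v) = 0" if v: "v \<in> H1_per" for v
  proof -
    note vc = H1_per_cnj[OF v]
    have L: "L2_cell (\<lambda>y. cnj_vec (weak_gradient (\<lambda>y. cnj (v y)) y))"
      by (rule L2_cell_linear[OF H1_per_L2_cell(2)[OF vc(1)]]) fact
    have "field_form A (\<lambda>y. cnj_vec (?X y)) (weak_gradient v)
        = field_form A (\<lambda>y. cnj_vec (?X y)) (\<lambda>y. cnj_vec (weak_gradient (\<lambda>y. cnj (v y)) y))"
    proof (rule field_form_cong_AE[OF A(1) X' X' H1_per_L2_cell(2)[OF v] L])
      show "AE y in cell_measure. weak_gradient v y = cnj_vec (weak_gradient (\<lambda>y. cnj (v y)) y)"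
        using AE_cell[OF vc(2)] by eventually_elim simp
    qed simp
    then show ?thesis by (simp add: field_form_cnj w'(2)[OF vc(1)])
  qed
  show "(\<lambda>y. cnj (w y) - w y) \<in> H1_per" by (rule H1_per_diff(1)[OF H1_per_cnj(1)[OF w'(1)] w'(1)])
  show "AE y in cell_measure. weak_gradient (\<lambda>y. cnj (w y) - w y) y = cnj_vec (?X y) - ?X y"
    using AE_cell[OF H1_per_diff(2)[OF H1_per_cnj(1)[OF w'(1)] w'(1)]] AE_cell[OF H1_per_cnj(2)[OF w'(1)]]
    by eventually_elim (simp add: cnj_vec_linear, simp add: cnj_vec_def vec_eq_iff axis_def)
qed

text \<open>Testing the eigenvalue equation with the normalized eigenvector identifies the eigenvalue with the
  form, which has no terms of degree below two. The right-hand side \<open>\<lambda>(\<eta>) \<langle>\<phi>(\<eta>), v\<rangle>\<close> then has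
  derivative \<open>0\<close> at the origin, and comparison with the first-order term on the left gives the
  equation of the cell problem.\<close>

lemma first_order_field_orthogonal:
  assumes A: "A \<in> coeff_class \<alpha> \<beta>" and "\<delta> > 0"
    and eig: "\<And>\<eta>. \<eta> \<in> ball 0 \<delta> \<Longrightarrow> bloch_eigenvector A \<eta> (lam \<eta>) (\<phi> \<eta>)"
    and norm: "\<And>\<eta>. \<eta> \<in> ball 0 \<delta> \<Longrightarrow> L2_norm (\<phi> \<eta>) = 1"
    and \<phi>: "H1_powser \<phi> 0 r c" and c0: "AE y in cell_measure. weak_gradient (c (\<lambda>_. 0)) y = 0"
    and v: "v \<in> H1_per"
  shows "field_form A (first_order_field c k) (weak_gradient v) = 0"
proof -
  obtain \<rho> C where "mpowser (\<lambda>x. shifted_form A x (\<phi> x) (\<phi> x)) 0 \<rho> C" "C (\<lambda>_. 0) = 0" "\<And>k. C (unit_exp k) = 0"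
    using shifted_form_expansion[OF A \<phi> c0] by metis
  note g = mpowser_deriv_at_center(1)[OF this(1), of k, unfolded this(3)] mpowser_at_center[OF this(1), unfolded this(2)]
  obtain \<rho>' C' where "mpowser (\<lambda>x. shifted_form A x (\<phi> x) v) 0 \<rho>' C'" "C' (\<lambda>_. 0) = 0"
    "\<And>k. C' (unit_exp k) = field_form A (first_order_field c k) (weak_gradient v)"
    using shifted_form_expansion_left[OF A \<phi> c0 v] by metis
  note f = mpowser_deriv_at_center(1)[OF this(1), of k, unfolded this(3)]
  show ?thesis
  proof (rule vector_derivative_zero_mult_bounded[OF _ _ f \<open>\<delta> > 0\<close>])
    show "((\<lambda>t. shifted_form A (0 + t *\<^sub>R axis k 1) (\<phi> (0 + t *\<^sub>R axis k 1)) (\<phi> (0 + t *\<^sub>R axis k 1))) has_vector_derivative 0) (at 0)"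
      by (rule g(1))
    show "shifted_form A (0 + 0 *\<^sub>R axis k 1) (\<phi> (0 + 0 *\<^sub>R axis k 1)) (\<phi> (0 + 0 *\<^sub>R axis k 1)) = 0" using g(2) by simp
    fix t :: real assume "\<bar>t\<bar> < \<delta>"
    then have t: "0 + t *\<^sub>R axis k 1 \<in> ball (0 :: real ^ 'a) \<delta>" by simp
    define x :: "real ^ 'a" where "x = 0 + t *\<^sub>R axis k 1"
    have \<phi>x: "\<phi> x \<in> H1_per" and eq: "\<And>v. v \<in> H1_per \<Longrightarrow> shifted_form A x (\<phi> x) v = complex_of_real (lam x) * L2_inner (\<phi> x) v"
      using eig[OF t] by (auto simp: bloch_eigenvector_def x_def)
    have "shifted_form A x (\<phi> x) (\<phi> x) = complex_of_real (lam x)"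
      using eq[OF \<phi>x] norm[OF t] by (simp add: L2_inner_self x_def)
    then show "shifted_form A (0 + t *\<^sub>R axis k 1) (\<phi> (0 + t *\<^sub>R axis k 1)) v
      = shifted_form A (0 + t *\<^sub>R axis k 1) (\<phi> (0 + t *\<^sub>R axis k 1)) (\<phi> (0 + t *\<^sub>R axis k 1)) * L2_inner (\<phi> (0 + t *\<^sub>R axis k 1)) v"
      using eq[OF v] by (simp add: x_def)
    show "norm (L2_inner (\<phi> (0 + t *\<^sub>R axis k 1)) v) \<le> L2_norm v"
      using norm_L2_inner_le[OF \<phi>x v] norm[OF t] by (simp add: x_def)
  qed
qed

text \<open>This is \<open>\<partial>\<^sub>k\<phi>(0) = i \<chi>\<^sub>k\<close> up to an additive constant. Both sides solve the same weak equation, and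
  as the constant coefficient is \<open>1\<close> the parts along \<open>e\<^sub>k\<close> cancel in the difference, which is thus a periodic gradient.\<close>

lemma first_order_field_eq_cell_function:
  assumes A: "A \<in> coeff_class \<alpha> \<beta>" "\<alpha> > 0" and c: "\<And>m. c m \<in> H1_per" and c0: "AE y in cell_measure. c (\<lambda>_. 0) y = 1"
    and orth: "\<And>v. v \<in> H1_per \<Longrightarrow> field_form A (first_order_field c k) (weak_gradient v) = 0"
    and w: "cell_function A k w"
  shows "AE y in cell_measure. first_order_field c k y = \<i> *s (weak_gradient w y + axis k 1)"
proof (rule cell_gradient_unique[OF A L2_cell_first_order_field[OF c] orth])
  note w' = cell_functionD[OF w]
  show "L2_cell (\<lambda>y. \<i> *s (weak_gradient w y + axis k 1))"
    by (rule L2_cell_smult[OF L2_cell_corrected[OF w'(1)]])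
  show "field_form A (\<lambda>y. \<i> *s (weak_gradient w y + axis k 1)) (weak_gradient v) = 0" if "v \<in> H1_per" for v
    by (simp only: field_form_smult w'(2)[OF that] mult_zero_right)
  note iw = H1_per_cmult[OF w'(1), of \<i>]
  show "(\<lambda>y. c (unit_exp k) y - \<i> * w y) \<in> H1_per" by (rule H1_per_diff(1)[OF c iw(1)])
  show "AE y in cell_measure. weak_gradient (\<lambda>y. c (unit_exp k) y - \<i> * w y) y
      = first_order_field c k y - \<i> *s (weak_gradient w y + axis k 1)"
    using AE_cell[OF H1_per_diff(2)[OF c[of "unit_exp k"] iw(1)]] AE_cell[OF iw(2)] c0
    by eventually_elim (simp add: first_order_field_def vec_eq_iff algebra_simps)
qed

text \<open>The symmetry in \<open>k\<close> and \<open>l\<close> is inherited from \<open>B\<close>, since the bilinear dot product involves no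
  conjugation.\<close>

lemma relative_limit_eq:
  assumes A: "A \<in> coeff_class \<alpha> \<beta>" "\<alpha> > 0" and B: "B \<in> coeff_class \<alpha>' \<beta>'"
    and chi: "\<And>k. cell_function A k (chi k)"
  defines "X k y \<equiv> weak_gradient (chi k) y + axis k 1"
  shows "field_form B (X k) (X l) = relative_limit B chi k l"
    and "relative_limit B chi k l = relative_limit B chi l k"
proof -
  note real = cell_function_real[OF A chi, folded X_def]
  have LX: "L2_cell (X k)" for k
    unfolding X_def by (rule L2_cell_corrected[OF cell_functionD(1)[OF chi]])
  have rl: "relative_limit B chi k l = (LINT y|cell_measure. cdot (cmat (B y) *v X k y) (X l y))" for k l
    by (simp add: relative_limit_def set_integral_cell X_def)
  have form: "field_form B (X k) (X l) = relative_limit B chi k l"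
    and int: "integrable cell_measure (\<lambda>y. cdot (cmat (B y) *v X k y) (X l y))" for k l
  proof -
    have L: "L2_cell (\<lambda>y. cnj_vec (X l y))"
      by (rule L2_cell_linear[OF LX])
         (intro linear_conv_bounded_linear[THEN iffD1] linearI; simp add: vec_eq_iff cnj_vec_def)
    have int: "integrable cell_measure (\<lambda>y. cdot (cmat (B y) *v X k y) (X l y))" for k
      using field_form_integrand(2)[OF B LX[of k] L] by simp
    have "field_form B (X k) (X l) = field_form B (X k) (\<lambda>y. cnj_vec (X l y))"
    proof (rule field_form_cong_AE[OF B LX LX LX L])
      show "AE y in cell_measure. X l y = cnj_vec (X l y)" using real[of l] by eventually_elim simp
    qed simp
    then show "field_form B (X k) (X l) = relative_limit B chi k l" by (simp add: field_form_def rl)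
    show "integrable cell_measure (\<lambda>y. cdot (cmat (B y) *v X k y) (X l y))" by (rule int)
  qed
  show "field_form B (X k) (X l) = relative_limit B chi k l" by (rule form)
  show "relative_limit B chi k l = relative_limit B chi l k"
    unfolding rl
  proof (rule integral_cong_AE)
    show "AE y in cell_measure. cdot (cmat (B y) *v X k y) (X l y) = cdot (cmat (B y) *v X l y) (X k y)"
      using coeff_classD(2)[OF B] by eventually_elim (rule cdot_cmat_symmetric)
  qed (use int in auto)
qed

lemma nu1_eq: "nu1 B \<phi> = (\<lambda>\<eta>. shifted_form B \<eta> (\<phi> \<eta>) (\<phi> \<eta>))"
  by (simp add: nu1_def fun_eq_iff measure_cell)

theorem mainTheorem2:
  fixes A B :: "real ^ 'n \<Rightarrow> real ^ 'n ^ 'n"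
    and a1 a2 b1 b2 \<delta> :: real
    and \<phi> :: "real ^ 'n \<Rightarrow> real ^ 'n \<Rightarrow> complex"
    and chi :: "'n \<Rightarrow> real ^ 'n \<Rightarrow> complex"
  assumes "0 < a1" "a1 \<le> a2" "0 < b1" "b1 \<le> b2"
    and "A \<in> coeff_class a1 a2" "periodic A"
    and "B \<in> coeff_class b1 b2" "periodic B"
    and cell_functions: "\<And>k. cell_function A k (chi k)"
    and "\<delta> > 0"
    and lambda1_analytic: "real_analytic_on (bloch_lambda1 A) (ball 0 \<delta>)"
    and eigenvector: "\<And>\<eta>. \<eta> \<in> ball 0 \<delta> \<Longrightarrow> bloch_eigenvector A \<eta> (bloch_lambda1 A \<eta>) (\<phi> \<eta>)"
    and phi_analytic: "H1_analytic_on \<phi> (ball 0 \<delta>)"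
    and phi_0: "AE y in lebesgue. \<phi> 0 y = complex_of_real (measure lebesgue (cell :: (real ^ 'n) set) powr (- 1 / 2))"
    and phi_norm: "\<And>\<eta>. \<eta> \<in> ball 0 \<delta> \<Longrightarrow> L2_norm (\<phi> \<eta>) = 1"
    and phi_phase: "\<And>\<eta>. \<eta> \<in> ball 0 \<delta> \<Longrightarrow> Im (LINT y:cell|lebesgue. \<phi> \<eta> y) = 0"
  shows "real_analytic_on (nu1 B \<phi>) (ball 0 \<delta>) \<and>
    nu1 B \<phi> 0 = 0 \<and>
    (\<forall>k. partial_deriv k (nu1 B \<phi>) 0 = 0) \<and>
    (\<forall>k l. 1 / 2 * partial_deriv k (partial_deriv l (nu1 B \<phi>)) 0 = relative_limit B chi k l)"
proof -
  note A = \<open>A \<in> coeff_class a1 a2\<close> and B = \<open>B \<in> coeff_class b1 b2\<close>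
  have analytic: "real_analytic_on (nu1 B \<phi>) (ball 0 \<delta>)"
  proof (rule real_analytic_on_mpowser)
    fix a :: "real ^ 'n" assume "a \<in> ball 0 \<delta>"
    then obtain r c where rc: "H1_powser \<phi> a r c" "ball a r \<subseteq> ball 0 \<delta>"
      using H1_analytic_on_powser[OF phi_analytic] by metis
    obtain \<rho> C where "\<rho> \<le> r" "mpowser (nu1 B \<phi>) a \<rho> C"
      using shifted_form_mpowser[OF B rc(1) rc(1), folded nu1_eq] by metis
    then show "\<exists>\<rho> c. mpowser (nu1 B \<phi>) a \<rho> c \<and> ball a \<rho> \<subseteq> ball 0 \<delta>"
      using rc(2) subset_ball by blast
  qed
  obtain r c where \<phi>: "H1_powser \<phi> 0 r c"
    using H1_analytic_on_powser[OF phi_analytic, of 0] \<open>\<delta> > 0\<close> by (metis centre_in_ball)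
  have "AE y in lebesgue. \<phi> 0 y = 1" using phi_0 by (simp add: measure_cell)
  note c0 = H1_powser_at_0[OF \<phi> this] and c = H1_powserD(2)[OF \<phi>]
  define X where "X k y = weak_gradient (chi k) y + axis k 1" for k y
  have LX: "L2_cell (X k)" for k
    unfolding X_def by (rule L2_cell_corrected[OF cell_functionD(1)[OF cell_functions]])
  have "field_form A (first_order_field c k) (weak_gradient v) = 0" if "v \<in> H1_per" for k v
    by (rule first_order_field_orthogonal[OF A \<open>\<delta> > 0\<close> eigenvector phi_norm \<phi> c0(2) that])
  note first_order = first_order_field_eq_cell_function[OF A \<open>0 < a1\<close> c c0(1) this cell_functions, folded X_def]
  have form: "field_form B (first_order_field c k) (first_order_field c l) = relative_limit B chi k l" for k l
  proof -
    have "field_form B (first_order_field c k) (first_order_field c l) = field_form B (\<lambda>y. \<i> *s X k y) (\<lambda>y. \<i> *s X l y)"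
      by (intro field_form_cong_AE[OF B] L2_cell_first_order_field c L2_cell_smult LX first_order)
    also have "\<dots> = field_form B (X k) (X l)" by (simp add: field_form_smult)
    also have "\<dots> = relative_limit B chi k l"
      using relative_limit_eq(1)[OF A \<open>0 < a1\<close> B cell_functions] by (simp add: X_def[abs_def])
    finally show ?thesis .
  qed
  obtain \<rho> C where C: "mpowser (nu1 B \<phi>) 0 \<rho> C" "C (\<lambda>_. 0) = 0" "\<And>k. C (unit_exp k) = 0"
    "\<And>k l. (if k = l then 2 else 1) * C (add_exp (unit_exp k) (unit_exp l)) = relative_limit B chi k l + relative_limit B chi l k"
    using shifted_form_expansion[OF B \<phi> c0(2), folded nu1_eq, unfolded form] by metis
  have "1 / 2 * partial_deriv k (partial_deriv l (nu1 B \<phi>)) 0 = relative_limit B chi k l" for k l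
    using relative_limit_eq(2)[OF A \<open>0 < a1\<close> B cell_functions, of l k]
    by (simp add: mpowser_deriv_at_center(3)[OF C(1)] C(4))
  then show ?thesis
    using analytic mpowser_at_center[OF C(1)] mpowser_deriv_at_center(2)[OF C(1)] C(2,3) by simp
qed

end
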